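(* Let $n\ge 2$, let $\Omega\subset\mathbb{R}^n$ be a non-empty bounded open set, and let $U$ be a non-empty open subset of $\mathcal{S}^{n\times n}$ such that (i) if $A\in U$, $B\in\mathcal{S}^{n\times n}$ and $B>0$, then $A+B\in U$; (ii) if $A\in U$ and $c>0$, then $cA\in U$. Let $\alpha,\beta\in\mathbb{R}$ be constants and $$F[\psi]=\nabla^2\psi+\alpha\,\nabla\psi\otimes\nabla\psi-\beta|\nabla\psi|^2 I .$$ Then for any $\varphi\in C^0(\partial\Omega)$ there exists at most one $\psi\in C^0(\overline\Omega)$ which satisfies $F[\psi]\in\partial U$ in $\Omega$ in the viscosity sense and $\psi=\varphi$ on $\partial\Omega$.
   Context: $\mathcal{S}^{n\times n}$ is the space of real symmetric $n\times n$ matrices, $B>0$ means positive definite, $I$ is the identity matrix, $(p\otimes q)_{ij}=p_iq_j$. Viscosity solution: $\psi\in C^0(\Omega)$ satisfies $F[\psi]\in\partial U$ in $\Omega$ in the viscosity sense if for every $x_0\in\Omega$ and $\varphi\in C^2(\Omega)$ with $(\psi-\varphi)(x_0)=0$: if $\psi-\varphi\le0$ near $x_0$ then $F[\varphi](x_0)\in\overline U$; and if $\psi-\varphi\ge0$ near $x_0$ then $F[\varphi](x_0)\in\mathcal{S}^{n\times n}\setminus U$. *)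

theory Defs
  imports "HOL-Analysis.Analysis"
begin

definition sym_matrices :: "(real^'n^'n) set" where
  "sym_matrices = {A. transpose A = A}"

definition pos_def :: "real^'n^'n \<Rightarrow> bool" where
  "pos_def B \<longleftrightarrow> B \<in> sym_matrices \<and> (\<forall>v. v \<noteq> 0 \<longrightarrow> v \<bullet> (B *v v) > 0)"

definition outer :: "real^'n \<Rightarrow> real^'n \<Rightarrow> real^'n^'n" where
  "outer p q = (\<chi> i j. p $ i * q $ j)"

definition grad :: "(real^'n \<Rightarrow> real) \<Rightarrow> real^'n \<Rightarrow> real^'n" where
  "grad f x = (\<chi> i. frechet_derivative f (at x) (axis i 1))"

definition hess :: "(real^'n \<Rightarrow> real) \<Rightarrow> real^'n \<Rightarrow> real^'n^'n" where
  "hess f x = jacobian (grad f) (at x)"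

(* Meant for open sets. Functions on the open set are represented by total functions; every notion
   below depends only on the values on the open set. *)
definition C2_on :: "(real^'n) set \<Rightarrow> (real^'n \<Rightarrow> real) \<Rightarrow> bool" where
  "C2_on \<Omega> f \<longleftrightarrow>
     (\<forall>x\<in>\<Omega>. f differentiable (at x)) \<and>
     (\<forall>x\<in>\<Omega>. grad f differentiable (at x)) \<and>
     continuous_on \<Omega> (hess f)"

definition F_op :: "real \<Rightarrow> real \<Rightarrow> (real^'n \<Rightarrow> real) \<Rightarrow> real^'n \<Rightarrow> real^'n^'n" where
  "F_op \<alpha> \<beta> f x =
     hess f x + \<alpha> *\<^sub>R outer (grad f x) (grad f x) - (\<beta> * (norm (grad f x))\<^sup>2) *\<^sub>R mat 1"

(* F[psi] \<in> \<partial>U in the viscosity sense, for an open set \<Omega> and U relatively open in the symmetric matrices.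
   The symmetric matrices are a closed subspace, so the ambient closure of U is also its closure there. *)
definition viscosity_boundary ::
  "((real^'n \<Rightarrow> real) \<Rightarrow> real^'n \<Rightarrow> real^'n^'n) \<Rightarrow> (real^'n^'n) set \<Rightarrow> (real^'n) set
     \<Rightarrow> (real^'n \<Rightarrow> real) \<Rightarrow> bool" where
  "viscosity_boundary F U \<Omega> \<psi> \<longleftrightarrow>
     continuous_on \<Omega> \<psi> \<and>
     (\<forall>x0\<in>\<Omega>. \<forall>\<phi>. C2_on \<Omega> \<phi> \<and> \<psi> x0 - \<phi> x0 = 0 \<longrightarrow>
        ((\<forall>\<^sub>F x in nhds x0. \<psi> x - \<phi> x \<le> 0) \<longrightarrow> F \<phi> x0 \<in> closure U) \<and>
        ((\<forall>\<^sub>F x in nhds x0. \<psi> x - \<phi> x \<ge> 0) \<longrightarrow> F \<phi> x0 \<in> sym_matrices - U))"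

end

theory Submission
  imports Defs "HOL-Complex_Analysis.Great_Picard"
begin

text \<open>Suppose \<open>\<psi>1 - \<psi>2\<close> has a positive maximum. Since \<open>U\<close> is a cone, an increasing change of variables
  in the unknown, combined with the addition of a small multiple of \<open>|x|\<^sup>2\<close>, turns \<open>\<psi>1\<close> into a strict
  subsolution \<open>u\<close>: any quadratic touching \<open>u\<close> from above satisfies \<open>F - \<delta>I \<in> closure U\<close> with \<open>\<delta>\<close>
  independent of the gradient. It remains to find quadratics touching \<open>u\<close> from above and \<open>\<psi>2\<close> from
  below, with almost equal gradients and Hessians.

  Instead of Alexandrov's theorem we use the following. A double convolution \<open>g\<close> of \<open>u\<close> has second
  differences of size \<open>O(h\<^sup>2)\<close>, and for every small slope \<open>q\<close> it is squeezed, up to the affine function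
  \<open>q \<bullet> x + m\<close>, between the sup-convolution of \<open>u\<close> and the inf-convolution of \<open>\<psi>2\<close>, with contact at a
  point \<open>x q\<close>; moreover \<open>q\<close> depends on \<open>x q\<close> in a Lipschitz way. The normalised second differences of
  \<open>g\<close> at scale \<open>2h\<close> are averages of those at scale \<open>h\<close>, so their \<open>L\<^sup>2\<close> norms increase to a finite
  limit as \<open>h = 2\<^bsup>-k\<^esup> \<rightarrow> 0\<close>, and the third differences tend to zero in \<open>L\<^sup>2\<close>. As the
  contact points occupy a fixed proportion of the volume, some \<open>x q\<close> and some small \<open>h\<close> have
  negligible third differences nearby, and by compactness \<open>g\<close> is then close to a quadratic at scale
  \<open>h\<close> around \<open>x q\<close>. This quadratic serves for both functions.\<close>

section \<open>Functions with bounded second differences\<close>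

text \<open>\<open>F_op\<close> involves only derivatives of its argument, so no term of order zero
  separates the two solutions and the strictness has to be manufactured. Adding \<theta>\<nu>|x|^2/2
  alone fails: it shifts the gradient by \<theta>\<nu>x and creates terms linear in the gradient,
  which a constant gain cannot absorb. Nor can gradients be bounded beforehand, since the bound
  \<open>K\<close> in the theorem on sums depends on the perturbed function. The change of variables
  supplies terms quadratic in the gradient instead. A single maximum point may be exceptional for
  the regularity of g. Tilting by all small slopes q yields many contact points, and the Lipschitz
  dependence of q on \<open>x q\<close> keeps them apart; as g is built from u alone, one energy
  argument serves all slopes. One point at one scale is enough: a polynomial with error \<zeta>h^2
  on a ball of radius h, bent by 2\<zeta>|w|^2, forces the relevant maximum into the interior of
  that ball, so no second derivative of g ever has to exist.\<close>

definition sdiff :: "('a::real_vector \<Rightarrow> real) \<Rightarrow> 'a \<Rightarrow> 'a \<Rightarrow> real" where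
  "sdiff f x h = f (x + h) + f (x - h) - 2 * f x"

definition tdiff :: "('a::real_vector \<Rightarrow> real) \<Rightarrow> 'a \<Rightarrow> 'a \<Rightarrow> real" where
  "tdiff f x h = f (x + 3 *\<^sub>R h) - 3 * f (x + 2 *\<^sub>R h) + 3 * f (x + h) - f x"

text \<open>Among continuous functions these are the ones with Lipschitz gradient. The condition is
  put in differences because it needs no derivative and passes unchanged to blow-ups.\<close>

definition sdiff_bounded :: "real \<Rightarrow> ('a::real_normed_vector \<Rightarrow> real) \<Rightarrow> bool" where
  "sdiff_bounded C f \<longleftrightarrow> (\<forall>x h. \<bar>sdiff f x h\<bar> \<le> C * (norm h)\<^sup>2)"

lemma tdiff_eq_sdiff: "tdiff f x h = sdiff f (x + 2 *\<^sub>R h) h - sdiff f (x + h) h"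
proof -
  have "3 *\<^sub>R h = (1 + 1 + 1) *\<^sub>R h"
    by simp
  then have "3 *\<^sub>R h = h + h + h"
    by (simp only: scaleR_left_distrib scaleR_one)
  then show ?thesis
    unfolding tdiff_def sdiff_def scaleR_2 by (simp add: add.assoc[symmetric])
qed

text \<open>Induction by halving: the increment over d is half the increment over 2d up to half a
  second difference. The base point x stays fixed, so all points remain in the ball of radius R + 1.
  The term C/2 (1 - 2^(-j)) is the partial sum of the accumulated errors.\<close>

lemma sdiff_bounded_oscillation:
  fixes f :: "'a::real_normed_vector \<Rightarrow> real"
  assumes C: "sdiff_bounded C f" "0 \<le> C" and M: "\<And>x. norm x \<le> R + 1 \<Longrightarrow> \<bar>f x\<bar> \<le> M"
    and x: "norm x \<le> R" and d: "norm d \<le> 1 / 2 ^ j"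
  shows "\<bar>f (x + d) - f x\<bar> \<le> (2 * M + C / 2 * (1 - 1 / 2 ^ j)) / 2 ^ j"
  using d
proof (induction j arbitrary: d)
  case 0
  have "norm (x + d) \<le> R + 1" "norm x \<le> R + 1"
    using norm_triangle_ineq[of x d] x 0 by auto
  then show ?case
    using M[of "x + d"] M[of x] by auto
next
  case (Suc j)
  have halves: "\<bar>a / 2 - b / 2\<bar> \<le> P / 2 + Q / 2" if "\<bar>a\<bar> \<le> P" "\<bar>b\<bar> \<le> Q" for a b P Q :: real
    using that by linarith
  have d2: "norm (2 *\<^sub>R d) \<le> 1 / 2 ^ j"
    using Suc.prems by (simp add: field_simps)
  have "sdiff f (x + d) d = f (x + 2 *\<^sub>R d) + f x - 2 * f (x + d)"
    by (simp add: sdiff_def scaleR_2 add.assoc)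
  then have eq: "f (x + d) - f x = (f (x + 2 *\<^sub>R d) - f x) / 2 - sdiff f (x + d) d / 2"
    by (simp add: field_simps)
  have "\<bar>sdiff f (x + d) d\<bar> \<le> C * (norm d)\<^sup>2"
    using C(1) unfolding sdiff_bounded_def by blast
  also have "\<dots> \<le> C * (1 / 2 ^ Suc j)\<^sup>2"
    using Suc.prems C(2) by (intro mult_left_mono power_mono) auto
  finally have s: "\<bar>sdiff f (x + d) d\<bar> \<le> C * (1 / 2 ^ Suc j)\<^sup>2" .
  have "\<bar>f (x + d) - f x\<bar> \<le> (2 * M + C / 2 * (1 - 1 / 2 ^ j)) / 2 ^ j / 2 + C * (1 / 2 ^ Suc j)\<^sup>2 / 2"
    unfolding eq using halves[OF Suc.IH[OF d2] s] .
  also have "\<dots> = (2 * M + C / 2 * (1 - 1 / 2 ^ Suc j)) / 2 ^ Suc j"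
    by (simp add: field_simps power2_eq_square)
  finally show ?case .
qed

text \<open>Newton's forward difference formula, which stops after the term of second order.\<close>

lemma third_difference_zero_sequence:
  fixes s :: "nat \<Rightarrow> real"
  assumes "\<And>i. i + 3 \<le> N \<Longrightarrow> s (i + 3) - 3 * s (i + 2) + 3 * s (i + 1) - s i = 0" and "i \<le> N"
  shows "s i = s 0 + real i * (s 1 - s 0) + real i * (real i - 1) / 2 * (s 2 - 2 * s 1 + s 0)"
  using assms(2)
proof (induction i rule: less_induct)
  case (less i)
  consider "i = 0" | "i = 1" | "i = 2" | k where "i = k + 3"
    by (metis One_nat_def Suc_1 add_Suc_right add_0_right numeral_3_eq_3 old.nat.exhaust)
  then show ?case
  proof cases
    case 4
    have "s (k + 3) = 3 * s (k + 2) - 3 * s (k + 1) + s k"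
      using assms(1)[of k] less.prems 4 by simp
    also have "\<dots> = s 0 + real i * (s 1 - s 0) + real i * (real i - 1) / 2 * (s 2 - 2 * s 1 + s 0)"
      using less.IH[of "k + 2"] less.IH[of "k + 1"] less.IH[of k] less.prems 4
      by (simp add: field_simps)
    finally show ?thesis using 4 by simp
  qed auto
qed

text \<open>Cauchy's functional equation: additivity settles integer multiples, and the remaining
  fractional multiple of x lies on a segment where g is bounded. Hence the defect of homogeneity
  stays bounded when multiplied by any m.\<close>

lemma additive_bounded_imp_homogeneous:
  fixes g :: "'a::real_vector \<Rightarrow> real"
  assumes add: "\<And>x y. g (x + y) = g x + g y"
    and bdd: "\<And>r. 0 \<le> r \<Longrightarrow> r \<le> 1 \<Longrightarrow> \<bar>g (r *\<^sub>R x)\<bar> \<le> M"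
  shows "g (t *\<^sub>R x) = t * g x"
proof -
  interpret additive g by unfold_locales (rule add)
  have nat: "g (of_nat m *\<^sub>R y) = of_nat m * g y" for m y
    by (induction m) (simp_all add: zero add algebra_simps)
  have int: "g (of_int m *\<^sub>R y) = of_int m * g y" for m y
    using nat[of "nat m" y] nat[of "nat (- m)" y] minus[of "of_int (- m) *\<^sub>R y"]
    by (cases "m \<ge> 0") (auto simp: algebra_simps)
  have "real m * \<bar>g (t *\<^sub>R x) - t * g x\<bar> \<le> 2 * M" for m
  proof -
    define r where "r = real m * t - of_int \<lfloor>real m * t\<rfloor>"
    have r: "0 \<le> r" "r \<le> 1"
      unfolding r_def by linarith+
    have mt: "(real m * t) *\<^sub>R x = of_int \<lfloor>real m * t\<rfloor> *\<^sub>R x + r *\<^sub>R x"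
      by (simp add: r_def algebra_simps)
    have "real m * g (t *\<^sub>R x) = g ((real m * t) *\<^sub>R x)"
      using nat[of m "t *\<^sub>R x"] by simp
    also have "\<dots> = of_int \<lfloor>real m * t\<rfloor> * g x + g (r *\<^sub>R x)"
      unfolding mt add int ..
    finally have "real m * (g (t *\<^sub>R x) - t * g x) = g (r *\<^sub>R x) - r * g x"
      by (simp add: r_def algebra_simps)
    then have "real m * \<bar>g (t *\<^sub>R x) - t * g x\<bar> = \<bar>g (r *\<^sub>R x) - r * g x\<bar>"
      by (metis abs_mult abs_of_nat)
    also have "\<dots> \<le> \<bar>g (r *\<^sub>R x)\<bar> + r * \<bar>g x\<bar>"
      using abs_triangle_ineq4[of "g (r *\<^sub>R x)" "r * g x"] r by (simp add: abs_mult)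
    also have "\<dots> \<le> M + 1 * M"
      using bdd[of r] bdd[of 1] r by (intro add_mono mult_mono) auto
    finally show ?thesis by simp
  qed
  then have "\<bar>g (t *\<^sub>R x) - t * g x\<bar> \<le> 0"
    by (meson linorder_not_le reals_Archimedean3)
  then show ?thesis by simp
qed

text \<open>The argument of Jordan and von Neumann: polarisation gives a biadditive form, and the
  quadratic bound makes it homogeneous. The form is not halved, so that B x x = 2 Q x matches the
  factor 1/2 of a Taylor polynomial.\<close>

lemma parallelogram_imp_quadratic_form:
  fixes Q :: "real^'n \<Rightarrow> real"
  assumes par: "\<And>x y. Q (x + y) + Q (x - y) = 2 * Q x + 2 * Q y"
    and bdd: "\<And>x. \<bar>Q x\<bar> \<le> C * (norm x)\<^sup>2"
  shows "\<exists>A\<in>sym_matrices. \<forall>x. Q x = x \<bullet> (A *v x) / 2"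
proof -
  define B where "B = (\<lambda>x y. Q (x + y) - Q x - Q y)"
  have Q0: "Q 0 = 0" using bdd[of 0] by simp
  have comm: "B x y = B y x" for x y
    by (simp add: B_def add.commute)
  have add: "B (x + y) z = B x z + B y z" for x y z
  proof -
    \<comment> \<open>Adding the first two instances and subtracting the third isolates Q (x + y +
      z); \<open>par[of x y]\<close> then removes Q (x - y).\<close>
    have 1: "Q (x + y + z) + Q (x - y + z) = 2 * Q (x + z) + 2 * Q y"
      using par[of "x + z" y] by (simp add: algebra_simps)
    have 2: "Q (x + y + z) + Q (z - (x - y)) = 2 * Q (y + z) + 2 * Q x"
      using par[of "y + z" x] by (simp add: algebra_simps)
    have 3: "Q (x - y + z) + Q (z - (x - y)) = 2 * Q z + 2 * Q (x - y)"
      using par[of z "x - y"] by (simp add: algebra_simps)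
    show ?thesis
      using 1 2 3 par[of x y] by (simp add: B_def)
  qed
  have Bb: "\<bar>B x y\<bar> \<le> \<bar>C\<bar> * (norm x + norm y)\<^sup>2 * 3" for x y
  proof -
    have b: "\<bar>Q z\<bar> \<le> \<bar>C\<bar> * (norm x + norm y)\<^sup>2" if "norm z \<le> norm x + norm y" for z
    proof -
      have "\<bar>Q z\<bar> \<le> \<bar>C\<bar> * (norm z)\<^sup>2"
        by (rule order_trans[OF bdd]) (simp add: mult_right_mono)
      also have "\<dots> \<le> \<bar>C\<bar> * (norm x + norm y)\<^sup>2"
        using that by (intro mult_left_mono power_mono) auto
      finally show ?thesis .
    qed
    show ?thesis
      using b[of "x + y"] b[of x] b[of y] norm_triangle_ineq[of x y] by (simp add: B_def)
  qed
  have scale: "B (t *\<^sub>R x) y = t * B x y" for t x y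
  proof (rule additive_bounded_imp_homogeneous[where M = "\<bar>C\<bar> * (norm x + norm y)\<^sup>2 * 3"])
    fix r :: real assume r: "0 \<le> r" "r \<le> 1"
    have "\<bar>B (r *\<^sub>R x) y\<bar> \<le> \<bar>C\<bar> * (norm (r *\<^sub>R x) + norm y)\<^sup>2 * 3"
      by (rule Bb)
    also have "\<dots> \<le> \<bar>C\<bar> * (norm x + norm y)\<^sup>2 * 3"
      using r by (intro mult_right_mono mult_left_mono power_mono add_mono) (auto simp: mult_left_le_one_le)
    finally show "\<bar>B (r *\<^sub>R x) y\<bar> \<le> \<bar>C\<bar> * (norm x + norm y)\<^sup>2 * 3" .
  qed (rule add)
  have lin: "linear (\<lambda>x. B x y)" for y
    by (rule linearI) (simp_all add: add scale)
  define A :: "real^'n^'n" where "A = (\<chi> i j. B (axis i 1) (axis j 1))"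
  have expand: "B x y = (\<Sum>i\<in>UNIV. x $ i * B (axis i 1) y)" for x y
  proof -
    have "B x y = B (\<Sum>i\<in>UNIV. x $ i *\<^sub>R axis i 1) y"
      by (simp add: basis_expansion flip: scalar_mult_eq_scaleR)
    also have "\<dots> = (\<Sum>i\<in>UNIV. x $ i * B (axis i 1) y)"
      by (simp add: linear_sum[OF lin] scale)
    finally show ?thesis .
  qed
  have "x \<bullet> (A *v y) = B x y" for x y
  proof -
    have "B x y = (\<Sum>i\<in>UNIV. x $ i * (\<Sum>j\<in>UNIV. y $ j * B (axis j 1) (axis i 1)))"
      unfolding expand[of x y] comm[of "axis _ 1" y] by (simp add: expand[of y])
    also have "\<dots> = x \<bullet> (A *v y)"
      by (simp add: inner_vec_def matrix_vector_mult_def A_def comm[of "axis _ 1" "axis _ 1"] mult.commute)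
    finally show ?thesis by simp
  qed
  moreover have "B x x = 2 * Q x" for x
    using par[of x x] Q0 by (simp add: B_def)
  moreover have "A \<in> sym_matrices"
    by (simp add: sym_matrices_def transpose_def A_def vec_eq_iff comm)
  ultimately show ?thesis
    by (intro bexI[of _ A]) auto
qed


text \<open>Along an arithmetic progression f is a polynomial of degree at most two. As f is also
  O(|z|^2) at the origin, its constant and linear parts vanish; comparing progressions of different
  fineness gives homogeneity and the parallelogram law.\<close>

lemma third_difference_zero_imp_quadratic_form:
  fixes f :: "real^'n \<Rightarrow> real"
  assumes T: "\<And>z e. norm z \<le> 4 \<Longrightarrow> norm (z + 3 *\<^sub>R e) \<le> 4 \<Longrightarrow> tdiff f z e = 0"
    and bdd: "\<And>z. norm z \<le> 4 \<Longrightarrow> \<bar>f z\<bar> \<le> C * (norm z)\<^sup>2"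
    and cont: "continuous_on (cball 0 4) f"
  shows "\<exists>A\<in>sym_matrices. \<forall>z. norm z \<le> 4 \<longrightarrow> f z = z \<bullet> (A *v z) / 2"
proof -
  have f0: "f 0 = 0" using bdd[of 0] by simp
  have prog: "f (z + real i *\<^sub>R w) = f z + real i * (f (z + w) - f z)
      + real i * (real i - 1) / 2 * (f (z + 2 *\<^sub>R w) - 2 * f (z + w) + f z)"
    if z: "norm z \<le> 4" "norm (z + real N *\<^sub>R w) \<le> 4" and i: "i \<le> N" for z w i N
  proof -
    have seg: "norm (z + real k *\<^sub>R w) \<le> 4" if "k \<le> N" for k
    proof (cases "N = 0")
      case False
      have "(1 - real k / real N) *\<^sub>R z + (real k / real N) *\<^sub>R (z + real N *\<^sub>R w) \<in> cball 0 4"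
        using z that False by (intro convexD[OF convex_cball]) auto
      moreover have "(1 - real k / real N) *\<^sub>R z + (real k / real N) *\<^sub>R (z + real N *\<^sub>R w) = z + real k *\<^sub>R w"
        using False by (simp add: algebra_simps)
      ultimately show ?thesis by simp
    qed (use that z in simp)
    have "f (z + real (k + 3) *\<^sub>R w) - 3 * f (z + real (k + 2) *\<^sub>R w) + 3 * f (z + real (k + 1) *\<^sub>R w)
        - f (z + real k *\<^sub>R w) = 0" if "k + 3 \<le> N" for k
      using T[of "z + real k *\<^sub>R w" w] seg[of k] seg[of "k + 3"] that
      by (simp add: tdiff_def algebra_simps)
    from third_difference_zero_sequence[of N "\<lambda>i. f (z + real i *\<^sub>R w)", OF this i]
    show ?thesis by simp
  qed
  \<comment> \<open>On the progression from -z to z in 2m steps the middle term is 0, where f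
    vanishes. This determines how the odd and the even part of f scale.\<close>
  have sym: "f z - f (- z) = real m * (f ((1 / real m) *\<^sub>R z) - f (- ((1 / real m) *\<^sub>R z)))"
       "f z + f (- z) = (real m)\<^sup>2 * (f ((1 / real m) *\<^sub>R z) + f (- ((1 / real m) *\<^sub>R z)))"
    if z: "norm z \<le> 4" and m: "m \<ge> 1" for z m
  proof -
    define w where "w = (1 / real m) *\<^sub>R z"
    have zw: "z = real m *\<^sub>R w" using m by (simp add: w_def)
    define a b c where "a = f (- z)" and "b = f (- z + w) - f (- z)"
      and "c = f (- z + 2 *\<^sub>R w) - 2 * f (- z + w) + f (- z)"
    have end_eq: "- z + real (2 * m) *\<^sub>R w = z"
      by (simp add: zw algebra_simps flip: scaleR_left_distrib)
    have s: "f (- z + real i *\<^sub>R w) = a + real i * b + real i * (real i - 1) / 2 * c" if "i \<le> 2 * m" for i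
      using prog[of "- z" "2 * m" w i] that z end_eq unfolding a_def b_def c_def by simp
    have 1: "f z = a + real (2 * m) * b + real (2 * m) * (real (2 * m) - 1) / 2 * c"
      using s[of "2 * m"] end_eq by simp
    have 2: "0 = a + real m * b + real m * (real m - 1) / 2 * c"
      using s[of m] by (simp add: zw f0)
    have "- z + real (m + 1) *\<^sub>R w = w"
      by (simp add: zw algebra_simps)
    then have 3: "f w = a + real (m + 1) * b + real (m + 1) * (real (m + 1) - 1) / 2 * c"
      using s[of "m + 1"] m by simp
    have "- z + real (m - 1) *\<^sub>R w = - w"
      using m by (simp add: zw of_nat_diff algebra_simps)
    then have 4: "f (- w) = a + (real m - 1) * b + (real m - 1) * (real m - 2) / 2 * c"
      using s[of "m - 1"] m by (simp add: of_nat_diff)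
    show "f z - f (- z) = real m * (f ((1 / real m) *\<^sub>R z) - f (- ((1 / real m) *\<^sub>R z)))"
      unfolding w_def[symmetric] 1 3 4 a_def[symmetric] by (simp add: field_simps)
    have a: "a = - real m * b - real m * (real m - 1) / 2 * c"
      using 2 by simp
    show "f z + f (- z) = (real m)\<^sup>2 * (f ((1 / real m) *\<^sub>R z) + f (- ((1 / real m) *\<^sub>R z)))"
      unfolding w_def[symmetric] 1 3 4 a_def[symmetric] unfolding a
      by (simp add: field_simps power2_eq_square)
  qed
  \<comment> \<open>The odd part scales like m but is O(1/m^2) at z/m, so m times the odd part stays
    bounded.\<close>
  have even: "f (- z) = f z" if z: "norm z \<le> 4" for z
  proof -
    have "real m * \<bar>f z - f (- z)\<bar> \<le> 2 * C * (norm z)\<^sup>2" for m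
    proof (cases "m = 0")
      case True
      have "0 \<le> C * (norm z)\<^sup>2"
        using bdd[OF z] by (meson abs_ge_zero order_trans)
      then show ?thesis using True by simp
    next
      case False
      define w where "w = (1 / real m) *\<^sub>R z"
      have nw: "norm w = norm z / real m"
        by (simp add: w_def)
      have "norm w \<le> 4"
        using z False unfolding nw by (simp add: field_simps mult_le_cancel_left)
      then have "\<bar>f w - f (- w)\<bar> \<le> 2 * (C * (norm w)\<^sup>2)"
        using bdd[of w] bdd[of "- w"] by simp
      then have "real m * \<bar>real m * (f w - f (- w))\<bar> \<le> real m * (real m * (2 * (C * (norm w)\<^sup>2)))"
        by (simp add: abs_mult mult_left_mono)
      also have "\<dots> = 2 * C * (norm z)\<^sup>2"
        using False by (simp add: nw power2_eq_square)
      finally show ?thesis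
        using sym(1)[OF z, of m] False by (simp add: w_def)
    qed
    then have "\<bar>f z - f (- z)\<bar> \<le> 0"
      by (meson linorder_not_le reals_Archimedean3)
    then show ?thesis by simp
  qed
  have small: "norm ((1 / real m) *\<^sub>R z) \<le> 4" if "norm z \<le> 4" "m \<ge> 1" for z :: "real^'n" and m
  proof -
    have "norm ((1 / real m) *\<^sub>R z) \<le> 1 * norm z"
      unfolding norm_scaleR using that by (intro mult_right_mono) auto
    with that show ?thesis by simp
  qed
  have hom: "f z = (real m)\<^sup>2 * f ((1 / real m) *\<^sub>R z)" if "norm z \<le> 4" "m \<ge> 1" for z m
    using sym(2)[OF that] even[of z] even[OF small[OF that]] that by simp
  \<comment> \<open>Scaled by 1/j, the points a, a + b, a + 2b begin a progression whose term of
    index j is a/j + b. By homogeneity its value is a polynomial in 1/j with constant term half the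
    second difference, and continuity identifies the limit as f b.\<close>
  have par: "f (a + 2 *\<^sub>R b) - 2 * f (a + b) + f a = 2 * f b"
    if ab: "norm a + 2 * norm b \<le> 4" for a b
  proof -
    define D where "D = f (a + 2 *\<^sub>R b) - 2 * f (a + b) + f a"
    have n: "norm a \<le> 4" "norm (a + b) \<le> 4" "norm (a + 2 *\<^sub>R b) \<le> 4"
      using ab norm_triangle_ineq[of a b] norm_triangle_ineq[of a "2 *\<^sub>R b"] norm_ge_zero[of b]
      unfolding norm_scaleR by linarith+
    have nb: "norm ((1 / real j) *\<^sub>R a + b) \<le> 4" if "j \<ge> 1" for j
    proof -
      have "norm ((1 / real j) *\<^sub>R a) \<le> 1 * norm a"
        unfolding norm_scaleR using that by (intro mult_right_mono) auto
      then show ?thesis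
        using norm_triangle_ineq[of "(1 / real j) *\<^sub>R a" b] ab norm_ge_zero[of b] by linarith
    qed
    have eq: "f ((1 / real j) *\<^sub>R a + b) = f a * (1 / real j)\<^sup>2 + (f (a + b) - f a) * (1 / real j) + (1 - 1 / real j) / 2 * D"
      if j: "j \<ge> 1" for j
    proof -
      define z w where "z = (1 / real j) *\<^sub>R a" and "w = (1 / real j) *\<^sub>R b"
      have "z + real j *\<^sub>R w = (1 / real j) *\<^sub>R a + b"
        using j by (simp add: z_def w_def)
      then have A: "f ((1 / real j) *\<^sub>R a + b) = f z + real j * (f (z + w) - f z)
          + real j * (real j - 1) / 2 * (f (z + 2 *\<^sub>R w) - 2 * f (z + w) + f z)"
        using prog[of z j w j] small[OF n(1) j] nb[OF j] by (simp add: z_def)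
      have fz: "f z = f a / (real j)\<^sup>2"
        using hom[OF n(1) j] j by (simp add: z_def)
      have "z + w = (1 / real j) *\<^sub>R (a + b)"
        by (simp add: z_def w_def scaleR_right_distrib)
      then have fzw: "f (z + w) = f (a + b) / (real j)\<^sup>2"
        using hom[OF n(2) j] j by simp
      have "z + 2 *\<^sub>R w = (1 / real j) *\<^sub>R (a + 2 *\<^sub>R b)"
        by (simp add: z_def w_def scaleR_right_distrib)
      then have fz2w: "f (z + 2 *\<^sub>R w) = f (a + 2 *\<^sub>R b) / (real j)\<^sup>2"
        using hom[OF n(3) j] j by simp
      show ?thesis
        unfolding A fz fzw fz2w using j by (simp add: D_def field_simps power2_eq_square)
    qed
    have inv: "(\<lambda>j. 1 / real j) \<longlonglongrightarrow> 0"
      by (rule lim_1_over_n)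
    have "(\<lambda>j. f ((1 / real j) *\<^sub>R a + b)) \<longlonglongrightarrow> f (0 *\<^sub>R a + b)"
    proof (rule continuous_on_tendsto_compose[OF cont])
      show "(\<lambda>j. (1 / real j) *\<^sub>R a + b) \<longlonglongrightarrow> 0 *\<^sub>R a + b"
        by (intro tendsto_intros inv)
      show "\<forall>\<^sub>F j in sequentially. (1 / real j) *\<^sub>R a + b \<in> cball 0 4"
        using nb by (auto intro!: eventually_sequentiallyI[of 1])
      have "norm b \<le> 4"
        using ab norm_ge_zero[of a] norm_ge_zero[of b] by linarith
      then show "0 *\<^sub>R a + b \<in> cball 0 4"
        by simp
    qed
    moreover have "(\<lambda>j. f ((1 / real j) *\<^sub>R a + b)) \<longlonglongrightarrow> f a * 0\<^sup>2 + (f (a + b) - f a) * 0 + (1 - 0) / 2 * D"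
    proof (rule Lim_transform_eventually)
      show "(\<lambda>j. f a * (1 / real j)\<^sup>2 + (f (a + b) - f a) * (1 / real j) + (1 - 1 / real j) / 2 * D)
          \<longlonglongrightarrow> f a * 0\<^sup>2 + (f (a + b) - f a) * 0 + (1 - 0) / 2 * D"
        by (intro tendsto_intros inv) simp
      show "\<forall>\<^sub>F j in sequentially. f a * (1 / real j)\<^sup>2 + (f (a + b) - f a) * (1 / real j) + (1 - 1 / real j) / 2 * D
          = f ((1 / real j) *\<^sub>R a + b)"
        by (rule eventually_sequentiallyI[of 1]) (simp only: eq)
    qed
    ultimately have "f (0 *\<^sub>R a + b) = f a * 0\<^sup>2 + (f (a + b) - f a) * 0 + (1 - 0) / 2 * D"
      by (rule LIMSEQ_unique)
    then show ?thesis by (simp add: D_def)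
  qed
  \<comment> \<open>Dividing by N x brings x into the ball where f is controlled; the + 1 keeps the
    divisor positive at 0. By homogeneity every admissible divisor gives the same Q.\<close>
  define N :: "real^'n \<Rightarrow> nat" where "N = (\<lambda>x. nat \<lceil>norm x\<rceil> + 1)"
  have N: "N x \<ge> 1" "norm x \<le> 4 * real (N x)" for x
  proof -
    have "norm x \<le> real (N x)"
      unfolding N_def using norm_ge_zero[of x] by linarith
    also have "\<dots> \<le> 4 * real (N x)"
      by simp
    finally show "norm x \<le> 4 * real (N x)" .
  qed (simp add: N_def)
  define Q where "Q = (\<lambda>x. (real (N x))\<^sup>2 * f ((1 / real (N x)) *\<^sub>R x))"
  have le4: "norm ((1 / real k) *\<^sub>R x) \<le> 4" if "k \<ge> 1" "norm x \<le> 4 * real k" for k and x :: "real^'n"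
    using that by (simp add: field_simps)
  have Qeq: "Q x = (real k)\<^sup>2 * f ((1 / real k) *\<^sub>R x)" if k: "k \<ge> 1" "norm x \<le> 4 * real k" for k x
  proof -
    define m where "m = N x"
    have m: "m \<ge> 1" "norm x \<le> 4 * real m"
      unfolding m_def by (rule N)+
    have "(real k)\<^sup>2 * f ((1 / real k) *\<^sub>R x) = (real k * real m)\<^sup>2 * f ((1 / (real k * real m)) *\<^sub>R x)"
      using hom[OF le4[OF k] m(1)] by (simp add: power_mult_distrib mult.commute)
    moreover have "(real m)\<^sup>2 * f ((1 / real m) *\<^sub>R x) = (real k * real m)\<^sup>2 * f ((1 / (real k * real m)) *\<^sub>R x)"
      using hom[OF le4[OF m] k(1)] by (simp add: power_mult_distrib mult.commute)
    ultimately show ?thesis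
      by (simp add: Q_def m_def)
  qed
  have "\<exists>A\<in>sym_matrices. \<forall>x. Q x = x \<bullet> (A *v x) / 2"
  proof (rule parallelogram_imp_quadratic_form)
    fix x y :: "real^'n"
    obtain k where k: "k \<ge> 1" "norm x \<le> real k" "norm y \<le> real k"
      by (metis max.bounded_iff of_nat_1 of_nat_le_iff real_arch_simple)
    \<comment> \<open>Then a, a + b, a + 2b are (x - y)/k, x/k, (x + y)/k, and |a| + 2|b| \<le> 2 +
      2, which is what the radius 4 is for.\<close>
    define a b where "a = (1 / real k) *\<^sub>R (x - y)" and "b = (1 / real k) *\<^sub>R y"
    have nb: "norm b \<le> 1" using k by (simp add: b_def field_simps)
    have "norm (x - y) \<le> 2 * real k"
      using k norm_triangle_ineq4[of x y] by linarith
    then have na: "norm a \<le> 2" using k unfolding a_def norm_scaleR by (simp add: field_simps)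
    have e: "a + b = (1 / real k) *\<^sub>R x" "a + 2 *\<^sub>R b = (1 / real k) *\<^sub>R (x + y)"
      unfolding a_def b_def scaleR_2 by (simp_all flip: scaleR_add_right)
    have "Q (x + y) = (real k)\<^sup>2 * f (a + 2 *\<^sub>R b)" "Q (x - y) = (real k)\<^sup>2 * f a"
         "Q x = (real k)\<^sup>2 * f (a + b)" "Q y = (real k)\<^sup>2 * f b"
      unfolding e unfolding a_def b_def
      using k norm_triangle_ineq[of x y] norm_triangle_ineq4[of x y] by (intro Qeq; simp)+
    moreover have "f (a + 2 *\<^sub>R b) + f a = 2 * f (a + b) + 2 * f b"
      using par[of a b] na nb by simp
    ultimately show "Q (x + y) + Q (x - y) = 2 * Q x + 2 * Q y"
      by (metis (no_types, opaque_lifting) distrib_left mult.left_commute)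
  next
    fix x :: "real^'n"
    define m where "m = N x"
    have m: "m \<ge> 1" "norm x \<le> 4 * real m"
      unfolding m_def by (rule N)+
    have "\<bar>Q x\<bar> = (real m)\<^sup>2 * \<bar>f ((1 / real m) *\<^sub>R x)\<bar>"
      unfolding Qeq[OF m] by (simp add: abs_mult)
    also have "\<dots> \<le> (real m)\<^sup>2 * (C * (norm ((1 / real m) *\<^sub>R x))\<^sup>2)"
      by (intro mult_left_mono bdd le4[OF m]) simp
    also have "\<dots> = C * (norm x)\<^sup>2"
      using m by (simp add: power2_eq_square)
    finally show "\<bar>Q x\<bar> \<le> C * (norm x)\<^sup>2" .
  qed
  moreover have "Q z = f z" if "norm z \<le> 4" for z
    using Qeq[of 1 z] that by simp
  ultimately show ?thesis by metis
qed

section \<open>Compactness of the normalised class of functions\<close>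

lemma sdiff_bounded_equicontinuous:
  assumes C: "0 \<le> C" and \<eta>: "0 < \<eta>"
  shows "\<exists>\<mu>>0. \<forall>f :: 'a::real_normed_vector \<Rightarrow> real. sdiff_bounded C f \<and> (\<forall>z. \<bar>f z\<bar> \<le> C * (norm z)\<^sup>2) \<longrightarrow>
      (\<forall>x d. norm x \<le> R \<longrightarrow> norm d \<le> \<mu> \<longrightarrow> \<bar>f (x + d) - f x\<bar> \<le> \<eta>)"
proof -
  \<comment> \<open>This is the constant of \<open>sdiff_bounded_oscillation\<close> for M = C (R +
    1)^2, so the modulus of continuity depends on C, R and \<eta> only.\<close>
  define K where "K = 2 * (C * (R + 1)\<^sup>2) + C / 2"
  obtain j where j: "K / \<eta> < 2 ^ j"
    using real_arch_pow[of 2 "K / \<eta>"] by auto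
  have "\<bar>f (x + d) - f x\<bar> \<le> \<eta>"
    if f: "sdiff_bounded C f" "\<And>z. \<bar>f z\<bar> \<le> C * (norm z)\<^sup>2" and x: "norm x \<le> R" and d: "norm d \<le> 1 / 2 ^ j"
    for f :: "'a \<Rightarrow> real" and x d
  proof -
    have "\<bar>f z\<bar> \<le> C * (R + 1)\<^sup>2" if "norm z \<le> R + 1" for z
      using mult_left_mono[OF power_mono[OF that, of 2] C] f(2)[of z] by simp
    from sdiff_bounded_oscillation[OF f(1) C this x d]
    have "\<bar>f (x + d) - f x\<bar> \<le> (2 * (C * (R + 1)\<^sup>2) + C / 2 * (1 - 1 / 2 ^ j)) / 2 ^ j"
      by simp
    also have "\<dots> \<le> K / 2 ^ j"
      using C unfolding K_def by (intro divide_right_mono add_mono) (auto intro!: mult_left_le)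
    also have "\<dots> \<le> \<eta>"
      using j \<eta> by (simp add: field_simps)
    finally show ?thesis .
  qed
  then show ?thesis
    by (intro exI[of _ "1 / 2 ^ j"]) auto
qed

text \<open>By compactness: counterexamples with third differences below 1/(n + 1) would have a
  subsequence converging uniformly on the ball of radius 4 to a function with vanishing third
  differences, that is, to an exact quadratic form.\<close>

lemma small_third_differences_imp_near_quadratic_form:
  assumes C: "0 \<le> C" and \<zeta>: "0 < \<zeta>"
  shows "\<exists>\<eta>>0. \<forall>f :: real^'n \<Rightarrow> real. sdiff_bounded C f \<and> (\<forall>z. \<bar>f z\<bar> \<le> C * (norm z)\<^sup>2) \<and>
      (\<forall>z e. norm z \<le> 4 \<longrightarrow> norm e \<le> 4 \<longrightarrow> \<bar>tdiff f z e\<bar> \<le> \<eta>) \<longrightarrow>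
      (\<exists>A\<in>sym_matrices. \<forall>z. norm z \<le> 1 \<longrightarrow> \<bar>f z - z \<bullet> (A *v z) / 2\<bar> \<le> \<zeta>)"
proof (rule ccontr)
  assume neg: "\<not> ?thesis"
  have "\<forall>n::nat. \<exists>f :: real^'n \<Rightarrow> real. sdiff_bounded C f \<and> (\<forall>z. \<bar>f z\<bar> \<le> C * (norm z)\<^sup>2) \<and>
      (\<forall>z e. norm z \<le> 4 \<longrightarrow> norm e \<le> 4 \<longrightarrow> \<bar>tdiff f z e\<bar> \<le> 1 / (real n + 1)) \<and>
      \<not> (\<exists>A\<in>sym_matrices. \<forall>z. norm z \<le> 1 \<longrightarrow> \<bar>f z - z \<bullet> (A *v z) / 2\<bar> \<le> \<zeta>)"
  proof
    fix n :: nat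
    have "0 < 1 / (real n + 1)" by simp
    then show "\<exists>f :: real^'n \<Rightarrow> real. sdiff_bounded C f \<and> (\<forall>z. \<bar>f z\<bar> \<le> C * (norm z)\<^sup>2) \<and>
      (\<forall>z e. norm z \<le> 4 \<longrightarrow> norm e \<le> 4 \<longrightarrow> \<bar>tdiff f z e\<bar> \<le> 1 / (real n + 1)) \<and>
      \<not> (\<exists>A\<in>sym_matrices. \<forall>z. norm z \<le> 1 \<longrightarrow> \<bar>f z - z \<bullet> (A *v z) / 2\<bar> \<le> \<zeta>)"
      using neg by blast
  qed
  then obtain f :: "nat \<Rightarrow> real^'n \<Rightarrow> real" where
        sd: "\<And>n. sdiff_bounded C (f n)"
    and bd: "\<And>n z. \<bar>f n z\<bar> \<le> C * (norm z)\<^sup>2"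
    and td: "\<And>n z e. norm z \<le> 4 \<Longrightarrow> norm e \<le> 4 \<Longrightarrow> \<bar>tdiff (f n) z e\<bar> \<le> 1 / (real n + 1)"
    and no: "\<And>n. \<not> (\<exists>A\<in>sym_matrices. \<forall>z. norm z \<le> 1 \<longrightarrow> \<bar>f n z - z \<bullet> (A *v z) / 2\<bar> \<le> \<zeta>)"
    by metis
  have bd': "\<bar>f n x\<bar> \<le> C * r\<^sup>2" if "norm x \<le> r" for n x r
  proof -
    have "C * (norm x)\<^sup>2 \<le> C * r\<^sup>2"
      using that C by (intro mult_left_mono power_mono) auto
    then show ?thesis using bd[of n x] by linarith
  qed
  obtain g :: "real^'n \<Rightarrow> real" and k where g: "continuous_on (cball 0 4) g" and k: "strict_mono (k :: nat \<Rightarrow> nat)"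
    and unif: "\<And>e. 0 < e \<Longrightarrow> \<exists>N. \<forall>n x. n \<ge> N \<and> x \<in> cball 0 4 \<longrightarrow> norm (f (k n) x - g x) < e"
  proof (rule Arzela_Ascoli[of "cball (0::real^'n) 4" f "C * 4\<^sup>2"])
    show "norm (f n x) \<le> C * 4\<^sup>2" if "x \<in> cball 0 4" for n x
      using bd'[of x 4] that by simp
    fix x :: "real^'n" and e :: real assume x: "x \<in> cball 0 4" and e: "0 < e"
    obtain \<mu> where \<mu>: "\<mu> > 0" and eq: "\<And>h :: real^'n \<Rightarrow> real. \<And>x d. sdiff_bounded C h \<Longrightarrow> (\<And>z. \<bar>h z\<bar> \<le> C * (norm z)\<^sup>2) \<Longrightarrow>
        norm x \<le> 4 \<Longrightarrow> norm d \<le> \<mu> \<Longrightarrow> \<bar>h (x + d) - h x\<bar> \<le> e / 2"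
      using sdiff_bounded_equicontinuous[OF C, of "e / 2" 4] e by (metis half_gt_zero)
    have "norm (f n x - f n y) < e" if y: "norm (x - y) < \<mu>" for n y
      using eq[OF sd bd, of x "y - x" n] x y e by (simp add: norm_minus_commute abs_minus_commute)
    then show "\<exists>d. 0 < d \<and> (\<forall>n y. y \<in> cball 0 4 \<and> norm (x - y) < d \<longrightarrow> norm (f n x - f n y) < e)"
      using \<mu> by blast
  qed auto
  have lim: "(\<lambda>n. f (k n) x) \<longlonglongrightarrow> g x" if "norm x \<le> 4" for x
    unfolding LIMSEQ_iff using unif that by (metis dist_0_norm mem_cball)
  have "\<exists>A\<in>sym_matrices. \<forall>z. norm z \<le> 4 \<longrightarrow> g z = z \<bullet> (A *v z) / 2"
  proof (rule third_difference_zero_imp_quadratic_form[OF _ _ g])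
    show "\<bar>g z\<bar> \<le> C * (norm z)\<^sup>2" if "norm z \<le> 4" for z
      using bd by (intro LIMSEQ_le_const2[OF tendsto_rabs[OF lim[OF that]]]) auto
    fix z e :: "real^'n" assume z: "norm z \<le> 4" and ze: "norm (z + 3 *\<^sub>R e) \<le> 4"
    have mid: "norm (z + t *\<^sub>R e) \<le> 4" if "0 \<le> t" "t \<le> 3" for t
    proof -
      have "(1 - t / 3) *\<^sub>R z + (t / 3) *\<^sub>R (z + 3 *\<^sub>R e) \<in> cball 0 4"
        using z ze that by (intro convexD[OF convex_cball]) auto
      then show ?thesis by (simp add: algebra_simps)
    qed
    have "norm (3 *\<^sub>R e) \<le> 8"
      using norm_triangle_ineq4[of "z + 3 *\<^sub>R e" z] z ze by simp
    then have e4: "norm e \<le> 4" by simp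
    have "(\<lambda>n. tdiff (f (k n)) z e) \<longlonglongrightarrow> tdiff g z e"
      unfolding tdiff_def using mid[of 3] mid[of 2] mid[of 1] mid[of 0]
      by (intro tendsto_intros lim) auto
    moreover have "(\<lambda>n. tdiff (f (k n)) z e) \<longlonglongrightarrow> 0"
    proof (rule Lim_null_comparison)
      show "\<forall>\<^sub>F n in sequentially. norm (tdiff (f (k n)) z e) \<le> 1 / real (Suc n)"
      proof (rule always_eventually, rule allI)
        fix n
        have "norm (tdiff (f (k n)) z e) \<le> 1 / (real (k n) + 1)"
          using td[OF z e4] by simp
        also have "\<dots> \<le> 1 / real (Suc n)"
          using seq_suble[OF k, of n] by (intro divide_left_mono) auto
        finally show "norm (tdiff (f (k n)) z e) \<le> 1 / real (Suc n)" .
      qed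
      show "(\<lambda>n. 1 / real (Suc n)) \<longlonglongrightarrow> 0"
        using LIMSEQ_Suc[OF lim_1_over_n] .
    qed
    ultimately show "tdiff g z e = 0"
      by (rule LIMSEQ_unique)
  qed
  then obtain A where A: "A \<in> sym_matrices" "\<And>z. norm z \<le> 4 \<Longrightarrow> g z = z \<bullet> (A *v z) / 2"
    by blast
  obtain N where "\<And>n x. n \<ge> N \<Longrightarrow> norm x \<le> 4 \<Longrightarrow> norm (f (k n) x - g x) < \<zeta>"
    using unif[OF \<zeta>] by auto
  then have "\<bar>f (k N) z - z \<bullet> (A *v z) / 2\<bar> \<le> \<zeta>" if "norm z \<le> 1" for z
    using that A(2)[of z] by (metis less_eq_real_def norm_conv_dist one_le_numeral order_refl order_trans real_norm_def)
  then show False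
    using no A(1) by blast
qed

section \<open>Decay of the energy of third differences\<close>

lemma set_integrable_cball_continuous:
  fixes f :: "'a::euclidean_space \<Rightarrow> real"
  assumes "continuous_on UNIV f"
  shows "set_integrable lborel (cball a R) f"
  unfolding set_integrable_def
  by (intro borel_integrable_compact compact_cball continuous_on_subset[OF assms]) auto

lemma set_integral_cball_mono_set:
  fixes f :: "'a::euclidean_space \<Rightarrow> real"
  assumes f: "continuous_on UNIV f" "\<And>x. 0 \<le> f x" and "R \<le> R'"
  shows "(LINT x:cball 0 R|lborel. f x) \<le> (LINT x:cball 0 R'|lborel. f x)"
  unfolding set_lebesgue_integral_def
  using set_integrable_cball_continuous[OF f(1), of 0 R'] assms
  by (intro integral_mono') (auto simp: set_integrable_def indicator_def)

lemma set_integral_cball_shift_le: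
  fixes f :: "'a::euclidean_space \<Rightarrow> real"
  assumes f: "continuous_on UNIV f" "\<And>x. 0 \<le> f x" and e: "norm e \<le> r"
  shows "(LINT x:cball 0 R|lborel. f (x + e)) \<le> (LINT x:cball 0 (R + r)|lborel. f x)"
proof -
  define F where "F = (\<lambda>y. indicator (cball e R) y *\<^sub>R f y)"
  have mf: "f \<in> borel_measurable borel"
    by (rule borel_measurable_continuous_onI[OF f(1)])
  have [measurable]: "F \<in> borel_measurable borel"
    unfolding F_def by (intro borel_measurable_scaleR borel_measurable_indicator mf) simp
  have "(LINT x:cball 0 R|lborel. f (x + e)) = (LINT x|lborel. F (e + x))"
    unfolding set_lebesgue_integral_def F_def by (simp add: add.commute indicator_def dist_norm)
  also have "\<dots> = (LINT x|distr lborel borel ((+) e). F x)"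
    by (subst integral_distr) auto
  also have "\<dots> = (LINT x|lborel. F x)"
    by (simp add: lborel_distr_plus)
  also have "\<dots> \<le> (LINT x:cball 0 (R + r)|lborel. f x)"
    unfolding set_lebesgue_integral_def
  proof (rule integral_mono')
    show "integrable lborel (\<lambda>x. indicator (cball 0 (R + r)) x *\<^sub>R f x)"
      using set_integrable_cball_continuous[OF f(1)] by (simp add: set_integrable_def)
    show "F x \<le> indicator (cball 0 (R + r)) x *\<^sub>R f x" for x
    proof -
      have "norm x \<le> R + r" if "norm (x - e) \<le> R"
        using norm_triangle_ineq[of "x - e" e] that e by simp
      then show ?thesis
        using f(2)[of x] by (auto simp: F_def indicator_def dist_norm norm_minus_commute)
    qed
    show "0 \<le> indicator (cball 0 (R + r)) x *\<^sub>R f x" for x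
      using f(2) by simp
  qed
  finally show ?thesis .
qed

lemma continuous_on_sdiff [continuous_intros]:
  fixes g :: "'a::real_normed_vector \<Rightarrow> real"
  assumes g: "continuous_on UNIV g" and "continuous_on S a" "continuous_on S b"
  shows "continuous_on S (\<lambda>x. sdiff g (a x) (b x))"
  unfolding sdiff_def using assms(2,3)
  by (intro continuous_intros continuous_on_compose2[OF g]) auto

lemma continuous_on_tdiff [continuous_intros]:
  fixes g :: "'a::real_normed_vector \<Rightarrow> real"
  assumes g: "continuous_on UNIV g" and "continuous_on S a" "continuous_on S b"
  shows "continuous_on S (\<lambda>x. tdiff g (a x) (b x))"
  unfolding tdiff_def using assms(2,3)
  by (intro continuous_intros continuous_on_compose2[OF g]) auto

text \<open>The second difference with step \<open>2w\<close> is an average with weights 1/4, 1/2, 1/4 of second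
  differences with step \<open>w\<close>; the variance of the averaged values controls the third difference.\<close>

lemma sdiff_double_variance:
  "(sdiff g (x + w) (2 *\<^sub>R w))\<^sup>2 / 16 + (tdiff g x w)\<^sup>2 / 8
    \<le> (sdiff g (x + 2 *\<^sub>R w) w)\<^sup>2 / 4 + (sdiff g (x + w) w)\<^sup>2 / 2 + (sdiff g x w)\<^sup>2 / 4"
proof -
  define a b c where "a = sdiff g (x + 2 *\<^sub>R w) w" and "b = sdiff g (x + w) w" and "c = sdiff g x w"
  have 1: "sdiff g (x + w) (2 *\<^sub>R w) = a + 2 * b + c"
    unfolding a_def b_def c_def sdiff_def scaleR_2 by (simp add: algebra_simps)
  have 2: "tdiff g x w = a - b"
    by (simp add: tdiff_eq_sdiff a_def b_def)
  have 3: "a\<^sup>2 / 4 + b\<^sup>2 / 2 + c\<^sup>2 / 4 - ((a + 2 * b + c)\<^sup>2 / 16 + (a - b)\<^sup>2 / 8)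
      = (b - c)\<^sup>2 / 8 + (a - c)\<^sup>2 / 16"
    by (simp add: power2_eq_square field_simps)
  have 4: "0 \<le> (b - c)\<^sup>2 / 8 + (a - c)\<^sup>2 / 16"
    by simp
  show ?thesis
    unfolding a_def[symmetric] b_def[symmetric] c_def[symmetric] 1 2 using 3 4 by linarith
qed

text \<open>The averaging weights add up to one, so after integration only an enlargement of the
  ball is lost: r for centring the doubled difference at x, and 2r for translating the averaged
  ones.\<close>

lemma sdiff_energy_step:
  fixes g :: "'a::euclidean_space \<Rightarrow> real"
  assumes g: "continuous_on UNIV g" and w: "norm w \<le> r"
  shows "(LINT x:cball 0 \<rho>|lborel. (sdiff g x (2 *\<^sub>R w))\<^sup>2) / 16 + (LINT x:cball 0 \<rho>|lborel. (tdiff g x w)\<^sup>2) / 8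
    \<le> (LINT x:cball 0 (\<rho> + 3 * r)|lborel. (sdiff g x w)\<^sup>2)"
proof -
  have r: "0 \<le> r" using w norm_ge_zero order_trans by blast
  note int = set_integrable_cball_continuous[of _ 0 "\<rho> + r"]
  have c: "continuous_on UNIV (\<lambda>x. (sdiff g x w)\<^sup>2)" "continuous_on UNIV (\<lambda>x. (sdiff g (x + w) (2 *\<^sub>R w))\<^sup>2)"
     "continuous_on UNIV (\<lambda>x. (sdiff g (x + w) w)\<^sup>2)" "continuous_on UNIV (\<lambda>x. (sdiff g (x + 2 *\<^sub>R w) w)\<^sup>2)"
     "continuous_on UNIV (\<lambda>x. (tdiff g x w)\<^sup>2)"
    by (intro continuous_intros g)+
  have "(LINT x:cball 0 \<rho>|lborel. (sdiff g ((x + - w) + w) (2 *\<^sub>R w))\<^sup>2)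
      \<le> (LINT x:cball 0 (\<rho> + r)|lborel. (sdiff g (x + w) (2 *\<^sub>R w))\<^sup>2)"
    using set_integral_cball_shift_le[OF c(2), of "- w" r \<rho>] w by simp
  moreover have "(LINT x:cball 0 \<rho>|lborel. (tdiff g x w)\<^sup>2) \<le> (LINT x:cball 0 (\<rho> + r)|lborel. (tdiff g x w)\<^sup>2)"
    using set_integral_cball_mono_set[OF c(5)] r by simp
  moreover have "(LINT x:cball 0 (\<rho> + r)|lborel. (sdiff g (x + w) (2 *\<^sub>R w))\<^sup>2) / 16
      + (LINT x:cball 0 (\<rho> + r)|lborel. (tdiff g x w)\<^sup>2) / 8
      \<le> (LINT x:cball 0 (\<rho> + r)|lborel. (sdiff g (x + 2 *\<^sub>R w) w)\<^sup>2) / 4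
      + (LINT x:cball 0 (\<rho> + r)|lborel. (sdiff g (x + w) w)\<^sup>2) / 2
      + (LINT x:cball 0 (\<rho> + r)|lborel. (sdiff g x w)\<^sup>2) / 4"
    unfolding set_integral_divide_zero[symmetric]
    by (subst set_integral_add(2)[symmetric],
        (intro int set_integral_add(1) continuous_intros g; simp)+)+
       (intro set_integral_mono int continuous_intros g sdiff_double_variance; simp)
  moreover have "(LINT x:cball 0 (\<rho> + r)|lborel. (sdiff g (x + 2 *\<^sub>R w) w)\<^sup>2) \<le> (LINT x:cball 0 (\<rho> + r + 2 * r)|lborel. (sdiff g x w)\<^sup>2)"
    using set_integral_cball_shift_le[OF c(1), of "2 *\<^sub>R w" "2 * r" "\<rho> + r"] w by simp
  moreover have "(LINT x:cball 0 (\<rho> + r)|lborel. (sdiff g (x + w) w)\<^sup>2) \<le> (LINT x:cball 0 (\<rho> + r + 2 * r)|lborel. (sdiff g x w)\<^sup>2)"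
    using set_integral_cball_shift_le[OF c(1), of w "2 * r" "\<rho> + r"] w r by simp
  moreover have "(LINT x:cball 0 (\<rho> + r)|lborel. (sdiff g x w)\<^sup>2) \<le> (LINT x:cball 0 (\<rho> + r + 2 * r)|lborel. (sdiff g x w)\<^sup>2)"
    using set_integral_cball_mono_set[OF c(1)] r by simp
  moreover have "\<rho> + r + 2 * r = \<rho> + 3 * r" by simp
  ultimately show ?thesis by simp
qed

lemma tdiff_energy_tendsto_zero:
  fixes g :: "'a::euclidean_space \<Rightarrow> real"
  assumes g: "continuous_on UNIV g" and C: "sdiff_bounded C g"
  shows "(\<lambda>k. 16 ^ k * (LINT x:cball 0 R|lborel. (tdiff g x ((1 / 2 ^ k) *\<^sub>R e))\<^sup>2)) \<longlonglongrightarrow> 0"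
proof -
  \<comment> \<open>The radius grows by three times the step at each halving. The steps form a
    geometric series, so all balls stay within radius R + 3|e|.\<close>
  define \<rho> where "\<rho> = (\<lambda>k::nat. R + 3 * norm e * (1 - 1 / 2 ^ k))"
  \<comment> \<open>The factor 16^k is h^(-4) for h = 2^(-k), the normalisation of a squared second
    difference.\<close>
  define E where "E = (\<lambda>k. 16 ^ k * (LINT x:cball 0 (\<rho> k)|lborel. (sdiff g x ((1 / 2 ^ k) *\<^sub>R e))\<^sup>2))"
  define T where "T = (\<lambda>k. 16 ^ k * (LINT x:cball 0 R|lborel. (tdiff g x ((1 / 2 ^ k) *\<^sub>R e))\<^sup>2))"
  define K where "K = (LINT x:cball (0::'a) (R + 3 * norm e)|lborel. (C * (norm e)\<^sup>2)\<^sup>2)"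
  have T0: "0 \<le> T k" for k
    unfolding T_def set_lebesgue_integral_def by (intro mult_nonneg_nonneg integral_nonneg) auto
  have E0: "0 \<le> E k" for k
    unfolding E_def set_lebesgue_integral_def by (intro mult_nonneg_nonneg integral_nonneg) auto
  have step: "E k + T (Suc k) / 8 \<le> E (Suc k)" for k
  proof -
    define w where "w = (1 / 2 ^ Suc k) *\<^sub>R e"
    have w2: "2 *\<^sub>R w = (1 / 2 ^ k) *\<^sub>R e"
      by (simp add: w_def)
    have "norm w \<le> norm e / 2 ^ Suc k"
      by (simp add: w_def)
    note st = sdiff_energy_step[OF g this, of "\<rho> k"]
    have rho: "\<rho> k + 3 * (norm e / 2 ^ Suc k) = \<rho> (Suc k)"
      by (simp add: \<rho>_def field_simps)
    have "(LINT x:cball 0 R|lborel. (tdiff g x w)\<^sup>2) \<le> (LINT x:cball 0 (\<rho> k)|lborel. (tdiff g x w)\<^sup>2)"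
      by (intro set_integral_cball_mono_set continuous_intros g) (auto simp: \<rho>_def)
    with st have "(LINT x:cball 0 (\<rho> k)|lborel. (sdiff g x (2 *\<^sub>R w))\<^sup>2) / 16 + (LINT x:cball 0 R|lborel. (tdiff g x w)\<^sup>2) / 8
       \<le> (LINT x:cball 0 (\<rho> (Suc k))|lborel. (sdiff g x w)\<^sup>2)"
      unfolding rho by simp
    then have "16 ^ Suc k * ((LINT x:cball 0 (\<rho> k)|lborel. (sdiff g x (2 *\<^sub>R w))\<^sup>2) / 16 + (LINT x:cball 0 R|lborel. (tdiff g x w)\<^sup>2) / 8)
       \<le> 16 ^ Suc k * (LINT x:cball 0 (\<rho> (Suc k))|lborel. (sdiff g x w)\<^sup>2)"
      by (intro mult_left_mono) auto
    then show ?thesis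
      unfolding E_def T_def w2 unfolding w_def by (simp add: algebra_simps)
  qed
  have p4: "(2 ^ k)\<^sup>2 = (4::real) ^ k" and p16: "(4 ^ k)\<^sup>2 = (16::real) ^ k" for k
    by (simp_all add: power2_eq_square flip: power_mult_distrib)
  have EK: "E k \<le> K" for k
  proof -
    have pw: "16 ^ k * (sdiff g x ((1 / 2 ^ k) *\<^sub>R e))\<^sup>2 \<le> (C * (norm e)\<^sup>2)\<^sup>2" for x
    proof -
      have "\<bar>sdiff g x ((1 / 2 ^ k) *\<^sub>R e)\<bar> \<le> C * (norm ((1 / 2 ^ k) *\<^sub>R e))\<^sup>2"
        using C unfolding sdiff_bounded_def by blast
      also have "\<dots> = C * (norm e)\<^sup>2 / 4 ^ k"
        by (simp add: power_divide p4)
      finally have "(sdiff g x ((1 / 2 ^ k) *\<^sub>R e))\<^sup>2 \<le> (C * (norm e)\<^sup>2 / 4 ^ k)\<^sup>2"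
        by (metis abs_ge_zero power2_abs power_mono)
      also have "\<dots> = (C * (norm e)\<^sup>2)\<^sup>2 / 16 ^ k"
        by (simp add: power_divide p16)
      finally show ?thesis by (simp add: field_simps)
    qed
    have "E k = (LINT x:cball 0 (\<rho> k)|lborel. 16 ^ k * (sdiff g x ((1 / 2 ^ k) *\<^sub>R e))\<^sup>2)"
      by (simp add: E_def)
    also have "\<dots> \<le> (LINT x:cball (0::'a) (\<rho> k)|lborel. (C * (norm e)\<^sup>2)\<^sup>2)"
      by (intro set_integral_mono set_integrable_cball_continuous continuous_intros g pw)
    also have "\<dots> \<le> K"
      unfolding K_def by (intro set_integral_cball_mono_set continuous_intros)
        (auto simp: \<rho>_def intro!: mult_left_le)
    finally show ?thesis .
  qed
  \<comment> \<open>Telescoping: the increments of the bounded sequence E dominate T (Suc k) / 8, so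
    these terms are summable.\<close>
  have "(\<Sum>k<n. T (Suc k) / 8) \<le> E n" for n
  proof (induction n)
    case (Suc n)
    then show ?case using step[of n] by simp
  qed (simp add: E0)
  then have "summable (\<lambda>k. T (Suc k) / 8)"
    using EK T0 by (intro summableI_nonneg_bounded[where x = K]) (auto intro: order_trans)
  then have "(\<lambda>k. T (Suc k) / 8) \<longlonglongrightarrow> 0"
    by (rule summable_LIMSEQ_zero)
  then have "(\<lambda>k. 8 * (T (Suc k) / 8)) \<longlonglongrightarrow> 8 * 0"
    by (intro tendsto_intros)
  then have "T \<longlonglongrightarrow> 0"
    by (subst filterlim_sequentially_Suc[symmetric]) simp
  then show ?thesis
    by (simp add: T_def)
qed

text \<open>Otherwise \<Phi> exceeds \<kappa> on disjoint balls whose total volume already makes the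
  integral too large. The bound h \<le> 1 keeps the balls within radius R + 1.\<close>

lemma packing_small_value:
  fixes \<Phi> :: "'a::euclidean_space \<Rightarrow> real" and x :: "'i \<Rightarrow> 'a"
  assumes \<Phi>: "continuous_on UNIV \<Phi>" "\<And>y. 0 \<le> \<Phi> y" and I: "finite I"
    and sep: "\<And>i j. i \<in> I \<Longrightarrow> j \<in> I \<Longrightarrow> i \<noteq> j \<Longrightarrow> 2 * h \<le> dist (x i) (x j)"
    and x: "\<And>i. i \<in> I \<Longrightarrow> norm (x i) \<le> R" and h: "0 < h" "h \<le> 1"
    and less: "(LINT y:cball 0 (R + 1)|lborel. \<Phi> y) < real (card I) * (h ^ DIM('a) * measure lborel (ball (0::'a) 1)) * \<kappa>"
  shows "\<exists>i\<in>I. \<exists>y. norm (y - x i) \<le> h \<and> \<Phi> y \<le> \<kappa>"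
proof (rule ccontr)
  assume neg: "\<not> ?thesis"
  then have big: "\<kappa> < \<Phi> y" if "i \<in> I" "y \<in> ball (x i) h" for i y
  proof -
    have "norm (y - x i) \<le> h"
      using that(2) by (simp add: dist_norm norm_minus_commute)
    then show ?thesis using neg that(1) by (meson linorder_not_le)
  qed
  define B where "B = (\<Union>i\<in>I. ball (x i) h)"
  have dis: "disjoint_family_on (\<lambda>i. ball (x i) h) I"
    unfolding disjoint_family_on_def
  proof (intro ballI impI)
    fix i j assume ij: "i \<in> I" "j \<in> I" "i \<noteq> j"
    have False if "dist (x i) y < h" "dist (x j) y < h" for y
      using sep[OF ij] dist_triangle2[of "x i" "x j" y] that by simp
    then show "ball (x i) h \<inter> ball (x j) h = {}"
      by auto
  qed
  have mB: "measure lborel B = real (card I) * (h ^ DIM('a) * measure lborel (ball (0::'a) 1))"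
  proof -
    have "measure lborel B = (\<Sum>i\<in>I. measure lborel (ball (x i) h))"
      unfolding B_def using I dis emeasure_lborel_ball_finite
      by (intro measure_finite_Union) (auto simp: less_top[symmetric])
    also have "\<dots> = (\<Sum>i\<in>I. h ^ DIM('a) * measure lborel (ball (0::'a) 1))"
      using content_ball_conv_unit_ball[of h "x _"] h by (intro sum.cong) auto
    finally show ?thesis by simp
  qed
  have sub: "B \<subseteq> cball 0 (R + 1)"
  proof
    fix y assume "y \<in> B"
    then obtain i where i: "i \<in> I" "dist (x i) y < h" by (auto simp: B_def)
    then show "y \<in> cball 0 (R + 1)"
      using x[OF i(1)] h dist_triangle[of 0 y "x i"] by simp
  qed
  have fin: "emeasure lborel B < \<infinity>"
  proof -
    have "emeasure lborel B \<le> emeasure lborel (cball (0::'a) (R + 1))"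
      by (intro emeasure_mono sub) simp
    also have "\<dots> < \<infinity>" by (rule emeasure_lborel_cball_finite)
    finally show ?thesis .
  qed
  have [measurable]: "B \<in> sets lborel"
    by (simp add: B_def borel_open open_UN)
  have "real (card I) * (h ^ DIM('a) * measure lborel (ball (0::'a) 1)) * \<kappa> = (LINT y|lborel. indicator B y *\<^sub>R \<kappa>)"
    using fin by (simp add: mB)
  also have "\<dots> \<le> (LINT y:cball 0 (R + 1)|lborel. \<Phi> y)"
    unfolding set_lebesgue_integral_def
  proof (rule integral_mono')
    show "integrable lborel (\<lambda>y. indicator (cball 0 (R + 1)) y *\<^sub>R \<Phi> y)"
      using set_integrable_cball_continuous[OF \<Phi>(1)] by (simp add: set_integrable_def)
    show "indicator B y *\<^sub>R \<kappa> \<le> indicator (cball 0 (R + 1)) y *\<^sub>R \<Phi> y" for y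
    proof (cases "y \<in> B")
      case True
      then have "\<kappa> \<le> \<Phi> y" using big by (auto simp: B_def intro: less_imp_le)
      moreover have "y \<in> cball 0 (R + 1)" using True sub by blast
      ultimately show ?thesis using True by simp
    next
      case False
      then show ?thesis using \<Phi>(2) by simp
    qed
    show "0 \<le> indicator (cball 0 (R + 1)) y *\<^sub>R \<Phi> y" for y
      using \<Phi>(2) by simp
  qed
  finally show False using less by simp
qed

section \<open>Scales of approximate second-order differentiability\<close>

lemma finite_net_cball:
  assumes "0 < \<mu>" "\<mu> \<le> 1"
  obtains Z where "finite Z" "\<And>z. z \<in> Z \<Longrightarrow> norm z \<le> R + 1"
    "\<And>z :: 'a::euclidean_space. norm z \<le> R \<Longrightarrow> \<exists>\<xi>\<in>Z. norm (z - \<xi>) \<le> \<mu>"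
proof -
  obtain k where k: "finite k" "cball (0::'a) R \<subseteq> (\<Union>x\<in>k. ball x \<mu>)"
    using compact_cball[of "0::'a" R] assms(1) unfolding compact_eq_totally_bounded by blast
  show thesis
  proof
    show "finite (k \<inter> cball 0 (R + 1))" using k by simp
    show "norm z \<le> R + 1" if "z \<in> k \<inter> cball 0 (R + 1)" for z using that by simp
    fix z :: 'a assume z: "norm z \<le> R"
    then obtain \<xi> where \<xi>: "\<xi> \<in> k" "norm (z - \<xi>) < \<mu>"
      using k(2) by (force simp: dist_norm norm_minus_commute)
    have "norm \<xi> \<le> R + 1"
      using norm_triangle_ineq3[of z \<xi>] z \<xi>(2) assms by simp
    then show "\<exists>\<xi>\<in>k \<inter> cball 0 (R + 1). norm (z - \<xi>) \<le> \<mu>"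
      using \<xi> by (intro bexI[of _ \<xi>]) auto
  qed
qed

lemma set_integral_cball_sum:
  fixes f :: "'i \<Rightarrow> 'a::euclidean_space \<Rightarrow> real"
  assumes "\<And>i. i \<in> I \<Longrightarrow> continuous_on UNIV (f i)"
  shows "(LINT x:cball a R|lborel. \<Sum>i\<in>I. f i x) = (\<Sum>i\<in>I. LINT x:cball a R|lborel. f i x)"
  unfolding set_lebesgue_integral_def scaleR_sum_right
  using set_integrable_cball_continuous[OF assms] by (intro Bochner_Integration.integral_sum) (simp add: set_integrable_def)

text \<open>The factor 8 is the sum of the coefficients 1, 3, 3, 1. This allows arbitrary arguments
  of a third difference to be replaced by points of a net.\<close>

lemma tdiff_perturb:
  fixes f :: "'a::real_normed_vector \<Rightarrow> real"
  assumes f: "\<And>x d. norm x \<le> R \<Longrightarrow> norm d \<le> \<mu> \<Longrightarrow> \<bar>f (x + d) - f x\<bar> \<le> \<eta>"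
    and z: "norm z + 3 * norm e \<le> R" and d: "norm (z' - z) + 3 * norm (e' - e) \<le> \<mu>"
  shows "\<bar>tdiff f z' e' - tdiff f z e\<bar> \<le> 8 * \<eta>"
proof -
  have *: "\<bar>f (z' + t *\<^sub>R e') - f (z + t *\<^sub>R e)\<bar> \<le> \<eta>" if t: "0 \<le> t" "t \<le> 3" for t
  proof -
    have "norm (z + t *\<^sub>R e) \<le> norm z + norm (t *\<^sub>R e)" by (rule norm_triangle_ineq)
    also have "\<dots> \<le> norm z + 3 * norm e" using t by (simp add: mult_right_mono)
    finally have 1: "norm (z + t *\<^sub>R e) \<le> R" using z by simp
    have "norm ((z' - z) + t *\<^sub>R (e' - e)) \<le> norm (z' - z) + norm (t *\<^sub>R (e' - e))"
      by (rule norm_triangle_ineq)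
    also have "\<dots> \<le> norm (z' - z) + 3 * norm (e' - e)" using t by (simp add: mult_right_mono)
    finally have 2: "norm ((z' - z) + t *\<^sub>R (e' - e)) \<le> \<mu>" using d by simp
    have "z + t *\<^sub>R e + ((z' - z) + t *\<^sub>R (e' - e)) = z' + t *\<^sub>R e'"
      by (simp add: algebra_simps)
    then show ?thesis using f[OF 1 2] by (simp only:)
  qed
  show ?thesis
    unfolding tdiff_def using *[of 0] *[of 1] *[of 2] *[of 3] by simp
qed

text \<open>The blow-up of g at a with scale h. Second and third differences ignore the affine part
  that is subtracted, so one constant C serves every scale and all blow-ups lie in one compact
  class.\<close>

definition rescaled :: "('a::real_inner \<Rightarrow> real) \<Rightarrow> 'a \<Rightarrow> 'a \<Rightarrow> real \<Rightarrow> 'a \<Rightarrow> real" where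
  "rescaled g a p h z = (g (a + h *\<^sub>R z) - g a - h * (p \<bullet> z)) / h\<^sup>2"

lemma sdiff_rescaled:
  "sdiff (rescaled g a p h) z e = sdiff g (a + h *\<^sub>R z) (h *\<^sub>R e) / h\<^sup>2"
  by (simp add: sdiff_def rescaled_def algebra_simps diff_divide_distrib add_divide_distrib)

lemma tdiff_rescaled:
  "tdiff (rescaled g a p h) z e = tdiff g (a + h *\<^sub>R z) (h *\<^sub>R e) / h\<^sup>2"
  by (simp add: tdiff_eq_sdiff sdiff_rescaled algebra_simps diff_divide_distrib)

lemma sdiff_bounded_rescaled:
  assumes "sdiff_bounded C g" "h > 0"
  shows "sdiff_bounded C (rescaled g a p h)"
  unfolding sdiff_bounded_def
proof (intro allI)
  fix z e
  have "\<bar>sdiff g (a + h *\<^sub>R z) (h *\<^sub>R e)\<bar> \<le> C * (norm (h *\<^sub>R e))\<^sup>2"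
    using assms unfolding sdiff_bounded_def by blast
  then show "\<bar>sdiff (rescaled g a p h) z e\<bar> \<le> C * (norm e)\<^sup>2"
    using assms by (simp add: sdiff_rescaled abs_divide field_simps power_mult_distrib)
qed

lemma rescaled_bound:
  assumes "\<And>z. \<bar>g (a + z) - g a - p \<bullet> z\<bar> \<le> C * (norm z)\<^sup>2" "h > 0"
  shows "\<bar>rescaled g a p h z\<bar> \<le> C * (norm z)\<^sup>2"
  using assms(1)[of "h *\<^sub>R z"] assms(2)
  by (simp add: rescaled_def abs_divide field_simps power_mult_distrib)

text \<open>The spacing 3Lh is chosen so that the Lipschitz bound on the slopes separates the
  contact points by 3h. The factor \<open>CARD('n)\<close> comes from estimating the norm by the sum
  of the coordinates.\<close>

lemma lattice_slopes:
  fixes h :: real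
  assumes "0 < L" "0 < h" and N: "real CARD('n) * (3 * L * h) * real N \<le> s"
  defines "I \<equiv> (UNIV :: 'n::finite set) \<rightarrow>\<^sub>E {..<N}" and "q \<equiv> \<lambda>i :: 'n \<Rightarrow> nat. (\<chi> j. 3 * L * h * real (i j)) :: real^'n"
  shows "finite I" "card I = N ^ CARD('n)" "\<And>i. i \<in> I \<Longrightarrow> norm (q i) \<le> s"
    "\<And>i j. i \<noteq> j \<Longrightarrow> 3 * L * h \<le> norm (q i - q j)"
proof -
  show "finite I" unfolding I_def by (intro finite_PiE) auto
  show "card I = N ^ CARD('n)" unfolding I_def by (simp add: card_PiE)
  show "norm (q i) \<le> s" if "i \<in> I" for i
  proof -
    have "norm (q i) \<le> (\<Sum>j\<in>UNIV. \<bar>q i $ j\<bar>)" by (rule norm_le_l1_cart)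
    also have "\<dots> \<le> (\<Sum>j\<in>(UNIV :: 'n set). 3 * L * h * real N)"
    proof (rule sum_mono)
      fix j :: 'n
      have "i j < N" using that by (auto simp: I_def PiE_def Pi_def)
      then show "\<bar>q i $ j\<bar> \<le> 3 * L * h * real N"
        using assms(1,2) by (auto simp: q_def abs_mult)
    qed
    also have "\<dots> \<le> s" using N by (simp add: algebra_simps)
    finally show ?thesis .
  qed
  show "3 * L * h \<le> norm (q i - q j)" if "i \<noteq> j" for i j
  proof -
    obtain l where l: "i l \<noteq> j l" using \<open>i \<noteq> j\<close> by blast
    then have "1 \<le> \<bar>real (i l) - real (j l)\<bar>" by linarith
    then have "3 * L * h * 1 \<le> 3 * L * h * \<bar>real (i l) - real (j l)\<bar>"
      using assms(1,2) by (intro mult_left_mono) auto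
    also have "\<dots> = \<bar>(q i - q j) $ l\<bar>"
      using assms(1,2) by (simp add: q_def abs_mult flip: right_diff_distrib)
    also have "\<dots> \<le> norm (q i - q j)" by (rule component_le_norm_cart)
    finally show ?thesis by simp
  qed
qed

text \<open>The points \<open>x q\<close> belonging to a lattice of slopes with spacing proportional to \<open>h\<close> are
  \<open>3h\<close>-separated and number about \<open>h\<^bsup>-n\<^esup>\<close>, so the balls of radius \<open>h\<close> around them fill a fixed
  proportion of the volume. As the energy of the third differences at scale \<open>h\<close> tends to zero,
  one of these balls contains a point with small third differences.\<close>

proposition exists_near_quadratic_scale:
  fixes g :: "real^'n \<Rightarrow> real" and x p :: "real^'n \<Rightarrow> real^'n"
  assumes g: "continuous_on UNIV g" and C: "0 \<le> C" "sdiff_bounded C g" and s: "0 < s" and L: "0 < L"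
    and x: "\<And>q. norm q \<le> s \<Longrightarrow> norm (x q) \<le> R"
    and sep: "\<And>q q'. norm q \<le> s \<Longrightarrow> norm q' \<le> s \<Longrightarrow> norm (q - q') \<le> L * norm (x q - x q')"
    and p: "\<And>q z. norm q \<le> s \<Longrightarrow> \<bar>g (x q + z) - g (x q) - p q \<bullet> z\<bar> \<le> C * (norm z)\<^sup>2"
    and \<zeta>: "0 < \<zeta>"
  shows "\<exists>q h A. norm q \<le> s \<and> 0 < h \<and> h < \<zeta> \<and> A \<in> sym_matrices \<and>
    (\<forall>z. norm z \<le> h \<longrightarrow> \<bar>g (x q + z) - g (x q) - p q \<bullet> z - z \<bullet> (A *v z) / 2\<bar> \<le> \<zeta> * h\<^sup>2)"
proof -
  obtain \<eta> where \<eta>: "\<eta> > 0" and near: "\<And>f :: real^'n \<Rightarrow> real. sdiff_bounded C f \<Longrightarrow> (\<And>z. \<bar>f z\<bar> \<le> C * (norm z)\<^sup>2) \<Longrightarrow>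
      (\<And>z e. norm z \<le> 4 \<Longrightarrow> norm e \<le> 4 \<Longrightarrow> \<bar>tdiff f z e\<bar> \<le> \<eta>) \<Longrightarrow>
      \<exists>A\<in>sym_matrices. \<forall>z. norm z \<le> 1 \<longrightarrow> \<bar>f z - z \<bullet> (A *v z) / 2\<bar> \<le> \<zeta>"
    using small_third_differences_imp_near_quadratic_form[OF C(1) \<zeta>] by metis
  \<comment> \<open>An oscillation \<eta>/16 costs \<eta>/2 in a third difference and leaves
    \<eta>/2 for the net points. The radius 25 is 1 + 6 + 18: 1 for the offset of y from the contact
    point, 6 for a net point as base, three times 6 for a net point as step.\<close>
  obtain \<mu>0 where \<mu>0: "\<mu>0 > 0" and mod: "\<And>f :: real^'n \<Rightarrow> real. \<And>x d. sdiff_bounded C f \<Longrightarrow> (\<And>z. \<bar>f z\<bar> \<le> C * (norm z)\<^sup>2) \<Longrightarrow>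
      norm x \<le> 25 \<Longrightarrow> norm d \<le> \<mu>0 \<Longrightarrow> \<bar>f (x + d) - f x\<bar> \<le> \<eta> / 16"
    using sdiff_bounded_equicontinuous[OF C(1), of "\<eta> / 16" 25] \<eta> by (metis zero_less_divide_iff zero_less_numeral)
  define \<mu> where "\<mu> = min 1 (\<mu>0 / 4)"
  have \<mu>: "0 < \<mu>" "\<mu> \<le> 1" "\<mu> + 3 * \<mu> \<le> \<mu>0" using \<mu>0 by (auto simp: \<mu>_def)
  \<comment> \<open>The differences z - z0 with |z| \<le> 4 and |z0| \<le> 1 have to be covered,
    hence radius 5.\<close>
  obtain Z where Z: "finite Z" "\<And>z. z \<in> Z \<Longrightarrow> norm z \<le> 5 + 1"
    "\<And>z :: real^'n. norm z \<le> 5 \<Longrightarrow> \<exists>\<xi>\<in>Z. norm (z - \<xi>) \<le> \<mu>"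
    using finite_net_cball[OF \<mu>(1,2), of 5] by blast
  define h where "h = (\<lambda>k. 1 / 2 ^ k :: real)"
  have h: "0 < h k" "h k \<le> 1" for k by (simp_all add: h_def)
  have h2: "1 / (h k)\<^sup>2 = 4 ^ k" for k
    by (simp add: h_def power2_eq_square flip: power_mult_distrib)
  \<comment> \<open>The energy lemma treats one direction at a time. A finite sum over net points,
    used both as base points and as steps, makes it control all third differences of a
    blow-up.\<close>
  define \<Phi> where "\<Phi> = (\<lambda>k y. \<Sum>\<xi>\<in>Z. \<Sum>e\<in>Z. 16 ^ k * (tdiff g (y + h k *\<^sub>R \<xi>) (h k *\<^sub>R e))\<^sup>2)"
  have \<Phi>c: "continuous_on UNIV (\<Phi> k)" for k
    unfolding \<Phi>_def by (intro continuous_intros g)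
  have \<Phi>0: "0 \<le> \<Phi> k y" for k y
    unfolding \<Phi>_def by (intro sum_nonneg) auto
  have \<Phi>lim: "(\<lambda>k. LINT y:cball 0 (R + 1)|lborel. \<Phi> k y) \<longlonglongrightarrow> 0"
  proof (rule Lim_null_comparison)
    define B where "B = (\<lambda>k. \<Sum>\<xi>\<in>Z. \<Sum>e\<in>Z. 16 ^ k * (LINT y:cball 0 (R + 1 + 6)|lborel. (tdiff g y (h k *\<^sub>R e))\<^sup>2))"
    have "(LINT y:cball 0 (R + 1)|lborel. \<Phi> k y) \<le> B k" for k
    proof -
      have "(LINT y:cball 0 (R + 1)|lborel. \<Phi> k y) = (\<Sum>\<xi>\<in>Z. \<Sum>e\<in>Z. 16 ^ k * (LINT y:cball 0 (R + 1)|lborel. (tdiff g (y + h k *\<^sub>R \<xi>) (h k *\<^sub>R e))\<^sup>2))"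
        unfolding \<Phi>_def
        by (simp add: set_integral_cball_sum continuous_on_sum continuous_intros g)
      also have "\<dots> \<le> B k"
        unfolding B_def
      proof (intro sum_mono mult_left_mono)
        fix \<xi> e assume "\<xi> \<in> Z"
        then have "norm (h k *\<^sub>R \<xi>) \<le> 1 * 6"
          unfolding norm_scaleR using Z(2)[of \<xi>] h[of k] by (intro mult_mono) auto
        then show "(LINT y:cball 0 (R + 1)|lborel. (tdiff g (y + h k *\<^sub>R \<xi>) (h k *\<^sub>R e))\<^sup>2)
            \<le> (LINT y:cball 0 (R + 1 + 6)|lborel. (tdiff g y (h k *\<^sub>R e))\<^sup>2)"
          by (intro set_integral_cball_shift_le[where f = "\<lambda>y. (tdiff g y (h k *\<^sub>R e))\<^sup>2"] continuous_intros g) auto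
      qed auto
      finally show ?thesis .
    qed
    moreover have "0 \<le> (LINT y:cball 0 (R + 1)|lborel. \<Phi> k y)" for k
      unfolding set_lebesgue_integral_def using \<Phi>0 by (intro Bochner_Integration.integral_nonneg) auto
    ultimately show "\<forall>\<^sub>F k in sequentially. norm (LINT y:cball 0 (R + 1)|lborel. \<Phi> k y) \<le> B k"
      by simp
    have "B \<longlonglongrightarrow> (\<Sum>\<xi>\<in>Z. \<Sum>e\<in>Z. 0)"
      unfolding B_def h_def by (intro tendsto_sum tdiff_energy_tendsto_zero[OF g C(2)])
    then show "B \<longlonglongrightarrow> 0" by simp
  qed
  define n where "n = CARD('n)"
  have n: "0 < n" by (simp add: n_def)
  \<comment> \<open>With N near s/(3Lnh) the product N h is near 2c. Rounding N down costs at most h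
    < c, so N h \<ge> c remains.\<close>
  define c where "c = s / (6 * L * real n)"
  have c: "0 < c" using s L n by (simp add: c_def)
  define \<omega> where "\<omega> = measure lborel (ball (0 :: real^'n) 1)"
  have \<omega>: "0 < \<omega>" unfolding \<omega>_def by (rule content_ball_pos) simp
  define \<kappa> where "\<kappa> = (\<eta> / 2)\<^sup>2"
  have \<kappa>: "0 < \<kappa>" using \<eta> by (simp add: \<kappa>_def)
  have hlim: "h \<longlonglongrightarrow> 0"
    unfolding h_def using LIMSEQ_realpow_zero[of "1 / 2 :: real"] by (simp add: power_one_over)
  have "\<forall>\<^sub>F k in sequentially. (LINT y:cball 0 (R + 1)|lborel. \<Phi> k y) < c ^ n * \<omega> * \<kappa> \<and> h k < \<zeta> \<and> h k < c"
    using c \<omega> \<kappa> \<zeta>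
    by (intro eventually_conj order_tendstoD(2)[OF \<Phi>lim] order_tendstoD(2)[OF hlim]) auto
  then obtain k where k: "(LINT y:cball 0 (R + 1)|lborel. \<Phi> k y) < c ^ n * \<omega> * \<kappa>" "h k < \<zeta>" "h k < c"
    using eventually_sequentially by auto
  define N where "N = nat \<lfloor>s / (3 * L * real n * h k)\<rfloor>"
  have Nup: "real N \<le> s / (3 * L * real n * h k)"
    unfolding N_def using s L h[of k] by (simp add: le_floor_iff)
  have "s / (3 * L * real n * h k) - 1 \<le> real N"
    unfolding N_def by linarith
  then have "(s / (3 * L * real n * h k) - 1) * h k \<le> real N * h k"
    using h[of k] by (intro mult_right_mono) auto
  moreover have "(s / (3 * L * real n * h k) - 1) * h k = 2 * c - h k"
    using h(1)[of k] by (simp add: c_def field_simps)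
  ultimately have Nh: "c \<le> real N * h k" using k(3) by simp
  have Nle: "real CARD('n) * (3 * L * h k) * real N \<le> s"
    using Nup L n h(1)[of k] by (simp add: n_def[symmetric] field_simps)
  define I where "I = (UNIV :: 'n set) \<rightarrow>\<^sub>E {..<N}"
  define q where "q = (\<lambda>i :: 'n \<Rightarrow> nat. (\<chi> j. 3 * L * h k * real (i j)) :: real^'n)"
  have lat: "finite I" "card I = N ^ CARD('n)" "\<And>i. i \<in> I \<Longrightarrow> norm (q i) \<le> s"
      "\<And>i j. i \<noteq> j \<Longrightarrow> 3 * L * h k \<le> norm (q i - q j)"
    unfolding I_def q_def by (fact lattice_slopes[OF L h(1)[of k] Nle])+
  have "\<exists>i\<in>I. \<exists>y. norm (y - x (q i)) \<le> h k \<and> \<Phi> k y \<le> \<kappa>"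
  proof (rule packing_small_value[OF \<Phi>c \<Phi>0 lat(1) _ _ h])
    show "2 * h k \<le> dist (x (q i)) (x (q j))" if "i \<in> I" "j \<in> I" "i \<noteq> j" for i j
    proof -
      have "3 * L * h k \<le> L * norm (x (q i) - x (q j))"
        using lat(4)[OF that(3)] sep[OF lat(3)[OF that(1)] lat(3)[OF that(2)]] by simp
      then have "L * (3 * h k) \<le> L * norm (x (q i) - x (q j))" by (simp add: algebra_simps)
      then have "3 * h k \<le> norm (x (q i) - x (q j))" using L by (simp add: mult_le_cancel_left)
      then show ?thesis using h(1)[of k] by (simp add: dist_norm)
    qed
    show "norm (x (q i)) \<le> R" if "i \<in> I" for i using x lat(3) that by blast
    \<comment> \<open>The total volume of the balls has a lower bound independent of k, whereas the
      integral of \<open>\<Phi> k\<close> tends to zero.\<close>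
    have "c ^ n * \<omega> * \<kappa> \<le> (real N * h k) ^ n * \<omega> * \<kappa>"
      using Nh c \<omega> \<kappa> by (intro mult_right_mono power_mono) auto
    also have "\<dots> = real (card I) * (h k ^ DIM(real^'n) * measure lborel (ball (0::real^'n) 1)) * \<kappa>"
      by (simp add: lat(2) n_def \<omega>_def power_mult_distrib)
    finally show "(LINT y:cball 0 (R + 1)|lborel. \<Phi> k y)
        < real (card I) * (h k ^ DIM(real^'n) * measure lborel (ball (0::real^'n) 1)) * \<kappa>"
      using k(1) by simp
  qed
  then obtain i y where i: "i \<in> I" and y: "norm (y - x (q i)) \<le> h k" "\<Phi> k y \<le> \<kappa>" by blast
  define a P where "a = x (q i)" and "P = p (q i)"
  note qs = lat(3)[OF i]
  have exp: "\<bar>g (a + z) - g a - P \<bullet> z\<bar> \<le> C * (norm z)\<^sup>2" for z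
    unfolding a_def P_def by (rule p[OF qs])
  define f where "f = rescaled g a P (h k)"
  have f1: "sdiff_bounded C f"
    unfolding f_def by (rule sdiff_bounded_rescaled[OF C(2) h(1)])
  have f2: "\<bar>f z\<bar> \<le> C * (norm z)\<^sup>2" for z
    unfolding f_def by (rule rescaled_bound[OF exp h(1)])
  have f3: "\<bar>tdiff f z e\<bar> \<le> \<eta>" if z: "norm z \<le> 4" and e: "norm e \<le> 4" for z e
  proof -
    \<comment> \<open>The good point y is only within distance h of the contact point. In blown-up
      coordinates z0 is its position, from which the net points are measured.\<close>
    define z0 where "z0 = (1 / h k) *\<^sub>R (y - a)"
    have hz0: "h k *\<^sub>R z0 = y - a" using h(1)[of k] by (simp add: z0_def)
    have z0: "norm z0 \<le> 1"
      unfolding z0_def norm_scaleR using y(1) h(1)[of k] by (simp add: a_def)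
    have "norm (z - z0) \<le> 5" using norm_triangle_ineq4[of z z0] z z0 by simp
    then obtain \<xi> where \<xi>: "\<xi> \<in> Z" "norm (z - z0 - \<xi>) \<le> \<mu>" using Z(3) by blast
    obtain e' where e': "e' \<in> Z" "norm (e - e') \<le> \<mu>" using Z(3)[of e] e by auto
    have "16 ^ k * (tdiff g (y + h k *\<^sub>R \<xi>) (h k *\<^sub>R e'))\<^sup>2 \<le> (\<Sum>e\<in>Z. 16 ^ k * (tdiff g (y + h k *\<^sub>R \<xi>) (h k *\<^sub>R e))\<^sup>2)"
      by (rule member_le_sum[OF e'(1)]) (auto simp: Z(1))
    also have "\<dots> \<le> \<Phi> k y"
      unfolding \<Phi>_def by (rule member_le_sum[OF \<xi>(1)]) (auto simp: Z(1) intro!: sum_nonneg)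
    finally have "16 ^ k * (tdiff g (y + h k *\<^sub>R \<xi>) (h k *\<^sub>R e'))\<^sup>2 \<le> (\<eta> / 2)\<^sup>2"
      using y(2) by (simp add: \<kappa>_def)
    moreover have "tdiff f (z0 + \<xi>) e' = 4 ^ k * tdiff g (y + h k *\<^sub>R \<xi>) (h k *\<^sub>R e')"
      unfolding f_def tdiff_rescaled using h2[of k] by (simp add: algebra_simps hz0 divide_inverse)
    moreover have "(4 ^ k)\<^sup>2 = (16 :: real) ^ k"
      by (simp add: power2_eq_square flip: power_mult_distrib)
    ultimately have "(tdiff f (z0 + \<xi>) e')\<^sup>2 \<le> (\<eta> / 2)\<^sup>2"
      by (simp add: power_mult_distrib)
    then have 1: "\<bar>tdiff f (z0 + \<xi>) e'\<bar> \<le> \<eta> / 2"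
      using \<eta> by (simp add: abs_le_square_iff[symmetric])
    have "\<bar>tdiff f z e - tdiff f (z0 + \<xi>) e'\<bar> \<le> 8 * (\<eta> / 16)"
    proof (rule tdiff_perturb[where R = 25 and \<mu> = \<mu>0])
      show "\<bar>f (x + d) - f x\<bar> \<le> \<eta> / 16" if "norm x \<le> 25" "norm d \<le> \<mu>0" for x d
        by (rule mod[OF f1 f2 that])
      show "norm (z0 + \<xi>) + 3 * norm e' \<le> 25"
        using Z(2)[OF \<xi>(1)] Z(2)[OF e'(1)] z0 norm_triangle_ineq[of z0 \<xi>] by simp
      show "norm (z - (z0 + \<xi>)) + 3 * norm (e - e') \<le> \<mu>0"
        using \<xi>(2) e'(2) \<mu>(3) by (simp add: diff_diff_eq)
    qed
    with 1 show ?thesis by linarith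
  qed
  obtain A where A: "A \<in> sym_matrices" "\<And>z. norm z \<le> 1 \<Longrightarrow> \<bar>f z - z \<bullet> (A *v z) / 2\<bar> \<le> \<zeta>"
    using near[OF f1 f2 f3] by blast
  have "\<bar>g (a + z) - g a - P \<bullet> z - z \<bullet> (A *v z) / 2\<bar> \<le> \<zeta> * (h k)\<^sup>2" if z: "norm z \<le> h k" for z
  proof -
    define w where "w = (1 / h k) *\<^sub>R z"
    have hw: "z = h k *\<^sub>R w" using h(1)[of k] by (simp add: w_def)
    have "norm w \<le> 1" unfolding w_def norm_scaleR using z h(1)[of k] by simp
    from A(2)[OF this] have "\<bar>f w - w \<bullet> (A *v w) / 2\<bar> * (h k)\<^sup>2 \<le> \<zeta> * (h k)\<^sup>2"
      by (rule mult_right_mono) simp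
    then have "\<bar>(f w - w \<bullet> (A *v w) / 2) * (h k)\<^sup>2\<bar> \<le> \<zeta> * (h k)\<^sup>2"
      by (simp add: abs_mult)
    moreover have "(f w - w \<bullet> (A *v w) / 2) * (h k)\<^sup>2 = g (a + z) - g a - P \<bullet> z - z \<bullet> (A *v z) / 2"
      unfolding f_def rescaled_def hw using h(1)[of k]
      by (simp add: field_simps power2_eq_square matrix_vector_mult_scaleR)
    ultimately show ?thesis by simp
  qed
  then show ?thesis
    using qs h(1) k(2) A(1) unfolding a_def P_def by blast
qed

section \<open>Regularisation by sup- and inf-convolution\<close>

lemma parallelogram_norm:
  fixes a b :: "'a::real_inner"
  shows "(norm (a + b))\<^sup>2 + (norm (a - b))\<^sup>2 = 2 * (norm a)\<^sup>2 + 2 * (norm b)\<^sup>2"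
  by (simp add: power2_norm_eq_inner algebra_simps inner_commute)

lemma norm_diff_square_le:
  fixes a b c :: "'a::real_inner"
  shows "(norm (a - c))\<^sup>2 \<le> 2 * (norm (a - b))\<^sup>2 + 2 * (norm (b - c))\<^sup>2"
proof -
  have "a - b + (b - c) = a - c" by simp
  from parallelogram_norm[of "a - b" "b - c", unfolded this]
  show ?thesis using zero_le_power2[of "norm (a - b - (b - c))"] by linarith
qed

lemma continuous_on_sdiff_bounded:
  fixes f :: "'a::real_normed_vector \<Rightarrow> real"
  assumes f: "sdiff_bounded C f" "0 \<le> C" and bdd: "\<And>R. \<exists>M. \<forall>x. norm x \<le> R \<longrightarrow> \<bar>f x\<bar> \<le> M"
  shows "continuous_on UNIV f"
  unfolding continuous_on_iff
proof (intro ballI allI impI)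
  fix x :: 'a and e :: real assume "0 < e"
  obtain M where M: "\<And>y. norm y \<le> norm x + 1 \<Longrightarrow> \<bar>f y\<bar> \<le> M"
    using bdd by blast
  define K where "K = 2 * M + C / 2"
  obtain j where j: "K / e < 2 ^ j"
    using real_arch_pow[of 2 "K / e"] by auto
  have "dist (f y) (f x) < e" if y: "dist y x < 1 / 2 ^ j" for y
  proof -
    have "\<bar>f (x + (y - x)) - f x\<bar> \<le> (2 * M + C / 2 * (1 - 1 / 2 ^ j)) / 2 ^ j"
      using y by (intro sdiff_bounded_oscillation[OF f, where R = "norm x"] M) (auto simp: dist_norm)
    also have "\<dots> \<le> K / 2 ^ j"
      using f unfolding K_def by (intro divide_right_mono add_mono) (auto intro!: mult_left_le)
    also have "\<dots> < e"
      using j \<open>0 < e\<close> by (simp add: field_simps)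
    finally show ?thesis by (simp add: dist_norm)
  qed
  then show "\<exists>d>0. \<forall>y\<in>UNIV. dist y x < d \<longrightarrow> dist (f y) (f x) < e"
    by (intro exI[of _ "1 / 2 ^ j"]) auto
qed

text \<open>The supremum runs over D only while y is arbitrary, so the convolutions live on the
  whole space and no boundary layer has to be cut from D.\<close>

definition sup_conv :: "'a set \<Rightarrow> ('a \<Rightarrow> real) \<Rightarrow> real \<Rightarrow> 'a::real_inner \<Rightarrow> real" where
  "sup_conv D u \<epsilon> y = (SUP z\<in>D. u z - (norm (y - z))\<^sup>2 / (4 * \<epsilon>))"

text \<open>In the notation of Lasry and Lions this is the inf-convolution with parameter \<open>\<epsilon>\<close> of the
  sup-convolution of \<open>u\<close> with parameter \<open>2\<epsilon>\<close>; the mismatch of the parameters makes it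
  differentiable with Lipschitz gradient.\<close>

definition sup_inf_conv :: "'a set \<Rightarrow> ('a \<Rightarrow> real) \<Rightarrow> real \<Rightarrow> 'a::real_inner \<Rightarrow> real" where
  "sup_inf_conv D u \<epsilon> x = (INF y. sup_conv D u \<epsilon> y + (norm (x - y))\<^sup>2 / (2 * \<epsilon>))"

locale convolution =
  fixes D :: "'a::euclidean_space set" and u :: "'a \<Rightarrow> real" and \<epsilon> :: real
  assumes conv_compact: "compact D" and conv_nonempty: "D \<noteq> {}" and conv_cont: "continuous_on D u" and conv_pos: "0 < \<epsilon>"
begin

abbreviation "c \<equiv> sup_conv D u \<epsilon>"
abbreviation "g \<equiv> sup_inf_conv D u \<epsilon>"

lemma bdd_above_conv: "bdd_above ((\<lambda>z. u z - (norm (y - z))\<^sup>2 / (4 * \<epsilon>)) ` D)"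
proof -
  have "continuous_on D (\<lambda>z. u z - (norm (y - z))\<^sup>2 / (4 * \<epsilon>))"
    using conv_pos by (intro continuous_intros conv_cont) auto
  then show ?thesis
    by (meson conv_compact bounded_imp_bdd_above compact_continuous_image compact_imp_bounded)
qed

lemma sup_conv_ge: "z \<in> D \<Longrightarrow> u z - (norm (y - z))\<^sup>2 / (4 * \<epsilon>) \<le> c y"
  unfolding sup_conv_def by (rule cSUP_upper[OF _ bdd_above_conv])

lemma sup_conv_le: "(\<And>z. z \<in> D \<Longrightarrow> u z - (norm (y - z))\<^sup>2 / (4 * \<epsilon>) \<le> K) \<Longrightarrow> c y \<le> K"
  unfolding sup_conv_def by (rule cSUP_least[OF conv_nonempty])

text \<open>Each function under the supremum has second difference exactly -|k|^2/(2\<epsilon>), and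
  a supremum preserves such lower bounds.\<close>

lemma sup_conv_semiconvex: "2 * c y - (norm k)\<^sup>2 / (2 * \<epsilon>) \<le> c (y + k) + c (y - k)"
proof -
  have "c y \<le> (c (y + k) + c (y - k) + (norm k)\<^sup>2 / (2 * \<epsilon>)) / 2"
  proof (rule sup_conv_le)
    fix z assume z: "z \<in> D"
    have "(norm (y + k - z))\<^sup>2 + (norm (y - k - z))\<^sup>2 = 2 * (norm (y - z))\<^sup>2 + 2 * (norm k)\<^sup>2"
      using parallelogram_norm[of "y - z" k] by (simp add: algebra_simps)
    then have "(norm (y + k - z))\<^sup>2 / (4 * \<epsilon>) + (norm (y - k - z))\<^sup>2 / (4 * \<epsilon>)
        = 2 * ((norm (y - z))\<^sup>2 / (4 * \<epsilon>)) + (norm k)\<^sup>2 / (2 * \<epsilon>)"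
      by (simp flip: add_divide_distrib) (simp add: add_divide_distrib field_simps)
    then show "u z - (norm (y - z))\<^sup>2 / (4 * \<epsilon>) \<le> (c (y + k) + c (y - k) + (norm k)\<^sup>2 / (2 * \<epsilon>)) / 2"
      using sup_conv_ge[OF z, of "y + k"] sup_conv_ge[OF z, of "y - k"] by simp
  qed
  then show ?thesis by simp
qed

text \<open>The factor 2 lost in |y - z|^2 \<le> 2|y - x|^2 + 2|x - z|^2 is the ratio of the
  denominators 4\<epsilon> and 2\<epsilon>. Taking the infimum over y puts g above the
  sup-convolution of u with parameter \<epsilon>.\<close>

lemma conv_inf_lower: "z \<in> D \<Longrightarrow> u z - (norm (x - z))\<^sup>2 / (2 * \<epsilon>) \<le> c y + (norm (x - y))\<^sup>2 / (2 * \<epsilon>)"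
proof -
  assume z: "z \<in> D"
  have "(norm (y - z))\<^sup>2 / (4 * \<epsilon>) \<le> (2 * (norm (y - x))\<^sup>2 + 2 * (norm (x - z))\<^sup>2) / (4 * \<epsilon>)"
    using conv_pos norm_diff_square_le by (intro divide_right_mono) auto
  also have "\<dots> = (norm (x - y))\<^sup>2 / (2 * \<epsilon>) + (norm (x - z))\<^sup>2 / (2 * \<epsilon>)"
    using conv_pos by (simp add: norm_minus_commute field_simps)
  finally show ?thesis using sup_conv_ge[OF z, of y] by simp
qed

lemma bdd_below_conv: "bdd_below (range (\<lambda>y. c y + (norm (x - y))\<^sup>2 / (2 * \<epsilon>)))"
proof -
  obtain z where "z \<in> D" using conv_nonempty by blast
  then show ?thesis using conv_inf_lower[of z x] by (intro bdd_belowI2) blast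
qed

lemma sup_inf_conv_le: "g x \<le> c y + (norm (x - y))\<^sup>2 / (2 * \<epsilon>)"
  unfolding sup_inf_conv_def by (rule cINF_lower[OF bdd_below_conv]) simp

lemma sup_inf_conv_ge: "z \<in> D \<Longrightarrow> u z - (norm (x - z))\<^sup>2 / (2 * \<epsilon>) \<le> g x"
  unfolding sup_inf_conv_def by (rule cINF_greatest) (auto intro: conv_inf_lower)

lemma sup_inf_conv_approx:
  assumes "0 < \<delta>"
  obtains y where "c y + (norm (x - y))\<^sup>2 / (2 * \<epsilon>) < g x + \<delta>"
proof -
  have "\<exists>y\<in>UNIV. c y + (norm (x - y))\<^sup>2 / (2 * \<epsilon>) < g x + \<delta>"
    using assms unfolding sup_inf_conv_def
    by (subst cINF_less_iff[symmetric, OF _ bdd_below_conv]) auto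
  then show thesis using that by blast
qed

text \<open>A near-minimiser for x also competes at x + h and x - h.\<close>

lemma sdiff_sup_inf_conv_le: "sdiff g x h \<le> (norm h)\<^sup>2 / \<epsilon>"
proof (rule field_le_epsilon)
  fix \<delta> :: real assume "0 < \<delta>"
  then obtain y where y: "c y + (norm (x - y))\<^sup>2 / (2 * \<epsilon>) < g x + \<delta> / 2"
    using sup_inf_conv_approx[of "\<delta> / 2" x] by auto
  have "(norm (x + h - y))\<^sup>2 + (norm (x - h - y))\<^sup>2 = 2 * (norm (x - y))\<^sup>2 + 2 * (norm h)\<^sup>2"
    using parallelogram_norm[of "x - y" h] by (simp add: algebra_simps)
  then have "(norm (x + h - y))\<^sup>2 / (2 * \<epsilon>) + (norm (x - h - y))\<^sup>2 / (2 * \<epsilon>)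
      = 2 * ((norm (x - y))\<^sup>2 / (2 * \<epsilon>)) + (norm h)\<^sup>2 / \<epsilon>"
    by (simp flip: add_divide_distrib) (simp add: add_divide_distrib field_simps)
  then show "sdiff g x h \<le> (norm h)\<^sup>2 / \<epsilon> + \<delta>"
    using sup_inf_conv_le[of "x + h" y] sup_inf_conv_le[of "x - h" y] y by (simp add: sdiff_def)
qed

text \<open>Semiconvexity survives the infimum: for near-minimisers a, b at x + h and x - h their
  midpoint competes at x. Semiconvexity of \<open>c\<close> loses |k|^2/(2\<epsilon>), the squares
  gain |h - k|^2/\<epsilon>, and the mismatch of the parameters makes the balance at least
  -|h|^2/\<epsilon>.\<close>

lemma sdiff_sup_inf_conv_ge: "- ((norm h)\<^sup>2 / \<epsilon>) \<le> sdiff g x h"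
proof (rule field_le_epsilon)
  fix \<delta> :: real assume "0 < \<delta>"
  then obtain a b where a: "c a + (norm (x + h - a))\<^sup>2 / (2 * \<epsilon>) < g (x + h) + \<delta> / 2"
    and b: "c b + (norm (x - h - b))\<^sup>2 / (2 * \<epsilon>) < g (x - h) + \<delta> / 2"
    using sup_inf_conv_approx[of "\<delta> / 2"] by (metis half_gt_zero)
  define y k where "y = (1 / 2) *\<^sub>R (a + b)" and "k = (1 / 2) *\<^sub>R (a - b)"
  have half: "(1 / 2) *\<^sub>R w + (1 / 2) *\<^sub>R w = w" for w :: 'a
    by (simp flip: scaleR_left_distrib)
  have ab: "y + k = a" "y - k = b"
    unfolding y_def k_def using half[of a] half[of b] by (simp_all add: algebra_simps)
  have "(norm (x + h - a))\<^sup>2 + (norm (x - h - b))\<^sup>2 = 2 * (norm (x - y))\<^sup>2 + 2 * (norm (h - k))\<^sup>2"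
    using parallelogram_norm[of "x - y" "h - k"] by (simp add: algebra_simps flip: ab)
  moreover have "(norm k)\<^sup>2 \<le> 2 * (norm (h - k))\<^sup>2 + 2 * (norm h)\<^sup>2"
    using norm_diff_square_le[of k 0 h] by (simp add: norm_minus_commute)
  ultimately have "(2 * (norm (x - y))\<^sup>2 + (norm k)\<^sup>2 - 2 * (norm h)\<^sup>2) / (2 * \<epsilon>)
      \<le> ((norm (x + h - a))\<^sup>2 + (norm (x - h - b))\<^sup>2) / (2 * \<epsilon>)"
    using conv_pos by (intro divide_right_mono) auto
  then have "2 * ((norm (x - y))\<^sup>2 / (2 * \<epsilon>)) + (norm k)\<^sup>2 / (2 * \<epsilon>) - (norm h)\<^sup>2 / \<epsilon>
      \<le> (norm (x + h - a))\<^sup>2 / (2 * \<epsilon>) + (norm (x - h - b))\<^sup>2 / (2 * \<epsilon>)"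
    by (simp add: add_divide_distrib diff_divide_distrib)
  then show "- ((norm h)\<^sup>2 / \<epsilon>) \<le> sdiff g x h + \<delta>"
    using sup_conv_semiconvex[of y k] a b sup_inf_conv_le[of x y] unfolding ab by (simp add: sdiff_def)
qed

lemma sdiff_bounded_sup_inf_conv: "sdiff_bounded (1 / \<epsilon>) g"
  unfolding sdiff_bounded_def abs_le_iff
  using sdiff_sup_inf_conv_le sdiff_sup_inf_conv_ge by (simp add: minus_le_iff)

lemma continuous_on_sup_inf_conv: "continuous_on UNIV g"
proof (rule continuous_on_sdiff_bounded[OF sdiff_bounded_sup_inf_conv])
  obtain z where z: "z \<in> D" using conv_nonempty by blast
  have "compact (u ` D)" by (rule compact_continuous_image[OF conv_cont conv_compact])
  then obtain B where B: "\<And>z. z \<in> D \<Longrightarrow> u z \<le> B"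
    by (meson bdd_above.unfold bounded_imp_bdd_above compact_imp_bounded imageI)
  fix R
  have "\<bar>g x\<bar> \<le> \<bar>B\<bar> + \<bar>u z\<bar> + (R + norm z)\<^sup>2 / (2 * \<epsilon>)" if x: "norm x \<le> R" for x
  proof -
    have "c x \<le> B"
    proof (rule sup_conv_le)
      fix y assume "y \<in> D"
      then show "u y - (norm (x - y))\<^sup>2 / (4 * \<epsilon>) \<le> B"
        using B[of y] conv_pos by (smt (verit) divide_nonneg_pos zero_le_power2)
    qed
    then have 1: "g x \<le> B" using sup_inf_conv_le[of x x] by simp
    have "(norm (x - z))\<^sup>2 / (2 * \<epsilon>) \<le> (R + norm z)\<^sup>2 / (2 * \<epsilon>)"
      using conv_pos x norm_triangle_ineq4[of x z] by (intro divide_right_mono power_mono) auto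
    then have 2: "u z - (R + norm z)\<^sup>2 / (2 * \<epsilon>) \<le> g x" using sup_inf_conv_ge[OF z, of x] by simp
    have "0 \<le> (R + norm z)\<^sup>2 / (2 * \<epsilon>)" using conv_pos by simp
    then show ?thesis using 1 2 by linarith
  qed
  then show "\<exists>M. \<forall>x. norm x \<le> R \<longrightarrow> \<bar>g x\<bar> \<le> M" by blast
qed (use conv_pos in simp)

end

text \<open>Maximised over y and z this is the sup-convolution of u minus the inf-convolution of v,
  tilted by q; maximised over x with q = 0 it is the usual doubled functional with penalty |y -
  z|^2/(4\<epsilon>). Keeping x as a third variable gives direct access to the contact
  points.\<close>

definition doubling :: "('a \<Rightarrow> real) \<Rightarrow> ('a \<Rightarrow> real) \<Rightarrow> real \<Rightarrow> 'a::real_inner \<Rightarrow> 'a \<Rightarrow> 'a \<Rightarrow> 'a \<Rightarrow> real" where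
  "doubling u v \<epsilon> q x y z = u y - v z - ((norm (x - y))\<^sup>2 + (norm (x - z))\<^sup>2) / (2 * \<epsilon>) - q \<bullet> x"

definition doubling_max :: "'a set \<Rightarrow> ('a \<Rightarrow> real) \<Rightarrow> ('a \<Rightarrow> real) \<Rightarrow> real \<Rightarrow> 'a::real_inner \<Rightarrow> 'a \<Rightarrow> 'a \<Rightarrow> 'a \<Rightarrow> bool" where
  "doubling_max D u v \<epsilon> q x y z \<longleftrightarrow> y \<in> D \<and> z \<in> D \<and>
    (\<forall>x' y' z'. y' \<in> D \<longrightarrow> z' \<in> D \<longrightarrow> doubling u v \<epsilon> q x' y' z' \<le> doubling u v \<epsilon> q x y z)"

text \<open>Completing the square in \<open>x\<close> eliminates the unbounded variable.\<close>

lemma doubling_square: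
  assumes "0 < \<epsilon>"
  shows "doubling u v \<epsilon> q x y z = u y - v z - (norm (y - z))\<^sup>2 / (4 * \<epsilon>) - q \<bullet> (y + z) / 2 + \<epsilon> * (norm q)\<^sup>2 / 4
    - (norm (x - ((1 / 2) *\<^sub>R (y + z) - (\<epsilon> / 2) *\<^sub>R q)))\<^sup>2 / \<epsilon>"
  using assms unfolding doubling_def power2_norm_eq_inner
  by (simp add: field_simps inner_diff_left inner_diff_right inner_add_left inner_add_right inner_commute power2_eq_square)

lemma doubling_max_exists:
  fixes D :: "'a::euclidean_space set"
  assumes D: "compact D" "D \<noteq> {}" and u: "continuous_on D u" and v: "continuous_on D v" and \<epsilon>: "0 < \<epsilon>"
    and b: "\<And>y. y \<in> D \<Longrightarrow> norm y \<le> b"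
  shows "\<exists>x y z. doubling_max D u v \<epsilon> q x y z \<and> norm x \<le> b + \<epsilon> / 2 * norm q"
proof -
  define J where "J = (\<lambda>(y, z). u y - v z - (norm (y - z))\<^sup>2 / (4 * \<epsilon>) - q \<bullet> (y + z) / 2)"
  have "continuous_on (D \<times> D) J"
    unfolding J_def case_prod_beta using \<epsilon>
    by (intro continuous_intros continuous_on_compose2[OF u] continuous_on_compose2[OF v]) auto
  then obtain yz where yz: "yz \<in> D \<times> D" "\<And>w. w \<in> D \<times> D \<Longrightarrow> J w \<le> J yz"
    using continuous_attains_sup[of "D \<times> D" J] D compact_Times by blast
  obtain y z where [simp]: "yz = (y, z)" by fastforce
  define x where "x = (1 / 2) *\<^sub>R (y + z) - (\<epsilon> / 2) *\<^sub>R q"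
  have yD: "y \<in> D" "z \<in> D" using yz by auto
  have "doubling u v \<epsilon> q x' y' z' \<le> doubling u v \<epsilon> q x y z" if "y' \<in> D" "z' \<in> D" for x' y' z'
  proof -
    have "J (y', z') \<le> J (y, z)" using yz(2)[of "(y', z')"] that by simp
    moreover have "0 \<le> (norm (x' - ((1 / 2) *\<^sub>R (y' + z') - (\<epsilon> / 2) *\<^sub>R q)))\<^sup>2 / \<epsilon>"
      using \<epsilon> by simp
    ultimately show ?thesis
      unfolding doubling_square[OF \<epsilon>] x_def[symmetric] J_def by simp
  qed
  moreover have "norm x \<le> b + \<epsilon> / 2 * norm q"
  proof -
    have "norm x \<le> norm ((1 / 2) *\<^sub>R (y + z)) + norm ((\<epsilon> / 2) *\<^sub>R q)"
      unfolding x_def by (rule norm_triangle_ineq4)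
    also have "\<dots> \<le> b + \<epsilon> / 2 * norm q"
      using b[OF yD(1)] b[OF yD(2)] norm_triangle_ineq[of y z] \<epsilon> by simp
    finally show ?thesis .
  qed
  ultimately show ?thesis
    using yD unfolding doubling_max_def by blast
qed

context convolution
begin

context
  fixes v q x y z assumes max: "doubling_max D u v \<epsilon> q x y z"
begin

lemma doubling_max_mem: "y \<in> D" "z \<in> D"
  using max by (auto simp: doubling_max_def)

lemma doubling_le_max: "y' \<in> D \<Longrightarrow> z' \<in> D \<Longrightarrow> doubling u v \<epsilon> q x' y' z' \<le> doubling u v \<epsilon> q x y z"
  using max by (auto simp: doubling_max_def)

text \<open>The upper half of the sandwich, \<open>sup_inf_conv_ge\<close> being the lower one. The
  competitor z' - \<epsilon>q in the infimum defining g is chosen so that expanding the square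
  around it reproduces the affine term q \<bullet> x'.\<close>

lemma sup_inf_conv_le_inf:
  assumes z': "z' \<in> D"
  shows "g x' \<le> doubling u v \<epsilon> q x y z + q \<bullet> x' + v z' + (norm (x' - z'))\<^sup>2 / (2 * \<epsilon>)"
proof -
  define y' where "y' = z' - \<epsilon> *\<^sub>R q"
  have "c y' \<le> doubling u v \<epsilon> q x y z + v z' + q \<bullet> z' - \<epsilon> * (norm q)\<^sup>2 / 2"
  proof (rule sup_conv_le)
    fix w assume w: "w \<in> D"
    have "doubling u v \<epsilon> q ((1 / 2) *\<^sub>R (w + z') - (\<epsilon> / 2) *\<^sub>R q) w z' \<le> doubling u v \<epsilon> q x y z"
      by (rule doubling_le_max[OF w z'])
    moreover have "doubling u v \<epsilon> q ((1 / 2) *\<^sub>R (w + z') - (\<epsilon> / 2) *\<^sub>R q) w z'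
        = u w - v z' - (norm (w - z'))\<^sup>2 / (4 * \<epsilon>) - q \<bullet> (w + z') / 2 + \<epsilon> * (norm q)\<^sup>2 / 4"
      unfolding doubling_square[OF conv_pos] by simp
    moreover have "(norm (y' - w))\<^sup>2 = (norm (w - z'))\<^sup>2 + 2 * \<epsilon> * (q \<bullet> w - q \<bullet> z') + \<epsilon>\<^sup>2 * (norm q)\<^sup>2"
      unfolding y'_def power2_norm_eq_inner
      by (simp add: inner_diff_left inner_diff_right inner_commute power2_eq_square algebra_simps)
    then have "(norm (y' - w))\<^sup>2 / (4 * \<epsilon>) = (norm (w - z'))\<^sup>2 / (4 * \<epsilon>) + q \<bullet> w / 2 - q \<bullet> z' / 2 + \<epsilon> * (norm q)\<^sup>2 / 4"
      using conv_pos by (simp add: field_simps power2_eq_square)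
    ultimately show "u w - (norm (y' - w))\<^sup>2 / (4 * \<epsilon>) \<le> doubling u v \<epsilon> q x y z + v z' + q \<bullet> z' - \<epsilon> * (norm q)\<^sup>2 / 2"
      by (simp add: inner_add_right add_divide_distrib)
  qed
  moreover have "(norm (x' - y'))\<^sup>2 = (norm (x' - z'))\<^sup>2 + 2 * \<epsilon> * (q \<bullet> x' - q \<bullet> z') + \<epsilon>\<^sup>2 * (norm q)\<^sup>2"
    unfolding y'_def power2_norm_eq_inner
    by (simp add: inner_diff_left inner_diff_right inner_commute power2_eq_square algebra_simps)
  then have "(norm (x' - y'))\<^sup>2 / (2 * \<epsilon>) = (norm (x' - z'))\<^sup>2 / (2 * \<epsilon>) + q \<bullet> x' - q \<bullet> z' + \<epsilon> * (norm q)\<^sup>2 / 2"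
    using conv_pos by (simp add: field_simps power2_eq_square)
  ultimately show ?thesis
    using sup_inf_conv_le[of x' y'] by simp
qed

lemma sup_inf_conv_at_max: "g x = u y - (norm (x - y))\<^sup>2 / (2 * \<epsilon>)"
    "g x = doubling u v \<epsilon> q x y z + q \<bullet> x + v z + (norm (x - z))\<^sup>2 / (2 * \<epsilon>)"
proof -
  have eq: "doubling u v \<epsilon> q x y z + q \<bullet> x + v z + (norm (x - z))\<^sup>2 / (2 * \<epsilon>) = u y - (norm (x - y))\<^sup>2 / (2 * \<epsilon>)"
    by (simp add: doubling_def add_divide_distrib)
  show "g x = u y - (norm (x - y))\<^sup>2 / (2 * \<epsilon>)"
    using sup_inf_conv_ge[OF doubling_max_mem(1), of x] sup_inf_conv_le_inf[OF doubling_max_mem(2), of x] eq by simp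
  then show "g x = doubling u v \<epsilon> q x y z + q \<bullet> x + v z + (norm (x - z))\<^sup>2 / (2 * \<epsilon>)"
    using eq by simp
qed

lemma norm_shift_square: "(norm (a + w - e))\<^sup>2 / (2 * \<epsilon>) = (norm (a - e))\<^sup>2 / (2 * \<epsilon>) - ((1 / \<epsilon>) *\<^sub>R (e - a)) \<bullet> w + (norm w)\<^sup>2 / (2 * \<epsilon>)"
  using conv_pos by (simp add: power2_norm_eq_inner field_simps inner_diff_left inner_diff_right inner_add_left
      inner_add_right inner_commute)

lemma sup_inf_conv_expand_lower:
  "g x + ((1 / \<epsilon>) *\<^sub>R (y - x)) \<bullet> w - (norm w)\<^sup>2 / (2 * \<epsilon>) \<le> g (x + w)"
  using sup_inf_conv_ge[OF doubling_max_mem(1), of "x + w"] unfolding norm_shift_square sup_inf_conv_at_max(1)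
  by simp

lemma sup_inf_conv_expand_upper:
  "g (x + w) \<le> g x + (q - (1 / \<epsilon>) *\<^sub>R (z - x)) \<bullet> w + (norm w)\<^sup>2 / (2 * \<epsilon>)"
  using sup_inf_conv_le_inf[OF doubling_max_mem(2), of "x + w"] unfolding norm_shift_square sup_inf_conv_at_max(2)
  by (simp add: inner_add_right inner_diff_left)

text \<open>This is stationarity of \<open>doubling\<close> in x. It holds because paraboloids with
  these two slopes touch g at x from below and from above.\<close>

lemma doubling_max_gradient: "(1 / \<epsilon>) *\<^sub>R (y - x) = q - (1 / \<epsilon>) *\<^sub>R (z - x)"
proof -
  define d where "d = (1 / \<epsilon>) *\<^sub>R (y - x) - (q - (1 / \<epsilon>) *\<^sub>R (z - x))"
  have "d \<bullet> w \<le> (norm w)\<^sup>2 / \<epsilon>" for w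
    using sup_inf_conv_expand_lower[of w] sup_inf_conv_expand_upper[of w]
    unfolding d_def inner_diff_left[of _ "q - _"] by (simp add: field_simps)
  from this[of "(\<epsilon> / 2) *\<^sub>R d"]
  have "d \<bullet> ((\<epsilon> / 2) *\<^sub>R d) \<le> (norm ((\<epsilon> / 2) *\<^sub>R d))\<^sup>2 / \<epsilon>" .
  moreover have "d \<bullet> ((\<epsilon> / 2) *\<^sub>R d) = \<epsilon> / 2 * (norm d)\<^sup>2"
    by (simp add: power2_norm_eq_inner)
  moreover have "(norm ((\<epsilon> / 2) *\<^sub>R d))\<^sup>2 / \<epsilon> = \<epsilon> / 4 * (norm d)\<^sup>2"
    using conv_pos by (simp add: power_mult_distrib) (simp add: power2_eq_square)
  ultimately have "\<epsilon> / 4 * (norm d)\<^sup>2 \<le> 0" by linarith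
  then have "d = 0"
    using conv_pos by (simp add: mult_le_0_iff)
  then show ?thesis by (simp add: d_def)
qed

lemma sup_inf_conv_expand:
  "\<bar>g (x + w) - g x - ((1 / \<epsilon>) *\<^sub>R (y - x)) \<bullet> w\<bar> \<le> 1 / \<epsilon> * (norm w)\<^sup>2"
proof -
  have "(norm w)\<^sup>2 / (2 * \<epsilon>) \<le> 1 / \<epsilon> * (norm w)\<^sup>2"
    using conv_pos by (simp add: field_simps)
  then show ?thesis
    using sup_inf_conv_expand_lower[of w] sup_inf_conv_expand_upper[of w]
    unfolding doubling_max_gradient by linarith
qed

end

text \<open>The functional is quadratic in x and stationary at the maximum for q, so its value for
  q' at (x + w, y, z) is known exactly. Comparison with the maximum for q' bounds q - q' tested
  against x - x' + w, for every w.\<close>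

lemma doubling_max_separated:
  assumes max: "doubling_max D u v \<epsilon> q x y z" and max': "doubling_max D u v \<epsilon> q' x' y' z'"
  shows "norm (q - q') \<le> 4 / \<epsilon> * norm (x - x')"
proof -
  define d e where "d = q - q'" and "e = x - x'"
  have key: "d \<bullet> (e + w) \<le> (norm w)\<^sup>2 / \<epsilon>" for w
  proof -
    have 1: "doubling u v \<epsilon> q' (x + w) y z \<le> doubling u v \<epsilon> q' x' y' z'"
      by (rule doubling_le_max[OF max' doubling_max_mem[OF max]])
    have 2: "doubling u v \<epsilon> q x' y' z' \<le> doubling u v \<epsilon> q x y z"
      by (rule doubling_le_max[OF max doubling_max_mem[OF max']])
    have 3: "doubling u v \<epsilon> q x' y' z' = doubling u v \<epsilon> q' x' y' z' - d \<bullet> x'"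
      by (simp add: doubling_def d_def inner_diff_left)
    have "doubling u v \<epsilon> q' (x + w) y z = doubling u v \<epsilon> q x y z + ((1 / \<epsilon>) *\<^sub>R (y - x)) \<bullet> w
        + ((1 / \<epsilon>) *\<^sub>R (z - x)) \<bullet> w - (norm w)\<^sup>2 / \<epsilon> - q' \<bullet> (x + w) + q \<bullet> x"
      unfolding doubling_def add_divide_distrib norm_shift_square[OF max] by simp
    also have "((1 / \<epsilon>) *\<^sub>R (y - x)) \<bullet> w = q \<bullet> w - ((1 / \<epsilon>) *\<^sub>R (z - x)) \<bullet> w"
      unfolding doubling_max_gradient[OF max] by (simp add: inner_diff_left)
    finally show ?thesis
      using 1 2 3 by (simp add: d_def e_def inner_diff_left inner_diff_right inner_add_right)
  qed
  \<comment> \<open>The choice w = (\<epsilon>/4) d - e turns e + w into a multiple of d.\<close>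
  have "(norm ((\<epsilon> / 4) *\<^sub>R d - e))\<^sup>2 \<le> 2 * (norm ((\<epsilon> / 4) *\<^sub>R d))\<^sup>2 + 2 * (norm e)\<^sup>2"
    using norm_diff_square_le[of "(\<epsilon> / 4) *\<^sub>R d" e 0] by simp
  moreover have "\<epsilon> * (d \<bullet> (e + ((\<epsilon> / 4) *\<^sub>R d - e))) \<le> (norm ((\<epsilon> / 4) *\<^sub>R d - e))\<^sup>2"
    using key[of "(\<epsilon> / 4) *\<^sub>R d - e"] conv_pos by (simp add: field_simps)
  ultimately have "\<epsilon>\<^sup>2 * (norm d)\<^sup>2 \<le> 16 * (norm e)\<^sup>2"
    using conv_pos by (simp add: power2_norm_eq_inner[symmetric] power_mult_distrib) (simp add: power2_eq_square field_simps)
  then have "(\<epsilon> * norm d)\<^sup>2 \<le> (4 * norm e)\<^sup>2"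
    by (simp add: power_mult_distrib)
  then have "\<epsilon> * norm d \<le> 4 * norm e"
    by (rule power2_le_imp_le) simp
  then show ?thesis
    using conv_pos by (simp add: d_def e_def field_simps)
qed

end

section \<open>Approximate theorem on sums\<close>

lemma sym_matrices_inner:
  fixes A :: "real^'n^'n"
  assumes "A \<in> sym_matrices"
  shows "x \<bullet> (A *v y) = y \<bullet> (A *v x)"
proof -
  have "x v* A = A *v x"
    using assms transpose_matrix_vector[of A x] by (simp add: sym_matrices_def)
  then show ?thesis
    using dot_lmul_matrix[of x A y] by (simp add: inner_commute)
qed

lemma matrix_vector_mult_minus_left: "(- A) *v w = - (A *v w)" for A :: "real^'n^'m"
  by (simp add: matrix_vector_mult_def vec_eq_iff sum_negf)

lemma sym_quadratic_expand:
  fixes A :: "real^'n^'n"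
  assumes "A \<in> sym_matrices"
  shows "(w + d) \<bullet> (A *v (w + d)) = w \<bullet> (A *v w) + 2 * ((A *v w) \<bullet> d) + d \<bullet> (A *v d)"
  using sym_matrices_inner[OF assms, of w d]
  by (simp add: inner_add_left inner_add_right matrix_vector_right_distrib inner_commute)

text \<open>Polarisation at T w + A w and T w - A w, in place of an argument with
  eigenvalues.\<close>

lemma sym_matrix_vector_norm_le:
  fixes A :: "real^'n^'n"
  assumes A: "A \<in> sym_matrices" and T: "0 < T" "\<And>w. \<bar>w \<bullet> (A *v w)\<bar> \<le> T * (norm w)\<^sup>2"
  shows "norm (A *v w) \<le> T * norm w"
proof -
  define v where "v = A *v w"
  have e: "(T *\<^sub>R w + v) \<bullet> (A *v (T *\<^sub>R w + v)) - (T *\<^sub>R w + - v) \<bullet> (A *v (T *\<^sub>R w + - v)) = 4 * T * (norm v)\<^sup>2"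
  proof -
    have Aw: "A *v (T *\<^sub>R w) = T *\<^sub>R v"
      by (simp add: v_def matrix_vector_mult_scaleR)
    have "(- v) \<bullet> (A *v (- v)) = v \<bullet> (A *v v)"
      using linear_neg[OF matrix_vector_mul_linear[of A], of v] by simp
    then show ?thesis
      unfolding sym_quadratic_expand[OF A] Aw by (simp add: power2_norm_eq_inner)
  qed
  have "4 * T * (norm v)\<^sup>2 \<le> T * (norm (T *\<^sub>R w + v))\<^sup>2 + T * (norm (T *\<^sub>R w + - v))\<^sup>2"
    unfolding e[symmetric] using T(2)[of "T *\<^sub>R w + v"] T(2)[of "T *\<^sub>R w + - v"] by linarith
  also have "\<dots> = T * ((norm (T *\<^sub>R w + v))\<^sup>2 + (norm (T *\<^sub>R w - v))\<^sup>2)"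
    by (simp only: distrib_left add_uminus_conv_diff)
  also have "\<dots> = T * (2 * (T * norm w)\<^sup>2 + 2 * (norm v)\<^sup>2)"
    unfolding parallelogram_norm using T(1) by simp
  also have "\<dots> = T * (2 * (T * norm w)\<^sup>2) + T * (2 * (norm v)\<^sup>2)"
    by (simp only: distrib_left)
  finally have "T * (2 * (norm v)\<^sup>2) \<le> T * (2 * (T * norm w)\<^sup>2)"
    by linarith
  then have "(norm v)\<^sup>2 \<le> (T * norm w)\<^sup>2"
    using T(1) by simp
  then show ?thesis
    unfolding v_def[symmetric] using T(1) by (auto intro: power2_le_imp_le)
qed

text \<open>Turns an approximate polynomial bound for the sup-convolution into an exact touching of
  u. At a joint maximum in w and y, moving both by the same vector leaves the penalty unchanged, so
  u inherits the Hessian of the polynomial. The lower bound in the conclusion serves to locate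
  y.\<close>

lemma convolution_touch:
  fixes A :: "real^'n^'n"
  assumes D: "compact D" and u: "continuous_on D u" and \<epsilon>: "0 < \<epsilon>" and h: "0 < h" and \<zeta>: "0 < \<zeta>"
    and A: "A \<in> sym_matrices" and y0: "y0 \<in> D"
    and upper: "\<And>w y. norm w \<le> h \<Longrightarrow> y \<in> D \<Longrightarrow>
      u y - (norm (x + w - y))\<^sup>2 / (2 * \<epsilon>) \<le> k + p \<bullet> w + w \<bullet> (A *v w) / 2 + \<zeta> * h\<^sup>2"
    and k: "k = u y0 - (norm (x - y0))\<^sup>2 / (2 * \<epsilon>)"
  shows "\<exists>w y. norm w < h \<and> y \<in> D \<and> k + p \<bullet> w + w \<bullet> (A *v w) / 2 \<le> u y - (norm (x + w - y))\<^sup>2 / (2 * \<epsilon>) \<and>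
    (\<forall>y'\<in>D. norm (w + (y' - y)) \<le> h \<longrightarrow>
      u y' \<le> u y + (p + A *v w + (4 * \<zeta>) *\<^sub>R w) \<bullet> (y' - y)
        + ((y' - y) \<bullet> (A *v (y' - y)) + 4 * \<zeta> * (norm (y' - y))\<^sup>2) / 2)"
proof -
  \<comment> \<open>At |w| = h the extra term 2\<zeta>|w|^2 exceeds the error \<zeta>h^2, which
    forces the maximum into the open ball.\<close>
  define q where "q = (\<lambda>w. k + p \<bullet> w + w \<bullet> (A *v w) / 2 + 2 * \<zeta> * (norm w)\<^sup>2)"
  define J where "J = (\<lambda>(w, y). u y - (norm (x + w - y))\<^sup>2 / (2 * \<epsilon>) - q w)"
  have Jc: "continuous_on (cball 0 h \<times> D) J"
    unfolding J_def q_def case_prod_beta using \<epsilon>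
    by (intro continuous_intros continuous_on_compose2[OF u] matrix_vector_mult_linear_continuous_on
        continuous_on_compose2[OF matrix_vector_mult_linear_continuous_on]) auto
  have DD: "compact (cball (0::real^'n) h \<times> D)" "cball (0::real^'n) h \<times> D \<noteq> {}"
    using compact_Times[OF compact_cball D] h y0 by auto
  obtain wy where wy: "wy \<in> cball 0 h \<times> D" "\<And>s. s \<in> cball 0 h \<times> D \<Longrightarrow> J s \<le> J wy"
    using continuous_attains_sup[OF DD Jc] by blast
  obtain w y where [simp]: "wy = (w, y)" by fastforce
  have w: "norm w \<le> h" and y: "y \<in> D" using wy(1) by auto
  have "J (0, y0) = 0" by (simp add: J_def q_def k)
  then have J0: "0 \<le> J (w, y)" using wy(2)[of "(0, y0)"] y0 h by simp
  have "norm w \<noteq> h"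
  proof
    assume "norm w = h"
    then have "J (w, y) \<le> \<zeta> * h\<^sup>2 - 2 * \<zeta> * h\<^sup>2"
      using upper[OF w y] by (simp add: J_def q_def)
    moreover have "0 < \<zeta> * h\<^sup>2" using \<zeta> h by simp
    ultimately show False using J0 by linarith
  qed
  then have "norm w < h" using w by simp
  moreover have "k + p \<bullet> w + w \<bullet> (A *v w) / 2 \<le> u y - (norm (x + w - y))\<^sup>2 / (2 * \<epsilon>)"
  proof -
    have "0 \<le> 2 * \<zeta> * (norm w)\<^sup>2" using \<zeta> by simp
    then show ?thesis using J0 unfolding J_def q_def prod.case by linarith
  qed
  moreover have "u y' \<le> u y + (p + A *v w + (4 * \<zeta>) *\<^sub>R w) \<bullet> (y' - y)
        + ((y' - y) \<bullet> (A *v (y' - y)) + 4 * \<zeta> * (norm (y' - y))\<^sup>2) / 2"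
    if y': "y' \<in> D" "norm (w + (y' - y)) \<le> h" for y'
  proof -
    define d where "d = y' - y"
    have "J (w + d, y') \<le> J (w, y)" using wy(2)[of "(w + d, y')"] y' by (simp add: d_def)
    moreover have "x + (w + d) - y' = x + w - y" by (simp add: d_def)
    ultimately have "u y' \<le> u y + (q (w + d) - q w)" by (simp add: J_def)
    also have "q (w + d) - q w = (p + A *v w + (4 * \<zeta>) *\<^sub>R w) \<bullet> d + (d \<bullet> (A *v d) + 4 * \<zeta> * (norm d)\<^sup>2) / 2"
      unfolding q_def sym_quadratic_expand[OF A] power2_norm_eq_inner
      by (simp add: inner_add_left inner_add_right inner_commute algebra_simps add_divide_distrib)
    finally show ?thesis by (simp add: d_def)
  qed
  ultimately show ?thesis using y by blast
qed

text \<open>An approximate form of the theorem on sums of Crandall and Ishii. The usual proof rests on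
  Alexandrov's theorem; since an error \<open>\<delta>\<close> in the Hessians is allowed here, the existence of scales
  at which the regularisation of \<open>u\<close> is close to a quadratic is enough.\<close>

proposition approximate_theorem_on_sums:
  fixes u v :: "real^'n \<Rightarrow> real"
  assumes \<Omega>: "open \<Omega>" "bounded \<Omega>" and u: "continuous_on (closure \<Omega>) u" and v: "continuous_on (closure \<Omega>) v"
    and x0: "x0 \<in> closure \<Omega>"
    and strict: "\<And>y. y \<in> frontier \<Omega> \<Longrightarrow> u y - v y < u x0 - v x0"
  shows "\<exists>K. \<forall>\<delta>>0. \<exists>A\<in>sym_matrices. \<exists>y\<in>\<Omega>. \<exists>z\<in>\<Omega>. \<exists>p1 p2.
     norm p1 \<le> K \<and> norm p2 \<le> K \<and> norm (p1 - p2) \<le> \<delta> \<and>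
     (\<forall>\<^sub>F y' in nhds y. u y' \<le> u y + p1 \<bullet> (y' - y) + ((y' - y) \<bullet> (A *v (y' - y)) + \<delta> * (norm (y' - y))\<^sup>2) / 2) \<and>
     (\<forall>\<^sub>F z' in nhds z. v z' \<ge> v z + p2 \<bullet> (z' - z) + ((z' - z) \<bullet> (A *v (z' - z)) - \<delta> * (norm (z' - z))\<^sup>2) / 2)"
proof -
  define D where "D = closure \<Omega>"
  have D: "compact D" "D \<noteq> {}" "x0 \<in> D" using \<Omega>(2) x0 by (auto simp: D_def)
  have uD: "continuous_on D u" and vD: "continuous_on D v" using u v by (auto simp: D_def)
  have DO: "y \<in> \<Omega>" if "y \<in> D" "y \<notin> frontier \<Omega>" for y
    using that \<Omega>(1) by (auto simp: D_def frontier_def interior_open)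
  define M where "M = u x0 - v x0"
  \<comment> \<open>The gap at the boundary is split into four: one \<kappa> for the tilt by q, one
    for the displacement within radius h, one for replacing a doubled point by its partner, and one
    as remaining margin.\<close>
  obtain \<kappa> where \<kappa>: "0 < \<kappa>" "\<kappa> \<le> 1" "\<And>y. y \<in> frontier \<Omega> \<Longrightarrow> u y - v y \<le> M - 4 * \<kappa>"
  proof (cases "frontier \<Omega> = {}")
    case True
    then show thesis using that[of 1] by simp
  next
    case False
    have "frontier \<Omega> \<subseteq> closure \<Omega>" by (simp add: frontier_def)
    then have "continuous_on (frontier \<Omega>) (\<lambda>y. u y - v y)"
      by (intro continuous_intros continuous_on_subset[OF u] continuous_on_subset[OF v])
    then obtain y0 where y0: "y0 \<in> frontier \<Omega>" "\<And>y. y \<in> frontier \<Omega> \<Longrightarrow> u y - v y \<le> u y0 - v y0"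
      using continuous_attains_sup[OF compact_frontier_bounded[OF \<Omega>(2)] False] by blast
    define \<kappa> where "\<kappa> = min 1 ((M - (u y0 - v y0)) / 4)"
    have "\<kappa> \<le> (M - (u y0 - v y0)) / 4" unfolding \<kappa>_def by (rule min.cobounded2)
    moreover have "0 < \<kappa>" "\<kappa> \<le> 1" using strict[OF y0(1)] by (auto simp: \<kappa>_def M_def)
    ultimately show thesis
      using y0(2) by (intro that[of \<kappa>]) (auto, fastforce)
  qed
  have "uniformly_continuous_on D u" "uniformly_continuous_on D v"
    using D(1) uD vD compact_uniformly_continuous by auto
  then obtain \<rho>1 \<rho>2 where \<rho>1: "\<rho>1 > 0" "\<And>y z. y \<in> D \<Longrightarrow> z \<in> D \<Longrightarrow> dist z y < \<rho>1 \<Longrightarrow> dist (u z) (u y) < \<kappa>"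
    and \<rho>2: "\<rho>2 > 0" "\<And>y z. y \<in> D \<Longrightarrow> z \<in> D \<Longrightarrow> dist z y < \<rho>2 \<Longrightarrow> dist (v z) (v y) < \<kappa>"
    unfolding uniformly_continuous_on_def using \<kappa>(1) by metis
  define \<rho> where "\<rho> = min \<rho>1 \<rho>2"
  have \<rho>: "0 < \<rho>" "\<And>y z. y \<in> D \<Longrightarrow> z \<in> D \<Longrightarrow> norm (z - y) < \<rho> \<Longrightarrow> \<bar>u z - u y\<bar> < \<kappa> \<and> \<bar>v z - v y\<bar> < \<kappa>"
    using \<rho>1 \<rho>2 by (auto simp: \<rho>_def dist_norm)
  obtain b where b: "\<And>y. y \<in> D \<Longrightarrow> norm y \<le> b" "0 < b"
    using compact_imp_bounded[OF D(1)] unfolding bounded_pos by blast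
  obtain B1 where B1: "\<And>y. y \<in> D \<Longrightarrow> \<bar>u y\<bar> \<le> B1"
    using compact_imp_bounded[OF compact_continuous_image[OF uD D(1)]] unfolding bounded_iff by auto
  obtain B2 where B2: "\<And>y. y \<in> D \<Longrightarrow> \<bar>v y\<bar> \<le> B2"
    using compact_imp_bounded[OF compact_continuous_image[OF vD D(1)]] unfolding bounded_iff by auto
  define B where "B = max B1 B2"
  have B: "\<bar>u y\<bar> \<le> B" "\<bar>v y\<bar> \<le> B" if "y \<in> D" for y
    using B1[OF that] B2[OF that] by (auto simp: B_def)
  have B0: "0 \<le> B" using B(1)[OF D(3)] by linarith
  \<comment> \<open>Near-maximality bounds the penalties below by a difference of values of u and v,
    minus M, plus 2\<kappa>; this is at most 4B + 2.\<close>
  define K1 where "K1 = 4 * B + 2"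
  have K1: "0 < K1" using B0 by (simp add: K1_def)
  \<comment> \<open>Penalties up to K1 then keep each penalised distance at most \<rho>/4.\<close>
  define \<epsilon> where "\<epsilon> = min 1 (\<rho>\<^sup>2 / (32 * K1))"
  have \<epsilon>: "0 < \<epsilon>" "\<epsilon> \<le> 1" "2 * \<epsilon> * K1 \<le> (\<rho> / 4)\<^sup>2"
  proof -
    have "\<epsilon> \<le> \<rho>\<^sup>2 / (32 * K1)" by (simp add: \<epsilon>_def)
    then show "2 * \<epsilon> * K1 \<le> (\<rho> / 4)\<^sup>2" using K1 by (simp add: field_simps power2_eq_square)
  qed (use \<rho>(1) K1 in \<open>auto simp: \<epsilon>_def\<close>)
  interpret convolution D u \<epsilon> by unfold_locales (use D uD \<epsilon> in auto)
  have "\<forall>q. \<exists>x y z. doubling_max D u v \<epsilon> q x y z \<and> norm x \<le> b + \<epsilon> / 2 * norm q"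
    using doubling_max_exists[OF D(1,2) uD vD \<epsilon>(1) b(1)] by blast
  then obtain X Y Z where dm: "\<And>q. doubling_max D u v \<epsilon> q (X q) (Y q) (Z q)"
    and X: "\<And>q. norm (X q) \<le> b + \<epsilon> / 2 * norm q"
    by metis
  have Xb: "norm (X q) \<le> b + 1" if "norm q \<le> 1" for q
  proof -
    have "\<epsilon> / 2 * norm q \<le> 1 * 1" using \<epsilon> that by (intro mult_mono) auto
    then show ?thesis using X[of q] by simp
  qed
  define C where "C = 1 / \<epsilon>"
  have C: "0 < C" using \<epsilon> by (simp add: C_def)
  define P where "P = C * (2 * b + 1)"
  have P0: "0 < P" using C b by (simp add: P_def)
  define p where "p = (\<lambda>q. (1 / \<epsilon>) *\<^sub>R (Y q - X q))"
  have pP: "norm (p q) \<le> P" if "norm q \<le> 1" for q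
  proof -
    have "norm (Y q - X q) \<le> 2 * b + 1"
      using norm_triangle_ineq4[of "Y q" "X q"] b(1)[OF doubling_max_mem(1)[OF dm]] Xb[OF that]
      by (smt (verit))
    then show ?thesis
      using C by (simp add: p_def P_def C_def divide_right_mono)
  qed
  \<comment> \<open>T will bound the quadratic form of A: the error \<zeta> \<le> 1 and the constant
    C of the first-order expansion, doubled because the form enters with the factor 1/2.\<close>
  define T where "T = 2 * (1 + C)"
  have T: "0 < T" using C by (simp add: T_def)
  define T1 where "T1 = T + 4"
  show ?thesis
  \<comment> \<open>All of \<epsilon>, C, P and T are fixed before \<delta>, so the bound on the
    slopes does not depend on \<delta>.\<close>
  proof (intro exI[of _ "P + 1 + T1"] allI impI)
    fix \<delta> :: real assume \<delta>: "0 < \<delta>"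
    define s where "s = min 1 (min (\<delta> / 2) (\<kappa> / (2 * b + 1)))"
    have s: "0 < s" "s \<le> 1" "s \<le> \<delta> / 2" "s * (2 * b + 1) \<le> \<kappa>"
    proof -
      have le: "s \<le> 1" "s \<le> \<delta> / 2" "s \<le> \<kappa> / (2 * b + 1)"
        unfolding s_def by (simp_all only: min_le_iff_disj order_refl simp_thms)
      then show "s \<le> 1" "s \<le> \<delta> / 2" "s * (2 * b + 1) \<le> \<kappa>"
        using b(2) by (simp_all add: field_simps)
    qed (use \<delta> \<kappa>(1) b(2) in \<open>simp add: s_def\<close>)
    \<comment> \<open>The entries serve, in order, the uniform bounds, the Hessian error, the
      difference of the slopes, the nearness of the doubled points, and the change of values within
      radius h.\<close>
    define \<zeta> where "\<zeta> = min 1 (min (\<delta> / 4) (min (\<delta> / (4 * T1)) (min (\<rho> / 4) (\<kappa> / (P + 1 + T1)))))"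
    have T10: "0 < T1" using T by (simp add: T1_def)
    have \<zeta>: "0 < \<zeta>" "\<zeta> \<le> 1" "4 * \<zeta> \<le> \<delta>" "2 * T1 * \<zeta> \<le> \<delta> / 2" "\<zeta> \<le> \<rho> / 4" "\<zeta> * (P + 1 + T1) \<le> \<kappa>"
    proof -
      have le: "\<zeta> \<le> 1" "\<zeta> \<le> \<delta> / 4" "\<zeta> \<le> \<delta> / (4 * T1)" "\<zeta> \<le> \<rho> / 4" "\<zeta> \<le> \<kappa> / (P + 1 + T1)"
        unfolding \<zeta>_def by (simp_all only: min_le_iff_disj order_refl simp_thms)
      then show "\<zeta> \<le> 1" "4 * \<zeta> \<le> \<delta>" "2 * T1 * \<zeta> \<le> \<delta> / 2" "\<zeta> \<le> \<rho> / 4" "\<zeta> * (P + 1 + T1) \<le> \<kappa>"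
        using T10 P0 by (simp_all add: field_simps)
    qed (use \<delta> \<kappa>(1) T10 P0 \<rho>(1) in \<open>simp add: \<zeta>_def\<close>)
    have "\<exists>q h A. norm q \<le> s \<and> 0 < h \<and> h < \<zeta> \<and> A \<in> sym_matrices \<and>
      (\<forall>z. norm z \<le> h \<longrightarrow> \<bar>g (X q + z) - g (X q) - p q \<bullet> z - z \<bullet> (A *v z) / 2\<bar> \<le> \<zeta> * h\<^sup>2)"
    proof (rule exists_near_quadratic_scale[OF continuous_on_sup_inf_conv _ sdiff_bounded_sup_inf_conv s(1)])
      show "0 < 4 / \<epsilon>" using \<epsilon> by simp
      show "norm (q - q') \<le> 4 / \<epsilon> * norm (X q - X q')" for q q'
        by (rule doubling_max_separated[OF dm dm])
      show "norm (X q) \<le> b + 1" if "norm q \<le> s" for q using Xb[of q] that s by simp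
      show "\<bar>g (X q + z) - g (X q) - p q \<bullet> z\<bar> \<le> 1 / \<epsilon> * (norm z)\<^sup>2" for q z
        unfolding p_def by (rule sup_inf_conv_expand[OF dm])
    qed (use \<zeta> \<epsilon> in auto)
    then obtain q h A where q: "norm q \<le> s" and h: "0 < h" "h < \<zeta>" and A: "A \<in> sym_matrices"
      and near: "\<And>z. norm z \<le> h \<Longrightarrow> \<bar>g (X q + z) - g (X q) - p q \<bullet> z - z \<bullet> (A *v z) / 2\<bar> \<le> \<zeta> * h\<^sup>2"
      by blast
    define x y0 z0 where "x = X q" and "y0 = Y q" and "z0 = Z q"
    note max = dm[of q, folded x_def y0_def z0_def]
    note near = near[folded x_def]
    have q1: "norm q \<le> 1" using q s by simp
    define m where "m = doubling u v \<epsilon> q x y0 z0"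
    \<comment> \<open>Comparing the first-order with the second-order expansion of g bounds the form
      on the ball of radius h; homogeneity extends the bound to all w.\<close>
    have AT: "\<bar>w \<bullet> (A *v w)\<bar> \<le> T * (norm w)\<^sup>2" for w
    proof -
      have *: "\<bar>z \<bullet> (A *v z)\<bar> \<le> T * h\<^sup>2" if "norm z \<le> h" for z
      proof -
        have "\<bar>z \<bullet> (A *v z) / 2\<bar> \<le> \<zeta> * h\<^sup>2 + 1 / \<epsilon> * (norm z)\<^sup>2"
          using near[OF that] sup_inf_conv_expand[OF max, of z] unfolding p_def x_def[symmetric] y0_def[symmetric]
          by linarith
        also have "\<dots> \<le> 1 * h\<^sup>2 + 1 / \<epsilon> * h\<^sup>2"
          using \<zeta> \<epsilon> that by (intro add_mono mult_right_mono mult_left_mono power_mono) auto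
        finally show ?thesis by (simp add: T_def C_def algebra_simps)
      qed
      show ?thesis
      proof (cases "w = 0")
        case False
        have "\<bar>((h / norm w) *\<^sub>R w) \<bullet> (A *v ((h / norm w) *\<^sub>R w))\<bar> \<le> T * h\<^sup>2"
          using h False by (intro *) simp
        then have "(h / norm w)\<^sup>2 * \<bar>w \<bullet> (A *v w)\<bar> \<le> T * h\<^sup>2"
          by (simp add: matrix_vector_mult_scaleR abs_mult power2_eq_square)
        then show ?thesis
          using h False by (simp add: field_simps power2_eq_square)
      qed simp
    qed
    have Aw: "norm (A *v w) \<le> T * norm w" for w
      by (rule sym_matrix_vector_norm_le[OF A T AT])
    have small: "norm (A *v w + (4 * \<zeta>) *\<^sub>R w) \<le> T1 * \<zeta>" if "norm w < h" for w
    proof -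
      have "norm (A *v w + (4 * \<zeta>) *\<^sub>R w) \<le> norm (A *v w) + norm ((4 * \<zeta>) *\<^sub>R w)" by (rule norm_triangle_ineq)
      also have "\<dots> \<le> T * norm w + 4 * norm w"
        using Aw[of w] \<zeta> by (intro add_mono) (auto simp: mult_left_le_one_le)
      also have "\<dots> \<le> T1 * \<zeta>"
        using that h T10 unfolding T1_def distrib_right[symmetric] by (intro mult_left_mono) auto
      finally show ?thesis .
    qed
    have dev: "\<bar>p' \<bullet> w + w \<bullet> (A *v w) / 2\<bar> \<le> \<kappa>" if w: "norm w < h" and p': "norm p' \<le> P + 1" for w p'
    proof -
      have "\<bar>p' \<bullet> w\<bar> \<le> (P + 1) * norm w"
        using Cauchy_Schwarz_ineq2[of p' w] p' by (meson mult_right_mono norm_ge_zero order_trans)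
      moreover have "T * (norm w)\<^sup>2 \<le> T * norm w"
        using w h \<zeta> T by (intro mult_left_mono) (auto simp: power2_eq_square mult_left_le)
      then have "\<bar>w \<bullet> (A *v w) / 2\<bar> \<le> T * norm w"
        using AT[of w] by linarith
      moreover have "(P + 1) * norm w + T * norm w \<le> (P + 1 + T1) * \<zeta>"
        using w h T P0 unfolding distrib_right[symmetric] T1_def by (intro mult_mono) auto
      ultimately show ?thesis using \<zeta>(6) by (simp add: mult.commute)
    qed
    have mM: "M - q \<bullet> x0 \<le> m"
      using doubling_le_max[OF max D(3) D(3), of x0] by (simp add: doubling_def m_def M_def)
    have qx: "\<bar>q \<bullet> x - q \<bullet> x0\<bar> \<le> \<kappa>"
    proof -
      have "\<bar>q \<bullet> (x - x0)\<bar> \<le> norm q * norm (x - x0)" by (rule Cauchy_Schwarz_ineq2)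
      also have "\<dots> \<le> s * (2 * b + 1)"
        using q s b(1)[OF D(3)] Xb[OF q1] norm_triangle_ineq4[of x x0] by (intro mult_mono) (auto simp: x_def)
      finally show ?thesis using s(4) by (simp add: inner_diff_right)
    qed
    have mem: "y0 \<in> D" "z0 \<in> D" using doubling_max_mem[OF max] by auto
    have mq: "M + v z0 + (norm (x - z0))\<^sup>2 / (2 * \<epsilon>) - \<kappa> \<le> u y0 - (norm (x - y0))\<^sup>2 / (2 * \<epsilon>)"
      using mM qx by (simp add: m_def doubling_def add_divide_distrib)
    have close: "norm (y - z) < \<rho>"
      if "(norm (x - z))\<^sup>2 / (2 * \<epsilon>) + (norm (x + w - y))\<^sup>2 / (2 * \<epsilon>) \<le> K1" "norm w < h" for y z w
    proof -
      have "(norm (x - z))\<^sup>2 + (norm (x + w - y))\<^sup>2 \<le> 2 * \<epsilon> * K1"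
        using that(1) \<epsilon>(1) by (simp add: field_simps)
      then have "(norm (x - z))\<^sup>2 \<le> 2 * \<epsilon> * K1" "(norm (x + w - y))\<^sup>2 \<le> 2 * \<epsilon> * K1"
        using zero_le_power2[of "norm (x - z)"] zero_le_power2[of "norm (x + w - y)"] by linarith+
      then have "(norm (x - z))\<^sup>2 \<le> (\<rho> / 4)\<^sup>2" "(norm (x + w - y))\<^sup>2 \<le> (\<rho> / 4)\<^sup>2"
        using \<epsilon>(3) by auto
      then have n: "norm (x - z) \<le> \<rho> / 4" "norm (x + w - y) \<le> \<rho> / 4"
        using \<rho>(1) by (auto intro: power2_le_imp_le)
      have "y - z = (x - z) + (w - (x + w - y))" by simp
      then have "norm (y - z) \<le> norm (x - z) + (norm w + norm (x + w - y))"
        by (metis norm_triangle_mono norm_triangle_ineq4 order_refl)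
      then show ?thesis using n that(2) h \<zeta>(5) \<rho>(1) by linarith
    qed
    have eventually_near: "\<forall>\<^sub>F y' in nhds y. y' \<in> D \<and> norm (w + (y' - y)) \<le> h" if "y \<in> \<Omega>" "norm w < h" for y w
    proof -
      have "open (\<Omega> \<inter> {y'. norm (w + (y' - y)) < h})"
        by (intro open_Int \<Omega>(1) open_Collect_less continuous_intros)
      moreover have "y \<in> \<Omega> \<inter> {y'. norm (w + (y' - y)) < h}" using that by simp
      ultimately have "\<forall>\<^sub>F y' in nhds y. y' \<in> \<Omega> \<inter> {y'. norm (w + (y' - y)) < h}"
        by (rule eventually_nhds_in_open)
      then show ?thesis
        by eventually_elim (use closure_subset[of \<Omega>] in \<open>auto simp: D_def\<close>)
    qed
    have weaken: "4 * \<zeta> * (norm d)\<^sup>2 \<le> \<delta> * (norm d)\<^sup>2" for d :: "real^'n"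
      using \<zeta>(3) by (intro mult_right_mono) auto

    have gx: "g x = u y0 - (norm (x - y0))\<^sup>2 / (2 * \<epsilon>)" by (rule sup_inf_conv_at_max(1)[OF max])
    have gx': "m + q \<bullet> x - g x = - v z0 - (norm (x - z0))\<^sup>2 / (2 * \<epsilon>)"
      using sup_inf_conv_at_max(2)[OF max] by (simp add: m_def)
    have "\<exists>w y. norm w < h \<and> y \<in> D \<and> g x + p q \<bullet> w + w \<bullet> (A *v w) / 2 \<le> u y - (norm (x + w - y))\<^sup>2 / (2 * \<epsilon>) \<and>
      (\<forall>y'\<in>D. norm (w + (y' - y)) \<le> h \<longrightarrow>
        u y' \<le> u y + (p q + A *v w + (4 * \<zeta>) *\<^sub>R w) \<bullet> (y' - y)
          + ((y' - y) \<bullet> (A *v (y' - y)) + 4 * \<zeta> * (norm (y' - y))\<^sup>2) / 2)"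
    proof (rule convolution_touch[OF D(1) uD \<epsilon>(1) h(1) \<zeta>(1) A mem(1) _ gx])
      show "u y - (norm (x + w - y))\<^sup>2 / (2 * \<epsilon>) \<le> g x + p q \<bullet> w + w \<bullet> (A *v w) / 2 + \<zeta> * h\<^sup>2"
        if "norm w \<le> h" "y \<in> D" for w y
        using sup_inf_conv_ge[OF that(2), of "x + w"] near[OF that(1)] by linarith
    qed
    then obtain w1 y1 where w1: "norm w1 < h" and y1: "y1 \<in> D"
      and low1: "g x + p q \<bullet> w1 + w1 \<bullet> (A *v w1) / 2 \<le> u y1 - (norm (x + w1 - y1))\<^sup>2 / (2 * \<epsilon>)"
      and touch1: "\<And>y'. y' \<in> D \<Longrightarrow> norm (w1 + (y' - y1)) \<le> h \<Longrightarrow>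
        u y' \<le> u y1 + (p q + A *v w1 + (4 * \<zeta>) *\<^sub>R w1) \<bullet> (y' - y1)
          + ((y' - y1) \<bullet> (A *v (y' - y1)) + 4 * \<zeta> * (norm (y' - y1))\<^sup>2) / 2"
      by blast
    have y1O: "y1 \<in> \<Omega>"
    proof -
      have ineq: "M + v z0 + ((norm (x - z0))\<^sup>2 / (2 * \<epsilon>) + (norm (x + w1 - y1))\<^sup>2 / (2 * \<epsilon>)) - 2 * \<kappa> \<le> u y1"
        using low1 mq gx dev[OF w1, of "p q"] pP[OF q1] by linarith
      then have "norm (y1 - z0) < \<rho>"
        using B(1)[OF y1] B(2)[OF mem(2)] B[OF D(3)] \<kappa>(2) w1 by (intro close) (auto simp: M_def K1_def)
      then have "\<bar>v y1 - v z0\<bar> < \<kappa>" using \<rho>(2)[OF mem(2) y1] by simp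
      moreover have "0 \<le> (norm (x - z0))\<^sup>2 / (2 * \<epsilon>)" "0 \<le> (norm (x + w1 - y1))\<^sup>2 / (2 * \<epsilon>)" using \<epsilon> by simp_all
      ultimately have "M - 3 * \<kappa> < u y1 - v y1" using ineq by linarith
      then show ?thesis using \<kappa>(1) \<kappa>(3)[of y1] by (intro DO[OF y1]) auto
    qed
    have nA: "- A \<in> sym_matrices" using A by (simp add: sym_matrices_def transpose_def vec_eq_iff)
    \<comment> \<open>The same argument for -v: by \<open>sup_inf_conv_le_inf\<close> its
      sup-convolution lies below m + q \<bullet> x' - g, which is near a polynomial with slope q - p
      q and Hessian -A. Thus one matrix serves both functions, and the slopes differ by q up to
      small terms.\<close>
    have "\<exists>w z. norm w < h \<and> z \<in> D \<and> (m + q \<bullet> x - g x) + (q - p q) \<bullet> w + w \<bullet> ((- A) *v w) / 2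
         \<le> (- v z) - (norm (x + w - z))\<^sup>2 / (2 * \<epsilon>) \<and>
      (\<forall>z'\<in>D. norm (w + (z' - z)) \<le> h \<longrightarrow>
        - v z' \<le> - v z + (q - p q + (- A) *v w + (4 * \<zeta>) *\<^sub>R w) \<bullet> (z' - z)
          + ((z' - z) \<bullet> ((- A) *v (z' - z)) + 4 * \<zeta> * (norm (z' - z))\<^sup>2) / 2)"
    proof (rule convolution_touch[where u = "\<lambda>z. - v z", OF D(1) _ \<epsilon>(1) h(1) \<zeta>(1) nA mem(2) _ gx'])
      show "continuous_on D (\<lambda>z. - v z)" by (intro continuous_intros vD)
      show "- v z - (norm (x + w - z))\<^sup>2 / (2 * \<epsilon>)
          \<le> (m + q \<bullet> x - g x) + (q - p q) \<bullet> w + w \<bullet> ((- A) *v w) / 2 + \<zeta> * h\<^sup>2"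
        if "norm w \<le> h" "z \<in> D" for w z
        using sup_inf_conv_le_inf[OF max that(2), of "x + w"] near[OF that(1)]
        by (simp add: m_def inner_add_right inner_diff_left matrix_vector_mult_minus_left)
    qed
    then obtain w2 z1 where w2: "norm w2 < h" and z1: "z1 \<in> D"
      and low2: "(m + q \<bullet> x - g x) + (q - p q) \<bullet> w2 + w2 \<bullet> ((- A) *v w2) / 2 \<le> (- v z1) - (norm (x + w2 - z1))\<^sup>2 / (2 * \<epsilon>)"
      and touch2: "\<And>z'. z' \<in> D \<Longrightarrow> norm (w2 + (z' - z1)) \<le> h \<Longrightarrow>
        - v z' \<le> - v z1 + (q - p q + (- A) *v w2 + (4 * \<zeta>) *\<^sub>R w2) \<bullet> (z' - z1)
          + ((z' - z1) \<bullet> ((- A) *v (z' - z1)) + 4 * \<zeta> * (norm (z' - z1))\<^sup>2) / 2"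
      by blast
    have pq: "norm (p q - q) \<le> P + 1"
      using norm_triangle_ineq4[of "p q" q] pP[OF q1] q1 by linarith
    have z1O: "z1 \<in> \<Omega>"
    proof -
      have "(q - p q) \<bullet> w2 + w2 \<bullet> ((- A) *v w2) / 2 = - ((p q - q) \<bullet> w2 + w2 \<bullet> (A *v w2) / 2)"
        by (simp add: inner_diff_left matrix_vector_mult_minus_left)
      then have ineq: "M - u y0 + ((norm (x - y0))\<^sup>2 / (2 * \<epsilon>) + (norm (x + w2 - z1))\<^sup>2 / (2 * \<epsilon>)) - 2 * \<kappa> \<le> - v z1"
        using low2 mq gx' dev[OF w2 pq] by linarith
      then have "norm (z1 - y0) < \<rho>"
        using B(2)[OF z1] B(1)[OF mem(1)] B[OF D(3)] \<kappa>(2) w2 by (intro close) (auto simp: M_def K1_def)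
      then have "\<bar>u z1 - u y0\<bar> < \<kappa>" using \<rho>(2)[OF mem(1) z1] by simp
      moreover have "0 \<le> (norm (x - y0))\<^sup>2 / (2 * \<epsilon>)" "0 \<le> (norm (x + w2 - z1))\<^sup>2 / (2 * \<epsilon>)" using \<epsilon> by simp_all
      ultimately have "M - 3 * \<kappa> < u z1 - v z1" using ineq by linarith
      then show ?thesis using \<kappa>(1) \<kappa>(3)[of z1] by (intro DO[OF z1]) auto
    qed
    define p1 p2 where "p1 = p q + (A *v w1 + (4 * \<zeta>) *\<^sub>R w1)"
      and "p2 = p q - q + (A *v w2 + (4 * \<zeta>) *\<^sub>R (- w2))"
    have small2: "norm (A *v w2 + (4 * \<zeta>) *\<^sub>R (- w2)) \<le> T1 * \<zeta>"
    proof -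
      have "norm (A *v w2 + (4 * \<zeta>) *\<^sub>R (- w2)) \<le> norm (A *v w2) + norm ((4 * \<zeta>) *\<^sub>R w2)"
        using norm_triangle_ineq4[of "A *v w2" "(4 * \<zeta>) *\<^sub>R w2"] by simp
      also have "\<dots> \<le> T * norm w2 + 4 * norm w2"
        using Aw[of w2] \<zeta> by (intro add_mono) (auto simp: mult_left_le_one_le)
      also have "\<dots> \<le> T1 * \<zeta>"
        using w2 h T10 unfolding T1_def distrib_right[symmetric] by (intro mult_left_mono) auto
      finally show ?thesis .
    qed
    have T1\<zeta>: "T1 * \<zeta> \<le> T1" using T10 \<zeta> by (simp add: mult_left_le)
    have n1: "norm p1 \<le> P + 1 + T1"
      using norm_triangle_ineq[of "p q" "A *v w1 + (4 * \<zeta>) *\<^sub>R w1"] pP[OF q1] small[OF w1] T1\<zeta>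
      unfolding p1_def by linarith
    have n2: "norm p2 \<le> P + 1 + T1"
      using norm_triangle_ineq[of "p q - q" "A *v w2 + (4 * \<zeta>) *\<^sub>R (- w2)"] pq small2 T1\<zeta>
      unfolding p2_def by linarith
    have n12: "norm (p1 - p2) \<le> \<delta>"
    proof -
      have "p1 - p2 = q + ((A *v w1 + (4 * \<zeta>) *\<^sub>R w1) - (A *v w2 + (4 * \<zeta>) *\<^sub>R (- w2)))"
        by (simp add: p1_def p2_def)
      then have "norm (p1 - p2) \<le> norm q + (norm (A *v w1 + (4 * \<zeta>) *\<^sub>R w1) + norm (A *v w2 + (4 * \<zeta>) *\<^sub>R (- w2)))"
        by (metis norm_triangle_mono norm_triangle_ineq4 order_refl)
      then show ?thesis using q s(3) small[OF w1] small2 \<zeta>(4) by linarith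
    qed
    have t1: "\<forall>\<^sub>F y' in nhds y1. u y' \<le> u y1 + p1 \<bullet> (y' - y1) + ((y' - y1) \<bullet> (A *v (y' - y1)) + \<delta> * (norm (y' - y1))\<^sup>2) / 2"
      using eventually_near[OF y1O w1]
    proof eventually_elim
      case (elim y')
      then show ?case
        using touch1[of y'] weaken[of "y' - y1"] by (simp add: p1_def add.assoc add_divide_distrib)
    qed
    have t2: "\<forall>\<^sub>F z' in nhds z1. v z' \<ge> v z1 + p2 \<bullet> (z' - z1) + ((z' - z1) \<bullet> (A *v (z' - z1)) - \<delta> * (norm (z' - z1))\<^sup>2) / 2"
      using eventually_near[OF z1O w2]
    proof eventually_elim
      case (elim z')
      define d where "d = z' - z1"
      have "- v z' \<le> - v z1 + (q - p q + (- A) *v w2 + (4 * \<zeta>) *\<^sub>R w2) \<bullet> d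
          + (d \<bullet> ((- A) *v d) + 4 * \<zeta> * (norm d)\<^sup>2) / 2"
        using touch2[of z'] elim by (simp add: d_def)
      moreover have "q - p q + (- A) *v w2 + (4 * \<zeta>) *\<^sub>R w2 = - p2"
        by (simp add: p2_def matrix_vector_mult_minus_left)
      moreover have "d \<bullet> ((- A) *v d) = - (d \<bullet> (A *v d))"
        by (simp add: matrix_vector_mult_minus_left)
      ultimately show ?case
        using weaken[of d] unfolding d_def[symmetric] by (simp add: diff_divide_distrib add_divide_distrib)
    qed
    show "\<exists>A\<in>sym_matrices. \<exists>y\<in>\<Omega>. \<exists>z\<in>\<Omega>. \<exists>p1 p2.
       norm p1 \<le> P + 1 + T1 \<and> norm p2 \<le> P + 1 + T1 \<and> norm (p1 - p2) \<le> \<delta> \<and>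
       (\<forall>\<^sub>F y' in nhds y. u y' \<le> u y + p1 \<bullet> (y' - y) + ((y' - y) \<bullet> (A *v (y' - y)) + \<delta> * (norm (y' - y))\<^sup>2) / 2) \<and>
       (\<forall>\<^sub>F z' in nhds z. v z' \<ge> v z + p2 \<bullet> (z' - z) + ((z' - z) \<bullet> (A *v (z' - z)) - \<delta> * (norm (z' - z))\<^sup>2) / 2)"
      using A y1O z1O n1 n2 n12 t1 t2 by blast
  qed
qed

section \<open>Test functions and the cone condition\<close>

lemma matrix_vector_mult_mat_scaled: "(c *\<^sub>R mat 1) *v w = c *\<^sub>R w" for w :: "real^'n"
  by (simp flip: scaleR_matrix_vector_assoc)

lemma outer_mult: "outer p q *v w = (q \<bullet> w) *\<^sub>R p"
  by (simp add: outer_def matrix_vector_mult_def vec_eq_iff inner_vec_def sum_distrib_left mult_ac)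

lemma sym_matrices_add: "A \<in> sym_matrices \<Longrightarrow> B \<in> sym_matrices \<Longrightarrow> A + B \<in> sym_matrices"
  and sym_matrices_diff: "A \<in> sym_matrices \<Longrightarrow> B \<in> sym_matrices \<Longrightarrow> A - B \<in> sym_matrices"
  and sym_matrices_scaleR: "A \<in> sym_matrices \<Longrightarrow> c *\<^sub>R A \<in> sym_matrices"
  and sym_matrices_mat: "mat c \<in> sym_matrices"
  and sym_matrices_outer: "outer p p \<in> sym_matrices"
  by (auto simp: sym_matrices_def transpose_def vec_eq_iff mat_def outer_def)

lemmas sym_matrices_intros = sym_matrices_add sym_matrices_diff sym_matrices_scaleR sym_matrices_mat sym_matrices_outer

lemma quadratic_form_norm_le:
  fixes E :: "real^'n^'n"
  shows "\<bar>v \<bullet> (E *v v)\<bar> \<le> real CARD('n) * norm E * (norm v)\<^sup>2"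
proof -
  have "v \<bullet> (E *v v) = (\<Sum>i\<in>UNIV. v $ i * (E $ i \<bullet> v))"
    by (simp add: inner_vec_def matrix_vector_mult_def)
  also have "\<bar>\<dots>\<bar> \<le> (\<Sum>i\<in>(UNIV :: 'n set). norm v * (norm E * norm v))"
  proof (rule order_trans[OF sum_abs sum_mono])
    fix i :: 'n
    have "\<bar>E $ i \<bullet> v\<bar> \<le> norm (E $ i) * norm v" by (rule Cauchy_Schwarz_ineq2)
    also have "\<dots> \<le> norm E * norm v" by (intro mult_right_mono Finite_Cartesian_Product.norm_nth_le) simp
    finally show "\<bar>v $ i * (E $ i \<bullet> v)\<bar> \<le> norm v * (norm E * norm v)"
      unfolding abs_mult by (intro mult_mono component_le_norm_cart) auto
  qed
  finally show ?thesis by (simp add: power2_eq_square mult_ac)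
qed

text \<open>A matrix Z of U close enough to X leaves Y - Z positive definite, with half of the
  margin m to spare. This is the way in which strictness leads from the closure into U
  itself.\<close>

lemma closure_add_mem:
  fixes U :: "(real^'n^'n) set"
  assumes U: "U \<subseteq> sym_matrices" "\<And>A B. A \<in> U \<Longrightarrow> B \<in> sym_matrices \<Longrightarrow> pos_def B \<Longrightarrow> A + B \<in> U"
    and X: "X \<in> closure U" and Y: "Y \<in> sym_matrices"
    and m: "0 < m" "\<And>\<xi>. m * (norm \<xi>)\<^sup>2 \<le> \<xi> \<bullet> (Y *v \<xi>) - \<xi> \<bullet> (X *v \<xi>)"
  shows "Y \<in> U"
proof -
  define n where "n = real CARD('n)"
  have n: "0 < n" by (simp add: n_def)
  obtain Z where Z: "Z \<in> U" "dist Z X < m / (2 * n)"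
    using X m(1) n unfolding closure_approachable by (meson divide_pos_pos mult_pos_pos zero_less_numeral)
  have "pos_def (Y - Z)"
    unfolding pos_def_def
  proof (intro conjI allI impI)
    show "Y - Z \<in> sym_matrices" using Y Z U by (intro sym_matrices_intros) auto
    fix v :: "real^'n" assume "v \<noteq> 0"
    have "\<bar>v \<bullet> ((X - Z) *v v)\<bar> \<le> n * norm (X - Z) * (norm v)\<^sup>2"
      unfolding n_def by (rule quadratic_form_norm_le)
    also have "\<dots> \<le> (m / 2) * (norm v)\<^sup>2"
      using Z(2) n by (intro mult_right_mono) (auto simp: dist_norm norm_minus_commute field_simps)
    finally have "\<bar>v \<bullet> (X *v v) - v \<bullet> (Z *v v)\<bar> \<le> (m / 2) * (norm v)\<^sup>2"
      by (simp only: matrix_vector_mult_diff_rdistrib inner_diff_right)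
    then have "- (m / 2 * (norm v)\<^sup>2) \<le> v \<bullet> (X *v v) - v \<bullet> (Z *v v)"
      by linarith
    moreover have "0 < m * (norm v)\<^sup>2" using \<open>v \<noteq> 0\<close> m(1) by simp
    ultimately show "0 < v \<bullet> ((Y - Z) *v v)"
      using m(2)[of v] by (simp add: matrix_vector_mult_diff_rdistrib inner_diff_right)
  qed
  with U(2)[OF Z(1), of "Y - Z"] show ?thesis
    by (simp add: pos_def_def)
qed

section \<open>Composition of a quadratic polynomial with a scalar function\<close>

definition quadratic :: "real \<Rightarrow> real^'n \<Rightarrow> real^'n^'n \<Rightarrow> real^'n \<Rightarrow> real^'n \<Rightarrow> real" where
  "quadratic k p A a y = k + p \<bullet> (y - a) + ((y - a) \<bullet> (A *v (y - a))) / 2"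

context
  fixes G G' G'' :: "real \<Rightarrow> real" and k :: real and p a :: "real^'n" and A :: "real^'n^'n"
  assumes G: "\<And>t. (G has_real_derivative G' t) (at t)" "\<And>t. (G' has_real_derivative G'' t) (at t)"
    and G''c: "continuous_on UNIV G''" and A: "A \<in> sym_matrices"
begin

lemma quadratic_has_derivative:
  "(quadratic k p A a has_derivative (\<lambda>h. (p + A *v (y - a)) \<bullet> h)) (at y)"
proof -
  have "(quadratic k p A a has_derivative (\<lambda>h. p \<bullet> h + ((y - a) \<bullet> (A *v h) + h \<bullet> (A *v (y - a))) / 2)) (at y)"
    unfolding quadratic_def
    by (auto intro!: derivative_eq_intros bounded_linear.has_derivative[OF matrix_vector_mul_bounded_linear])
  also have "(\<lambda>h. p \<bullet> h + ((y - a) \<bullet> (A *v h) + h \<bullet> (A *v (y - a))) / 2) = (\<lambda>h. (p + A *v (y - a)) \<bullet> h)"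
    using sym_matrices_inner[OF A, of "y - a"] by (auto simp: inner_add_left inner_add_right inner_commute fun_eq_iff)
  finally show ?thesis .
qed

lemma test_function_has_derivative:
  "((\<lambda>y. G (quadratic k p A a y)) has_derivative (\<lambda>h. G' (quadratic k p A a y) * ((p + A *v (y - a)) \<bullet> h))) (at y)"
  using has_derivative_compose[OF quadratic_has_derivative, of G] G(1)
  by (simp add: has_field_derivative_def)

lemma grad_test_function:
  "grad (\<lambda>y. G (quadratic k p A a y)) y = G' (quadratic k p A a y) *\<^sub>R (p + A *v (y - a))"
  unfolding grad_def frechet_derivative_at[OF test_function_has_derivative, symmetric]
  by (simp add: vec_eq_iff inner_axis)

lemma grad_test_function_has_derivative:
  "(grad (\<lambda>y. G (quadratic k p A a y)) has_derivative
     (\<lambda>h. (G'' (quadratic k p A a y) * ((p + A *v (y - a)) \<bullet> h)) *\<^sub>R (p + A *v (y - a))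
       + G' (quadratic k p A a y) *\<^sub>R (A *v h))) (at y)"
proof -
  have 1: "((\<lambda>y. G' (quadratic k p A a y)) has_derivative
      (\<lambda>h. G'' (quadratic k p A a y) * ((p + A *v (y - a)) \<bullet> h))) (at y)"
    using has_derivative_compose[OF quadratic_has_derivative, of G'] G(2)
    by (simp add: has_field_derivative_def)
  have 2: "((\<lambda>y. p + A *v (y - a)) has_derivative (\<lambda>h. A *v h)) (at y)"
    by (auto intro!: derivative_eq_intros bounded_linear.has_derivative[OF matrix_vector_mul_bounded_linear])
  have "grad (\<lambda>y. G (quadratic k p A a y)) = (\<lambda>y. G' (quadratic k p A a y) *\<^sub>R (p + A *v (y - a)))"
    using grad_test_function by blast
  then show ?thesis
    using has_derivative_scaleR[OF 1 2] by (simp add: add.commute)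
qed

lemma hess_test_function:
  "hess (\<lambda>y. G (quadratic k p A a y)) y = G'' (quadratic k p A a y) *\<^sub>R outer (p + A *v (y - a)) (p + A *v (y - a))
     + G' (quadratic k p A a y) *\<^sub>R A"
proof -
  have "(A *v axis j 1) $ i = A $ i $ j" for i j
    by (simp add: matrix_vector_mult_basis column_def)
  then show ?thesis
    unfolding hess_def jacobian_def frechet_derivative_at[OF grad_test_function_has_derivative, symmetric]
    by (simp add: matrix_def vec_eq_iff inner_axis outer_def)
qed

text \<open>Test functions have to be of class C2 on all of \<Omega> although they touch only
  locally. As G is of class C2 on the whole line, no cut-off is required.\<close>

lemma C2_on_test_function: "C2_on \<Omega> (\<lambda>y. G (quadratic k p A a y))"
proof -
  have q: "continuous_on \<Omega> (quadratic k p A a)"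
    by (meson continuous_at_imp_continuous_on has_derivative_continuous quadratic_has_derivative)
  have "continuous_on UNIV G'"
    using G(2) by (meson DERIV_continuous continuous_at_imp_continuous_on)
  then have 1: "continuous_on \<Omega> (\<lambda>y. G' (quadratic k p A a y))" "continuous_on \<Omega> (\<lambda>y. G'' (quadratic k p A a y))"
    using continuous_on_compose2[OF _ q] G''c by auto
  have 2: "continuous_on \<Omega> (\<lambda>y. p + A *v (y - a))"
    by (intro continuous_intros continuous_on_compose2[OF matrix_vector_mult_linear_continuous_on]) auto
  have "continuous_on \<Omega> (\<lambda>y. outer (p + A *v (y - a)) (p + A *v (y - a)))"
    unfolding outer_def by (intro continuous_intros 2)
  then have "continuous_on \<Omega> (hess (\<lambda>y. G (quadratic k p A a y)))"
    unfolding hess_test_function by (intro continuous_intros 1)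
  then show ?thesis
    unfolding C2_on_def using test_function_has_derivative grad_test_function_has_derivative
    by (auto simp: differentiable_def)
qed

text \<open>The outer product with coefficient \<open>G'' k\<close> is where the concavity of a
  change of variables enters.\<close>

lemma F_op_test_function:
  "F_op \<alpha> \<beta> (\<lambda>y. G (quadratic k p A a y)) a
    = G' k *\<^sub>R A + (G'' k + \<alpha> * (G' k)\<^sup>2) *\<^sub>R outer p p - (\<beta> * (G' k)\<^sup>2 * (norm p)\<^sup>2) *\<^sub>R mat 1"
proof -
  have [simp]: "quadratic k p A a a = k" by (simp add: quadratic_def)
  have o: "outer (c *\<^sub>R p) (c *\<^sub>R p) = c\<^sup>2 *\<^sub>R outer p p" for c
    by (simp add: outer_def vec_eq_iff power2_eq_square)
  show ?thesis
    unfolding F_op_def hess_test_function grad_test_function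
    by (simp add: o power_mult_distrib algebra_simps)
qed

lemma viscosity_touch_above:
  assumes "viscosity_boundary (F_op \<alpha> \<beta>) U \<Omega> \<psi>" "a \<in> \<Omega>" "\<psi> a = G k"
    and "\<forall>\<^sub>F y in nhds a. \<psi> y \<le> G (quadratic k p A a y)"
  shows "G' k *\<^sub>R A + (G'' k + \<alpha> * (G' k)\<^sup>2) *\<^sub>R outer p p - (\<beta> * (G' k)\<^sup>2 * (norm p)\<^sup>2) *\<^sub>R mat 1 \<in> closure U"
  unfolding F_op_test_function[symmetric]
  using assms C2_on_test_function[of \<Omega>] unfolding viscosity_boundary_def
  by (simp add: quadratic_def)

lemma viscosity_touch_below:
  assumes "viscosity_boundary (F_op \<alpha> \<beta>) U \<Omega> \<psi>" "a \<in> \<Omega>" "\<psi> a = G k"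
    and "\<forall>\<^sub>F y in nhds a. \<psi> y \<ge> G (quadratic k p A a y)"
  shows "G' k *\<^sub>R A + (G'' k + \<alpha> * (G' k)\<^sup>2) *\<^sub>R outer p p - (\<beta> * (G' k)\<^sup>2 * (norm p)\<^sup>2) *\<^sub>R mat 1 \<in> sym_matrices - U"
  unfolding F_op_test_function[symmetric]
  using assms C2_on_test_function[of \<Omega>] unfolding viscosity_boundary_def
  by (simp add: quadratic_def)

end

section \<open>Strict subsolutions and comparison\<close>

lemma young_weighted:
  fixes x y w :: real
  assumes "0 < w"
  shows "2 * (x * y) \<le> w * x\<^sup>2 + y\<^sup>2 / w"
proof -
  have "0 \<le> (w * x - y)\<^sup>2 / w" using assms by simp
  also have "\<dots> = w * x\<^sup>2 - 2 * (x * y) + y\<^sup>2 / w"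
    using assms by (simp add: power2_eq_square field_simps)
  finally show ?thesis by simp
qed

text \<open>In the application \<open>a\<close> and \<open>e\<close> are the components of \<open>\<nabla>\<chi>\<close> and \<open>\<theta>\<nu>y\<close> in some direction of squared
  length \<open>N\<close>, \<open>r\<close> and \<open>E\<close> are the lengths of these two vectors, and \<open>re\<close> is their inner product.
  The terms linear in the gradient are absorbed by the quadratic ones gained from the concavity of
  the change of variables (for \<open>\<alpha>\<close>) and from its slope differing from 1 (for \<open>\<beta>\<close>).\<close>

lemma strictness_gain:
  fixes \<alpha> \<beta> \<theta> \<sigma> \<tau> \<tau>0 \<nu> R N :: real
  assumes \<theta>: "0 < \<theta>" "\<theta> \<le> 1" and \<tau>: "0 < \<tau>0" "\<tau>0 \<le> \<tau>" and \<sigma>: "\<bar>\<sigma>\<bar> = 1" "\<beta> * \<sigma> = \<bar>\<beta>\<bar>"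
    and g: "g = 1 + \<theta> * \<sigma> * \<tau>" "1 / 2 \<le> g" "g \<le> 3 / 2" and k: "k = 2 * (\<bar>\<alpha>\<bar> + 1)"
    and N: "0 \<le> N" "e\<^sup>2 \<le> N * E\<^sup>2" and E: "0 \<le> E" "E \<le> \<theta> * \<nu> * R" and r: "0 \<le> r" "\<bar>re\<bar> \<le> r * E"
    and \<nu>: "0 < \<nu>" "\<nu> * R\<^sup>2 * ((\<alpha>\<^sup>2 + \<bar>\<beta>\<bar>) / \<tau>0 + \<bar>\<alpha>\<bar> + \<bar>\<beta>\<bar>) \<le> 1 / 2"
  shows "\<theta> * \<nu> / 2 * N \<le> \<theta> * \<nu> * N + \<alpha> * (a + e)\<^sup>2 - (- (\<theta> * k * \<tau>) + \<alpha> * g\<^sup>2) / g * a\<^sup>2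
     - \<beta> * (r\<^sup>2 + 2 * re + E\<^sup>2) * N + \<beta> * g * r\<^sup>2 * N"
proof -
  \<comment> \<open>The weight for Young's inequality: a lower bound of \<theta>\<tau> that does not
    depend on the point, so that \<nu> can be chosen uniformly.\<close>
  define w where "w = \<theta> * \<tau>0"
  have w: "0 < w" "w \<le> \<theta> * \<tau>" using \<theta> \<tau> by (simp_all add: w_def)
  have g0: "0 < g" using g by linarith
  have "\<bar>1 - g\<bar> = \<theta> * \<tau>"
    using g(1) \<sigma>(1) \<theta>(1) \<tau> by (simp add: abs_mult)
  then have ag: "\<bar>\<alpha> * (1 - g)\<bar> = \<bar>\<alpha>\<bar> * (\<theta> * \<tau>)" by (simp add: abs_mult)
  \<comment> \<open>This explains the choice of k: as g \<le> 3/2, the concavity term outweighs the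
    contribution |\<alpha>|\<theta>\<tau> of the factor 1 - g and leaves one full
    \<theta>\<tau>.\<close>
  have "\<bar>\<alpha>\<bar> + 1 \<le> k / g"
  proof -
    have "(\<bar>\<alpha>\<bar> + 1) * g \<le> (\<bar>\<alpha>\<bar> + 1) * (3 / 2)"
      using g(3) by (intro mult_left_mono) auto
    also have "\<dots> \<le> k" unfolding k by simp
    finally show ?thesis using g0 by (simp add: pos_le_divide_eq)
  qed
  then have "\<theta> * \<tau> * (\<bar>\<alpha>\<bar> + 1) \<le> \<theta> * \<tau> * (k / g)"
    using \<theta> \<tau> by (intro mult_left_mono) auto
  then have kg: "\<theta> * \<tau> + \<bar>\<alpha>\<bar> * (\<theta> * \<tau>) \<le> \<theta> * k * \<tau> / g" by (simp add: algebra_simps)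
  have "w \<le> \<theta> * k * \<tau> / g + \<alpha> * (1 - g)"
    using kg ag w(2) by linarith
  then have A: "w * a\<^sup>2 \<le> (\<theta> * k * \<tau> / g + \<alpha> * (1 - g)) * a\<^sup>2"
    by (rule mult_right_mono) simp
  define Q where "Q = (- (\<theta> * k * \<tau>) + \<alpha> * g\<^sup>2) / g"
  have A': "\<alpha> * a\<^sup>2 - Q * a\<^sup>2 = (\<theta> * k * \<tau> / g + \<alpha> * (1 - g)) * a\<^sup>2"
    unfolding Q_def using g0 by (simp add: field_simps power2_eq_square)
  have "2 * (\<bar>a\<bar> * \<bar>\<alpha> * e\<bar>) \<le> w * \<bar>a\<bar>\<^sup>2 + \<bar>\<alpha> * e\<bar>\<^sup>2 / w"
    by (rule young_weighted[OF w(1)])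
  moreover have "\<bar>a\<bar> * \<bar>\<alpha> * e\<bar> = \<bar>\<alpha> * (a * e)\<bar>" by (simp add: abs_mult mult_ac)
  ultimately have B: "- (2 * (\<alpha> * (a * e))) \<le> w * a\<^sup>2 + \<alpha>\<^sup>2 * e\<^sup>2 / w"
    by (simp add: power_mult_distrib)
  have C: "- (\<bar>\<alpha>\<bar> * e\<^sup>2) \<le> \<alpha> * e\<^sup>2"
    using mult_right_mono[of "- \<bar>\<alpha>\<bar>" \<alpha> "e\<^sup>2"] by simp
  have e1: "\<alpha>\<^sup>2 * e\<^sup>2 / w + \<bar>\<alpha>\<bar> * e\<^sup>2 \<le> (\<alpha>\<^sup>2 / w + \<bar>\<alpha>\<bar>) * E\<^sup>2 * N"
  proof -
    have "(\<alpha>\<^sup>2 / w + \<bar>\<alpha>\<bar>) * e\<^sup>2 \<le> (\<alpha>\<^sup>2 / w + \<bar>\<alpha>\<bar>) * (N * E\<^sup>2)"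
      using w by (intro mult_left_mono N(2)) auto
    then show ?thesis by (simp add: algebra_simps)
  qed
  have F: "\<beta> * g * r\<^sup>2 - \<beta> * r\<^sup>2 = \<bar>\<beta>\<bar> * (\<theta> * \<tau>) * r\<^sup>2"
    unfolding g(1) \<sigma>(2)[symmetric] by (simp add: algebra_simps)
  have "2 * (r * E) \<le> w * r\<^sup>2 + E\<^sup>2 / w" by (rule young_weighted[OF w(1)])
  then have "2 * \<bar>re\<bar> \<le> w * r\<^sup>2 + E\<^sup>2 / w" using r(2) by linarith
  then have "\<bar>\<beta>\<bar> * (2 * \<bar>re\<bar>) \<le> \<bar>\<beta>\<bar> * (w * r\<^sup>2 + E\<^sup>2 / w)" by (intro mult_left_mono) auto
  moreover have "\<beta> * (2 * re) \<le> \<bar>\<beta>\<bar> * (2 * \<bar>re\<bar>)"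
    by (metis abs_ge_self abs_mult abs_numeral)
  moreover have "\<bar>\<beta>\<bar> * (w * r\<^sup>2) \<le> \<bar>\<beta>\<bar> * (\<theta> * \<tau> * r\<^sup>2)"
    using w(2) by (intro mult_left_mono mult_right_mono) auto
  moreover have "\<beta> * E\<^sup>2 \<le> \<bar>\<beta>\<bar> * E\<^sup>2" by (intro mult_right_mono) auto
  ultimately have "- (\<bar>\<beta>\<bar> / w + \<bar>\<beta>\<bar>) * E\<^sup>2 \<le> \<beta> * g * r\<^sup>2 - \<beta> * (r\<^sup>2 + 2 * re + E\<^sup>2)"
    using F by (simp add: algebra_simps)
  then have G: "- (\<bar>\<beta>\<bar> / w + \<bar>\<beta>\<bar>) * E\<^sup>2 * N \<le> (\<beta> * g * r\<^sup>2 - \<beta> * (r\<^sup>2 + 2 * re + E\<^sup>2)) * N"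
    using N(1) by (rule mult_right_mono)
  \<comment> \<open>E^2 is of order (\<theta>\<nu>)^2 and w of order \<theta>, so E^2/w carries a
    second factor \<nu> beside \<theta>\<nu>. A small \<nu> therefore makes all errors at most half
    of the gain.\<close>
  have H: "((\<alpha>\<^sup>2 / w + \<bar>\<alpha>\<bar>) + (\<bar>\<beta>\<bar> / w + \<bar>\<beta>\<bar>)) * E\<^sup>2 \<le> \<theta> * \<nu> / 2"
  proof -
    have "E\<^sup>2 \<le> (\<theta> * \<nu> * R)\<^sup>2" using E by (intro power_mono) auto
    then have "((\<alpha>\<^sup>2 / w + \<bar>\<alpha>\<bar>) + (\<bar>\<beta>\<bar> / w + \<bar>\<beta>\<bar>)) * E\<^sup>2
        \<le> ((\<alpha>\<^sup>2 / w + \<bar>\<alpha>\<bar>) + (\<bar>\<beta>\<bar> / w + \<bar>\<beta>\<bar>)) * (\<theta> * \<nu> * R)\<^sup>2"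
      using w by (intro mult_left_mono) auto
    also have "\<dots> = \<theta> * \<nu> * (\<nu> * R\<^sup>2 * ((\<alpha>\<^sup>2 + \<bar>\<beta>\<bar>) / \<tau>0 + \<theta> * (\<bar>\<alpha>\<bar> + \<bar>\<beta>\<bar>)))"
      unfolding w_def using \<theta>(1) \<tau>(1) by (simp add: field_simps power2_eq_square)
    also have "\<dots> \<le> \<theta> * \<nu> * (\<nu> * R\<^sup>2 * ((\<alpha>\<^sup>2 + \<bar>\<beta>\<bar>) / \<tau>0 + 1 * (\<bar>\<alpha>\<bar> + \<bar>\<beta>\<bar>)))"
      using \<theta> \<nu>(1) by (intro mult_left_mono add_left_mono mult_right_mono) auto
    also have "\<dots> \<le> \<theta> * \<nu> * (1 / 2)"
      using \<theta>(1) \<nu> by (intro mult_left_mono) (auto simp: add.assoc)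
    finally show ?thesis by simp
  qed
  have H': "((\<alpha>\<^sup>2 / w + \<bar>\<alpha>\<bar>) + (\<bar>\<beta>\<bar> / w + \<bar>\<beta>\<bar>)) * E\<^sup>2 * N \<le> \<theta> * \<nu> / 2 * N"
    using H N(1) by (rule mult_right_mono)
  have "\<theta> * \<nu> * N + \<alpha> * (a + e)\<^sup>2 - Q * a\<^sup>2
     - \<beta> * (r\<^sup>2 + 2 * re + E\<^sup>2) * N + \<beta> * g * r\<^sup>2 * N
     = \<theta> * \<nu> * N + (\<alpha> * a\<^sup>2 - Q * a\<^sup>2) + 2 * (\<alpha> * (a * e)) + \<alpha> * e\<^sup>2
       + (\<beta> * g * r\<^sup>2 - \<beta> * (r\<^sup>2 + 2 * re + E\<^sup>2)) * N"
    by (simp add: power2_eq_square algebra_simps)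
  also have "\<dots> \<ge> \<theta> * \<nu> * N + w * a\<^sup>2 - (w * a\<^sup>2 + \<alpha>\<^sup>2 * e\<^sup>2 / w) - \<bar>\<alpha>\<bar> * e\<^sup>2 - (\<bar>\<beta>\<bar> / w + \<bar>\<beta>\<bar>) * E\<^sup>2 * N"
    unfolding A' using A B C G by linarith
  moreover have "\<theta> * \<nu> * N + w * a\<^sup>2 - (w * a\<^sup>2 + \<alpha>\<^sup>2 * e\<^sup>2 / w) - \<bar>\<alpha>\<bar> * e\<^sup>2 - (\<bar>\<beta>\<bar> / w + \<bar>\<beta>\<bar>) * E\<^sup>2 * N
      \<ge> \<theta> * \<nu> / 2 * N"
  proof -
    have eq: "((\<alpha>\<^sup>2 / w + \<bar>\<alpha>\<bar>) + (\<bar>\<beta>\<bar> / w + \<bar>\<beta>\<bar>)) * E\<^sup>2 * N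
        = (\<alpha>\<^sup>2 / w + \<bar>\<alpha>\<bar>) * E\<^sup>2 * N + (\<bar>\<beta>\<bar> / w + \<bar>\<beta>\<bar>) * E\<^sup>2 * N"
      by (simp add: algebra_simps)
    have gen: "h \<le> T + v - (v + x) - y - S" if "x + y \<le> Z" "X = Z + S" "X \<le> h" "T = h + h"
      for h T v x y Z S X :: real
      using that by linarith
    show ?thesis by (rule gen[OF e1 eq H']) simp
  qed
  ultimately show ?thesis unfolding Q_def by linarith
qed

lemma closure_cone_scaleR:
  fixes U :: "'a::real_normed_vector set"
  assumes "\<And>A c. A \<in> U \<Longrightarrow> c > 0 \<Longrightarrow> c *\<^sub>R A \<in> U" "X \<in> closure U" "c > 0"
  shows "c *\<^sub>R X \<in> closure U"
proof -
  have "c *\<^sub>R X \<in> (*\<^sub>R) c ` closure U" using assms(2) by blast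
  also have "\<dots> \<subseteq> closure ((*\<^sub>R) c ` U)" by (simp add: closure_scaleR)
  also have "\<dots> \<subseteq> closure U" using assms by (intro closure_mono) auto
  finally show ?thesis .
qed

text \<open>The perturbation is \<open>u = f(\<psi>) + \<theta>\<nu>|x|\<^sup>2/2\<close>, where \<open>f\<close> is the inverse of
  \<open>g(t) = t - (\<theta>/k) exp(-\<sigma>kt)\<close>. The sign \<open>\<sigma>\<close> is that of \<open>\<beta>\<close>, so that \<open>\<beta>(g' - 1) \<ge> 0\<close>.\<close>

lemma strict_subsolution:
  fixes \<psi> :: "real^'n \<Rightarrow> real"
  assumes \<Omega>: "bounded \<Omega>" "open \<Omega>" and U: "U \<subseteq> sym_matrices"
      "\<And>A B. A \<in> U \<Longrightarrow> B \<in> sym_matrices \<Longrightarrow> pos_def B \<Longrightarrow> A + B \<in> U"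
      "\<And>A c. A \<in> U \<Longrightarrow> c > 0 \<Longrightarrow> c *\<^sub>R A \<in> U"
    and \<psi>: "continuous_on (closure \<Omega>) \<psi>" "viscosity_boundary (F_op \<alpha> \<beta>) U \<Omega> \<psi>" and \<eta>: "0 < \<eta>"
  shows "\<exists>u \<delta>. 0 < \<delta> \<and> continuous_on (closure \<Omega>) u \<and> (\<forall>x\<in>closure \<Omega>. \<bar>u x - \<psi> x\<bar> \<le> \<eta>) \<and>
    (\<forall>y\<in>\<Omega>. \<forall>p. \<forall>A\<in>sym_matrices. (\<forall>\<^sub>F y' in nhds y. u y' \<le> quadratic (u y) p A y y') \<longrightarrow>
      A + \<alpha> *\<^sub>R outer p p - (\<beta> * (norm p)\<^sup>2 + \<delta>) *\<^sub>R mat 1 \<in> closure U)"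
proof -
  define D where "D = closure \<Omega>"
  have D: "compact D" using \<Omega>(1) by (simp add: D_def)
  have \<Omega>D: "\<Omega> \<subseteq> D" by (simp add: D_def closure_subset)
  have \<psi>D: "continuous_on D \<psi>" using \<psi>(1) by (simp add: D_def)
  obtain R where R: "0 < R" "\<And>x. x \<in> D \<Longrightarrow> norm x \<le> R"
    using compact_imp_bounded[OF D] unfolding bounded_pos by blast
  obtain L0 where L0: "\<And>x. x \<in> D \<Longrightarrow> \<bar>\<psi> x\<bar> \<le> L0" "0 < L0"
    using compact_imp_bounded[OF compact_continuous_image[OF \<psi>D D]] unfolding bounded_pos by auto
  define k where "k = 2 * (\<bar>\<alpha>\<bar> + 1)"
  have k: "2 \<le> k" by (simp add: k_def)
  define \<sigma> :: real where "\<sigma> = (if 0 \<le> \<beta> then 1 else - 1)"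
  have \<sigma>: "\<bar>\<sigma>\<bar> = 1" "\<beta> * \<sigma> = \<bar>\<beta>\<bar>" "\<sigma> * \<sigma> = 1" by (auto simp: \<sigma>_def)
  \<comment> \<open>The values of f(\<psi>) stay within L0 + 1/2, so L0 + 1 leaves room for a
    touching polynomial to vary while g is still increasing.\<close>
  define L where "L = L0 + 1"
  define \<tau>0 \<tau>1 where "\<tau>0 = exp (- (k * L))" and "\<tau>1 = exp (k * L)"
  define \<tau> where "\<tau> = (\<lambda>t. exp (- (\<sigma> * k * t)))"
  have \<tau>: "\<tau>0 \<le> \<tau> t" "\<tau> t \<le> \<tau>1" if "\<bar>t\<bar> \<le> L" for t
  proof -
    have "\<bar>\<sigma> * k * t\<bar> \<le> k * L"
      using that k by (simp add: abs_mult \<sigma>(1))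
    then show "\<tau>0 \<le> \<tau> t" "\<tau> t \<le> \<tau>1"
      unfolding \<tau>_def \<tau>0_def \<tau>1_def by (auto simp: abs_le_iff)
  qed
  have \<tau>0: "0 < \<tau>0" and \<tau>1: "0 < \<tau>1" by (simp_all add: \<tau>0_def \<tau>1_def)
  define W where "W = (\<alpha>\<^sup>2 + \<bar>\<beta>\<bar>) / \<tau>0 + \<bar>\<alpha>\<bar> + \<bar>\<beta>\<bar>"
  have W: "0 \<le> W" using \<tau>0 by (simp add: W_def)
  \<comment> \<open>\<nu> does not depend on \<theta>, which can still be shrunk afterwards. The + 1
    avoids division by zero when \<alpha> = \<beta> = 0.\<close>
  define \<nu> where "\<nu> = 1 / (2 * (R\<^sup>2 * W + 1))"
  have RW: "0 \<le> R\<^sup>2 * W" using W by simp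
  have \<nu>: "0 < \<nu>" "\<nu> \<le> 1" "\<nu> * R\<^sup>2 * W \<le> 1 / 2"
    using RW by (auto simp: \<nu>_def field_simps)
  \<comment> \<open>Here \<theta>\<tau>1 controls the distance of g' from 1 and of f from the
    identity, and \<theta>R^2 the size of the added square.\<close>
  define \<theta> where "\<theta> = min 1 (min \<eta> (1 / 2) / (\<tau>1 + R\<^sup>2))"
  have \<tau>R: "0 < \<tau>1 + R\<^sup>2" using \<tau>1 by (simp add: add_pos_nonneg)
  have \<theta>: "0 < \<theta>" "\<theta> \<le> 1" "\<theta> * (\<tau>1 + R\<^sup>2) \<le> \<eta>" "\<theta> * (\<tau>1 + R\<^sup>2) \<le> 1 / 2"
  proof -
    have "\<theta> \<le> min \<eta> (1 / 2) / (\<tau>1 + R\<^sup>2)" unfolding \<theta>_def by (rule min.cobounded2)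
    then have "\<theta> * (\<tau>1 + R\<^sup>2) \<le> min \<eta> (1 / 2)" using \<tau>R by (simp add: pos_le_divide_eq)
    then show "\<theta> * (\<tau>1 + R\<^sup>2) \<le> \<eta>" "\<theta> * (\<tau>1 + R\<^sup>2) \<le> 1 / 2" by auto
  qed (use \<eta> \<tau>R in \<open>auto simp: \<theta>_def\<close>)
  have \<theta>\<tau>1: "\<theta> * \<tau>1 \<le> 1 / 2"
  proof -
    have "\<theta> * \<tau>1 \<le> \<theta> * (\<tau>1 + R\<^sup>2)"
      using \<theta>(1) by (intro mult_left_mono) auto
    then show ?thesis using \<theta>(4) by linarith
  qed
  define g g' g'' where "g = (\<lambda>t. t - \<theta> / k * \<tau> t)" and "g' = (\<lambda>t. 1 + \<theta> * \<sigma> * \<tau> t)"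
    and "g'' = (\<lambda>t. - (\<theta> * k * \<tau> t))"
  have gd: "(g has_real_derivative g' t) (at t)" for t
    unfolding g_def g'_def \<tau>_def using k by (auto intro!: derivative_eq_intros)
  have gd': "(g' has_real_derivative g'' t) (at t)" for t
  proof -
    have 1: "(g' has_real_derivative \<theta> * \<sigma> * (\<tau> t * - (\<sigma> * k))) (at t)"
      unfolding g'_def \<tau>_def by (auto intro!: derivative_eq_intros)
    have 2: "\<theta> * \<sigma> * (\<tau> t * - (\<sigma> * k)) = - (\<theta> * (\<sigma> * \<sigma>) * k * \<tau> t)"
      by (simp add: mult_ac)
    show ?thesis using 1 unfolding 2 \<sigma>(3) g''_def by simp
  qed
  have g''c: "continuous_on UNIV g''"
    unfolding g''_def \<tau>_def by (intro continuous_intros)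
  have gc: "continuous_on S g" for S
    using gd by (meson DERIV_continuous continuous_at_imp_continuous_on)
  have g'b: "1 / 2 \<le> g' t" "g' t \<le> 3 / 2" if "\<bar>t\<bar> \<le> L" for t
  proof -
    have "\<theta> * \<tau> t \<le> \<theta> * \<tau>1" using \<tau>(2)[OF that] \<theta>(1) by simp
    then have "\<theta> * \<tau> t \<le> 1 / 2" using \<theta>\<tau>1 by linarith
    moreover have "\<bar>\<theta> * \<sigma> * \<tau> t\<bar> = \<theta> * \<tau> t"
      using \<theta>(1) \<sigma>(1) by (simp add: abs_mult \<tau>_def)
    ultimately show "1 / 2 \<le> g' t" "g' t \<le> 3 / 2" unfolding g'_def by linarith+
  qed
  have g_mono: "g s < g t" if "- L \<le> s" "s < t" "t \<le> L" for s t
  proof (rule DERIV_pos_imp_increasing[OF that(2)])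
    fix x assume "s \<le> x" "x \<le> t"
    then have "\<bar>x\<bar> \<le> L" using that by auto
    then show "\<exists>y. (g has_real_derivative y) (at x) \<and> 0 < y"
      using gd g'b(1)[of x] by (intro exI[of _ "g' x"]) auto
  qed
  have g_near: "\<bar>g t - t\<bar> \<le> \<theta> * \<tau>1 / 2" if "\<bar>t\<bar> \<le> L" for t
  proof -
    have "\<bar>g t - t\<bar> = \<theta> * \<tau> t / k" using \<theta>(1) k by (simp add: g_def abs_mult \<tau>_def)
    also have "\<dots> \<le> \<theta> * \<tau>1 / 2"
      using \<tau>(2)[OF that] \<theta>(1) k \<tau>1 by (intro frac_le mult_left_mono) auto
    finally show ?thesis .
  qed
  have inj: "inj_on g {- L..L}"
    by (rule linorder_inj_onI) (use g_mono in fastforce)+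
  define f where "f = inv_into {- L..L} g"
  have fc: "continuous_on (g ` {- L..L}) f"
    unfolding f_def by (rule continuous_on_inv[OF gc compact_Icc]) (simp add: inj)
  have L: "0 < L" using L0 by (simp add: L_def)
  have surj: "s \<in> g ` {- L..L}" if "\<bar>s\<bar> \<le> L0" for s
  proof -
    have "\<bar>g (- L) - (- L)\<bar> \<le> \<theta> * \<tau>1 / 2" "\<bar>g L - L\<bar> \<le> \<theta> * \<tau>1 / 2"
      using L by (intro g_near; simp)+
    then have "g (- L) \<le> s" "s \<le> g L"
      using \<theta>\<tau>1 that L_def unfolding abs_le_iff by linarith+
    then obtain t where "- L \<le> t" "t \<le> L" "g t = s"
      using IVT'[of g "- L" s L] gc L by auto
    then show ?thesis by force
  qed
  have f: "g (f s) = s" "\<bar>f s\<bar> \<le> L0 + 1 / 2" "\<bar>f s - s\<bar> \<le> \<theta> * \<tau>1 / 2" if "\<bar>s\<bar> \<le> L0" for s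
  proof -
    show gf: "g (f s) = s" unfolding f_def by (rule f_inv_into_f[OF surj[OF that]])
    have "f s \<in> {- L..L}" unfolding f_def by (rule inv_into_into[OF surj[OF that]])
    then have "\<bar>f s\<bar> \<le> L" by auto
    from g_near[OF this] show 1: "\<bar>f s - s\<bar> \<le> \<theta> * \<tau>1 / 2" unfolding gf by (simp add: abs_minus_commute)
    show "\<bar>f s\<bar> \<le> L0 + 1 / 2" using 1 \<theta>\<tau>1 that by linarith
  qed
  define u where "u = (\<lambda>x. f (\<psi> x) + \<theta> * \<nu> / 2 * (norm x)\<^sup>2)"
  have uc: "continuous_on D u"
    unfolding u_def
    by (intro continuous_intros continuous_on_compose2[OF fc \<psi>D]) (use surj L0 in auto)
  have un: "\<bar>u x - \<psi> x\<bar> \<le> \<eta>" if x: "x \<in> D" for x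
  proof -
    have "(norm x)\<^sup>2 \<le> R\<^sup>2" using R(2)[OF x] by (intro power_mono) auto
    then have "\<nu> * (norm x)\<^sup>2 \<le> 1 * R\<^sup>2" using \<nu> by (intro mult_mono) auto
    then have "\<theta> * (\<nu> * (norm x)\<^sup>2) \<le> \<theta> * R\<^sup>2" using \<theta>(1) by simp
    moreover have "0 \<le> \<theta> * (\<nu> * (norm x)\<^sup>2)" using \<theta>(1) \<nu>(1) by simp
    ultimately have "\<bar>\<theta> * \<nu> / 2 * (norm x)\<^sup>2\<bar> \<le> \<theta> * R\<^sup>2" by (simp add: mult.assoc)
    moreover have "\<theta> * \<tau>1 / 2 \<le> \<theta> * \<tau>1" using \<theta>(1) \<tau>1 by simp
    ultimately show ?thesis
      using f(3)[OF L0(1)[OF x]] \<theta>(3) unfolding u_def distrib_left by linarith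
  qed
  \<comment> \<open>A polynomial touching u from above, minus the added square, touches f(\<psi>);
    composed with the increasing g it is a test function for \<psi>. The cone property permits
    division by g'(t), which normalises the Hessian part to A - \<theta>\<nu>I.\<close>
  have jet: "A + \<alpha> *\<^sub>R outer p p - (\<beta> * (norm p)\<^sup>2 + \<theta> * \<nu> / 4) *\<^sub>R mat 1 \<in> closure U"
    if y: "y \<in> \<Omega>" and A: "A \<in> sym_matrices" and touch: "\<forall>\<^sub>F y' in nhds y. u y' \<le> quadratic (u y) p A y y'" for y p A
  proof -
    have yD: "y \<in> D" using y \<Omega>D by blast
    define t where "t = f (\<psi> y)"
    have t: "\<bar>t\<bar> \<le> L0 + 1 / 2" "g t = \<psi> y" using f[OF L0(1)[OF yD]] by (auto simp: t_def)
    have tL: "\<bar>t\<bar> \<le> L" using t by (simp add: L_def)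
    define e r B where "e = (\<theta> * \<nu>) *\<^sub>R y" and "r = p - e" and "B = A - (\<theta> * \<nu>) *\<^sub>R mat 1"
    have B: "B \<in> sym_matrices" unfolding B_def by (intro sym_matrices_intros A)
    have quad: "quadratic (u y) p A y y' - \<theta> * \<nu> / 2 * (norm y')\<^sup>2 = quadratic t r B y y'" for y'
    proof -
      define d where "d = y' - y"
      have y': "y' = y + d" by (simp add: d_def)
      have 1: "(norm y')\<^sup>2 = (norm y)\<^sup>2 + 2 * (y \<bullet> d) + d \<bullet> d"
        unfolding y' power2_norm_eq_inner by (simp add: inner_add_left inner_add_right inner_commute)
      have 2: "d \<bullet> (B *v d) = d \<bullet> (A *v d) - \<theta> * \<nu> * (d \<bullet> d)"
        by (simp add: B_def matrix_vector_mult_diff_rdistrib matrix_vector_mult_mat_scaled inner_diff_right)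
      have 3: "r \<bullet> d = p \<bullet> d - \<theta> * \<nu> * (y \<bullet> d)"
        by (simp add: r_def e_def inner_diff_left)
      show ?thesis
        unfolding quadratic_def d_def[symmetric] u_def t_def[symmetric] 1 2 3 by (simp add: field_simps)
    qed
    have "isCont (quadratic t r B y) y"
      by (rule has_derivative_continuous[OF quadratic_has_derivative[OF gd gd' g''c B]])
    moreover have "quadratic t r B y y = t" by (simp add: quadratic_def)
    ultimately have "(quadratic t r B y \<longlongrightarrow> t) (nhds y)"
      by (metis isCont_def tendsto_nhds_iff)
    then have "((\<lambda>y'. \<bar>quadratic t r B y y'\<bar>) \<longlongrightarrow> \<bar>t\<bar>) (nhds y)"
      by (rule tendsto_rabs)
    then have ev1: "\<forall>\<^sub>F y' in nhds y. \<bar>quadratic t r B y y'\<bar> < L"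
      using t by (intro order_tendstoD) (auto simp: L_def)
    have ev2: "\<forall>\<^sub>F y' in nhds y. y' \<in> \<Omega>"
      by (rule eventually_nhds_in_open[OF \<Omega>(2) y])
    have "\<forall>\<^sub>F y' in nhds y. \<psi> y' \<le> g (quadratic t r B y y')"
      using ev1 ev2 touch
    proof eventually_elim
      case (elim y')
      have y'D: "y' \<in> D" using elim \<Omega>D by blast
      note fy = f[OF L0(1)[OF y'D]]
      have le: "f (\<psi> y') \<le> quadratic t r B y y'"
        using elim(3) unfolding quad[symmetric] u_def by simp
      have "g (f (\<psi> y')) \<le> g (quadratic t r B y y')"
      proof (cases "f (\<psi> y') = quadratic t r B y y'")
        case False
        then show ?thesis
          using le fy(2) elim(1) by (intro less_imp_le g_mono) (auto simp: L_def)
      qed simp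
      then show ?case using fy(1) by simp
    qed
    from viscosity_touch_above[OF gd gd' g''c B \<psi>(2) y t(2)[symmetric] this]
    have "g' t *\<^sub>R B + (g'' t + \<alpha> * (g' t)\<^sup>2) *\<^sub>R outer r r - (\<beta> * (g' t)\<^sup>2 * (norm r)\<^sup>2) *\<^sub>R mat 1 \<in> closure U"
      (is "?X \<in> _") .
    moreover have g't: "0 < g' t" using g'b[OF tL] by linarith
    ultimately have X: "(1 / g' t) *\<^sub>R ?X \<in> closure U"
      by (intro closure_cone_scaleR[OF U(3)]) auto
    let ?Y = "A + \<alpha> *\<^sub>R outer p p - (\<beta> * (norm p)\<^sup>2 + \<theta> * \<nu> / 4) *\<^sub>R mat 1"
    \<comment> \<open>\<open>strictness_gain\<close> provides \<theta>\<nu>/2: one half becomes the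
      \<delta> of the conclusion, the other is the margin for entering U.\<close>
    have "?Y \<in> U"
    proof (rule closure_add_mem[OF U(1,2) X, of _ "\<theta> * \<nu> / 4"])
      show "?Y \<in> sym_matrices" by (intro sym_matrices_intros A)
      show "0 < \<theta> * \<nu> / 4" using \<theta>(1) \<nu>(1) by simp
      fix \<xi> :: "real^'n"
      define a N where "a = \<xi> \<bullet> r" and "N = (norm \<xi>)\<^sup>2"
      have pr: "p = r + e" by (simp add: r_def)
      have np: "(norm p)\<^sup>2 = (norm r)\<^sup>2 + 2 * (r \<bullet> e) + (norm e)\<^sup>2"
        unfolding pr power2_norm_eq_inner by (simp add: inner_add_left inner_add_right inner_commute)
      have N: "N = \<xi> \<bullet> \<xi>" by (simp add: N_def power2_norm_eq_inner)
      have ap: "a + \<xi> \<bullet> e = \<xi> \<bullet> p" by (simp add: a_def pr inner_add_right)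
      have Yf: "\<xi> \<bullet> (?Y *v \<xi>) = \<xi> \<bullet> (A *v \<xi>) + \<alpha> * (a + \<xi> \<bullet> e)\<^sup>2 - (\<beta> * ((norm r)\<^sup>2 + 2 * (r \<bullet> e) + (norm e)\<^sup>2) + \<theta> * \<nu> / 4) * N"
        unfolding np[symmetric] ap N
        by (simp add: matrix_vector_mult_diff_rdistrib matrix_vector_mult_add_rdistrib matrix_vector_mult_mat_scaled outer_mult
            inner_add_right inner_diff_right inner_commute power2_eq_square[of "_ \<bullet> _"]
            flip: scaleR_matrix_vector_assoc)
      have "\<xi> \<bullet> (?X *v \<xi>) = g' t * (\<xi> \<bullet> (A *v \<xi>) - \<theta> * \<nu> * N) + (g'' t + \<alpha> * (g' t)\<^sup>2) * a\<^sup>2 - \<beta> * (g' t)\<^sup>2 * (norm r)\<^sup>2 * N"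
        unfolding B_def N a_def
        by (simp add: matrix_vector_mult_diff_rdistrib matrix_vector_mult_add_rdistrib matrix_vector_mult_mat_scaled outer_mult
            inner_add_right inner_diff_right inner_commute power2_eq_square[of "_ \<bullet> _"]
            flip: scaleR_matrix_vector_assoc)
      then have Xf: "\<xi> \<bullet> (((1 / g' t) *\<^sub>R ?X) *v \<xi>) = \<xi> \<bullet> (A *v \<xi>) - \<theta> * \<nu> * N + (g'' t + \<alpha> * (g' t)\<^sup>2) / g' t * a\<^sup>2 - \<beta> * g' t * (norm r)\<^sup>2 * N"
        unfolding scaleR_matrix_vector_assoc[symmetric] inner_scaleR_right using g't
        by (simp add: field_simps power2_eq_square)
      have "\<theta> * \<nu> / 2 * N \<le> \<theta> * \<nu> * N + \<alpha> * (a + \<xi> \<bullet> e)\<^sup>2 - (- (\<theta> * k * \<tau> t) + \<alpha> * (g' t)\<^sup>2) / g' t * a\<^sup>2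
          - \<beta> * ((norm r)\<^sup>2 + 2 * (r \<bullet> e) + (norm e)\<^sup>2) * N + \<beta> * g' t * (norm r)\<^sup>2 * N"
      proof (rule strictness_gain[OF \<theta>(1,2) \<tau>0 \<tau>(1)[OF tL] \<sigma>(1,2) _ g'b[OF tL] k_def])
        show "g' t = 1 + \<theta> * \<sigma> * \<tau> t" by (simp add: g'_def)
        show "0 \<le> N" by (simp add: N_def)
        have "\<bar>\<xi> \<bullet> e\<bar>\<^sup>2 \<le> (norm \<xi> * norm e)\<^sup>2"
          by (intro power_mono Cauchy_Schwarz_ineq2) auto
        then show "(\<xi> \<bullet> e)\<^sup>2 \<le> N * (norm e)\<^sup>2" by (simp add: N_def power_mult_distrib)
        show "norm e \<le> \<theta> * \<nu> * R"
          unfolding e_def using R(2)[OF yD] \<theta>(1) \<nu>(1) by simp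
        show "\<bar>r \<bullet> e\<bar> \<le> norm r * norm e" by (rule Cauchy_Schwarz_ineq2)
        show "\<nu> * R\<^sup>2 * ((\<alpha>\<^sup>2 + \<bar>\<beta>\<bar>) / \<tau>0 + \<bar>\<alpha>\<bar> + \<bar>\<beta>\<bar>) \<le> 1 / 2" using \<nu>(3) by (simp add: W_def)
      qed (use \<nu> in auto)
      moreover have "0 \<le> \<theta> * \<nu> * N" using \<theta>(1) \<nu>(1) by (simp add: N_def)
      ultimately show "\<theta> * \<nu> / 4 * (norm \<xi>)\<^sup>2 \<le> \<xi> \<bullet> (?Y *v \<xi>) - \<xi> \<bullet> (((1 / g' t) *\<^sub>R ?X) *v \<xi>)"
        unfolding Yf Xf unfolding g''_def N_def[symmetric] by (simp add: algebra_simps)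
    qed
    then show ?thesis using closure_subset by blast
  qed
  show ?thesis
    using uc un jet \<theta>(1) \<nu>(1) unfolding D_def
    by (intro exI[of _ u] exI[of _ "\<theta> * \<nu> / 4"]) auto
qed

text \<open>The margin \<delta> of the strict subsolution absorbs the errors in slopes and Hessians
  from the theorem on sums. Hence the matrix tested for v falls into U, which the viscosity
  condition for v forbids.\<close>

theorem comparison_principle:
  fixes \<Omega> :: "(real^'n) set" and u v :: "real^'n \<Rightarrow> real"
  assumes \<Omega>: "bounded \<Omega>" "open \<Omega>" and U: "U \<subseteq> sym_matrices"
      "\<And>A B. A \<in> U \<Longrightarrow> B \<in> sym_matrices \<Longrightarrow> pos_def B \<Longrightarrow> A + B \<in> U"
      "\<And>A c. A \<in> U \<Longrightarrow> c > 0 \<Longrightarrow> c *\<^sub>R A \<in> U"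
    and u: "continuous_on (closure \<Omega>) u" "viscosity_boundary (F_op \<alpha> \<beta>) U \<Omega> u"
    and v: "continuous_on (closure \<Omega>) v" "viscosity_boundary (F_op \<alpha> \<beta>) U \<Omega> v"
    and bd: "\<And>x. x \<in> frontier \<Omega> \<Longrightarrow> u x \<le> v x" and x: "x \<in> closure \<Omega>"
  shows "u x \<le> v x"
proof (rule ccontr)
  assume "\<not> u x \<le> v x"
  define d where "d = u x - v x"
  have d: "0 < d" using \<open>\<not> u x \<le> v x\<close> by (simp add: d_def)
  \<comment> \<open>With |w - u| \<le> d/4 the difference w - v is at most d/4 on the boundary and
    at least 3d/4 at x.\<close>
  then have "0 < d / 4" by simp
  from strict_subsolution[OF \<Omega> U u this] obtain w \<delta> where \<delta>: "0 < \<delta>" and w: "continuous_on (closure \<Omega>) w"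
    and near: "\<And>x. x \<in> closure \<Omega> \<Longrightarrow> \<bar>w x - u x\<bar> \<le> d / 4"
    and jet: "\<And>y p A. y \<in> \<Omega> \<Longrightarrow> A \<in> sym_matrices \<Longrightarrow> (\<forall>\<^sub>F y' in nhds y. w y' \<le> quadratic (w y) p A y y') \<Longrightarrow>
      A + \<alpha> *\<^sub>R outer p p - (\<beta> * (norm p)\<^sup>2 + \<delta>) *\<^sub>R mat 1 \<in> closure U"
    by blast
  have "compact (closure \<Omega>)" "closure \<Omega> \<noteq> {}" using \<Omega>(1) x by auto
  moreover have "continuous_on (closure \<Omega>) (\<lambda>y. w y - v y)" by (intro continuous_intros w v)
  ultimately obtain x0 where x0: "x0 \<in> closure \<Omega>" "\<And>y. y \<in> closure \<Omega> \<Longrightarrow> w y - v y \<le> w x0 - v x0"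
    using continuous_attains_sup[of "closure \<Omega>" "\<lambda>y. w y - v y"] by blast
  have "w y - v y < w x0 - v x0" if "y \<in> frontier \<Omega>" for y
  proof -
    have "y \<in> closure \<Omega>" using that by (simp add: frontier_def)
    from near[OF this] show ?thesis
      using near[OF x] bd[OF that] x0(2)[OF x] d d_def unfolding abs_le_iff by linarith
  qed
  from approximate_theorem_on_sums[OF \<Omega>(2,1) w v(1) x0(1) this]
  obtain K where K: "\<And>\<delta>. 0 < \<delta> \<Longrightarrow> \<exists>A\<in>sym_matrices. \<exists>y\<in>\<Omega>. \<exists>z\<in>\<Omega>. \<exists>p1 p2.
     norm p1 \<le> K \<and> norm p2 \<le> K \<and> norm (p1 - p2) \<le> \<delta> \<and>
     (\<forall>\<^sub>F y' in nhds y. w y' \<le> w y + p1 \<bullet> (y' - y) + ((y' - y) \<bullet> (A *v (y' - y)) + \<delta> * (norm (y' - y))\<^sup>2) / 2) \<and>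
     (\<forall>\<^sub>F z' in nhds z. v z' \<ge> v z + p2 \<bullet> (z' - z) + ((z' - z) \<bullet> (A *v (z' - z)) - \<delta> * (norm (z' - z))\<^sup>2) / 2)"
    by blast
  \<comment> \<open>The Hessian errors contribute 2\<epsilon> and the slopes 2|K|\<epsilon> times
    |\<alpha>| + |\<beta>|; \<epsilon> makes the total \<delta>/2. This is possible because K is
    known before \<epsilon> is chosen.\<close>
  define c where "c = 2 + 2 * \<bar>K\<bar> * (\<bar>\<alpha>\<bar> + \<bar>\<beta>\<bar>)"
  have c: "0 < c" by (simp add: c_def add_pos_nonneg)
  define \<epsilon> where "\<epsilon> = \<delta> / (2 * c)"
  have \<epsilon>: "0 < \<epsilon>" "c * \<epsilon> = \<delta> / 2" using \<delta> c by (simp_all add: \<epsilon>_def)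
  obtain A y z p1 p2 where A: "A \<in> sym_matrices" and yz: "y \<in> \<Omega>" "z \<in> \<Omega>"
    and p: "norm p1 \<le> K" "norm p2 \<le> K" "norm (p1 - p2) \<le> \<epsilon>"
    and t1: "\<forall>\<^sub>F y' in nhds y. w y' \<le> w y + p1 \<bullet> (y' - y) + ((y' - y) \<bullet> (A *v (y' - y)) + \<epsilon> * (norm (y' - y))\<^sup>2) / 2"
    and t2: "\<forall>\<^sub>F z' in nhds z. v z' \<ge> v z + p2 \<bullet> (z' - z) + ((z' - z) \<bullet> (A *v (z' - z)) - \<epsilon> * (norm (z' - z))\<^sup>2) / 2"
    using K[OF \<epsilon>(1)] by blast
  define A1 A2 where "A1 = A + \<epsilon> *\<^sub>R mat 1" and "A2 = A - \<epsilon> *\<^sub>R mat 1"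
  have A12: "A1 \<in> sym_matrices" "A2 \<in> sym_matrices" unfolding A1_def A2_def by (intro sym_matrices_intros A)+
  have q1: "\<xi> \<bullet> (A1 *v \<xi>) = \<xi> \<bullet> (A *v \<xi>) + \<epsilon> * (norm \<xi>)\<^sup>2" and q2: "\<xi> \<bullet> (A2 *v \<xi>) = \<xi> \<bullet> (A *v \<xi>) - \<epsilon> * (norm \<xi>)\<^sup>2" for \<xi>
    by (simp_all add: A1_def A2_def matrix_vector_mult_add_rdistrib matrix_vector_mult_diff_rdistrib
        matrix_vector_mult_mat_scaled inner_add_right inner_diff_right power2_norm_eq_inner)
  have X: "A1 + \<alpha> *\<^sub>R outer p1 p1 - (\<beta> * (norm p1)\<^sup>2 + \<delta>) *\<^sub>R mat 1 \<in> closure U" (is "?X \<in> _")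
    using t1 by (intro jet[OF yz(1) A12(1)]) (simp add: quadratic_def q1)
  have Y: "A2 + \<alpha> *\<^sub>R outer p2 p2 - (\<beta> * (norm p2)\<^sup>2) *\<^sub>R mat 1 \<in> sym_matrices - U" (is "?Y \<in> _")
    using viscosity_touch_below[of "\<lambda>t. t" "\<lambda>t. 1" "\<lambda>t. 0", OF _ _ _ A12(2) v(2) yz(2), of "v z" p2] t2
    by (simp add: quadratic_def q2)
  have "?Y \<in> U"
  proof (rule closure_add_mem[OF U(1,2) X, of _ "\<delta> / 2"])
    show "?Y \<in> sym_matrices" using Y by simp
    show "0 < \<delta> / 2" using \<delta> by simp
    fix \<xi> :: "real^'n"
    define N where "N = (norm \<xi>)\<^sup>2"
    have K0: "norm p1 + norm p2 \<le> 2 * \<bar>K\<bar>" using p by linarith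
    have 1: "\<bar>(\<xi> \<bullet> p2)\<^sup>2 - (\<xi> \<bullet> p1)\<^sup>2\<bar> \<le> 2 * \<bar>K\<bar> * \<epsilon> * N"
    proof -
      have "(\<xi> \<bullet> p2)\<^sup>2 - (\<xi> \<bullet> p1)\<^sup>2 = (\<xi> \<bullet> (p1 + p2)) * (\<xi> \<bullet> (p2 - p1))"
        by (simp add: inner_add_right inner_diff_right power2_eq_square algebra_simps)
      also have "\<bar>\<dots>\<bar> \<le> (norm \<xi> * norm (p1 + p2)) * (norm \<xi> * norm (p2 - p1))"
        unfolding abs_mult by (intro mult_mono Cauchy_Schwarz_ineq2) auto
      also have "\<dots> \<le> (norm \<xi> * (2 * \<bar>K\<bar>)) * (norm \<xi> * \<epsilon>)"
        using K0 p(3) norm_triangle_ineq[of p1 p2]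
        by (intro mult_mono) (auto simp: norm_minus_commute)
      finally show ?thesis by (simp add: N_def power2_eq_square mult_ac)
    qed
    have 2: "\<bar>(norm p2)\<^sup>2 - (norm p1)\<^sup>2\<bar> \<le> 2 * \<bar>K\<bar> * \<epsilon>"
    proof -
      have "(norm p2)\<^sup>2 - (norm p1)\<^sup>2 = (norm p1 + norm p2) * (norm p2 - norm p1)"
        by (simp add: power2_eq_square algebra_simps)
      also have "\<bar>\<dots>\<bar> \<le> 2 * \<bar>K\<bar> * \<epsilon>"
        unfolding abs_mult using K0 p(3) norm_triangle_ineq3[of p2 p1]
        by (intro mult_mono) (auto simp: norm_minus_commute)
      finally show ?thesis .
    qed
    have "\<bar>\<alpha> * ((\<xi> \<bullet> p2)\<^sup>2 - (\<xi> \<bullet> p1)\<^sup>2)\<bar> \<le> \<bar>\<alpha>\<bar> * (2 * \<bar>K\<bar> * \<epsilon> * N)"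
      unfolding abs_mult by (rule mult_left_mono[OF 1]) simp
    moreover have "\<bar>\<beta> * (((norm p2)\<^sup>2 - (norm p1)\<^sup>2) * N)\<bar> \<le> \<bar>\<beta>\<bar> * (2 * \<bar>K\<bar> * \<epsilon> * N)"
      unfolding abs_mult using 2 \<epsilon>(1) by (intro mult_left_mono mult_mono) (auto simp: N_def)
    moreover have "\<xi> \<bullet> (?Y *v \<xi>) - \<xi> \<bullet> (?X *v \<xi>) = (\<delta> - 2 * \<epsilon>) * N + \<alpha> * ((\<xi> \<bullet> p2)\<^sup>2 - (\<xi> \<bullet> p1)\<^sup>2)
        - \<beta> * (((norm p2)\<^sup>2 - (norm p1)\<^sup>2) * N)"
    proof -
      have "\<xi> \<bullet> (?X *v \<xi>) = \<xi> \<bullet> (A1 *v \<xi>) + \<alpha> * (\<xi> \<bullet> p1)\<^sup>2 - (\<beta> * (norm p1)\<^sup>2 + \<delta>) * N"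
           "\<xi> \<bullet> (?Y *v \<xi>) = \<xi> \<bullet> (A2 *v \<xi>) + \<alpha> * (\<xi> \<bullet> p2)\<^sup>2 - \<beta> * (norm p2)\<^sup>2 * N"
        by (simp_all add: matrix_vector_mult_diff_rdistrib matrix_vector_mult_add_rdistrib matrix_vector_mult_mat_scaled outer_mult
            inner_add_right inner_diff_right power2_norm_eq_inner[of \<xi>] N_def inner_commute power2_eq_square[of "_ \<bullet> _"]
            flip: scaleR_matrix_vector_assoc)
      then show ?thesis
        unfolding q1 q2 N_def[symmetric] by (simp add: algebra_simps)
    qed
    ultimately have "(\<delta> - 2 * \<epsilon>) * N - \<bar>\<alpha>\<bar> * (2 * \<bar>K\<bar> * \<epsilon> * N) - \<bar>\<beta>\<bar> * (2 * \<bar>K\<bar> * \<epsilon> * N)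
        \<le> \<xi> \<bullet> (?Y *v \<xi>) - \<xi> \<bullet> (?X *v \<xi>)"
      by linarith
    moreover have "(\<delta> - 2 * \<epsilon>) * N - \<bar>\<alpha>\<bar> * (2 * \<bar>K\<bar> * \<epsilon> * N) - \<bar>\<beta>\<bar> * (2 * \<bar>K\<bar> * \<epsilon> * N) = (\<delta> - c * \<epsilon>) * N"
      by (simp add: c_def algebra_simps)
    ultimately show "\<delta> / 2 * (norm \<xi>)\<^sup>2 \<le> \<xi> \<bullet> (?Y *v \<xi>) - \<xi> \<bullet> (?X *v \<xi>)"
      unfolding \<epsilon>(2) N_def by simp
  qed
  then show False using Y by simp
qed

theorem theorem1p4:
  fixes \<Omega> :: "(real^'n) set" and U :: "(real^'n^'n) set" and \<alpha> \<beta> :: real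
    and \<phi> \<psi>1 \<psi>2 :: "real^'n \<Rightarrow> real"
  assumes "CARD('n) \<ge> 2"
    and "\<Omega> \<noteq> {}" and "bounded \<Omega>" and "open \<Omega>"
    and "U \<noteq> {}" and "openin (top_of_set sym_matrices) U"
    and "\<And>A B. A \<in> U \<Longrightarrow> B \<in> sym_matrices \<Longrightarrow> pos_def B \<Longrightarrow> A + B \<in> U"
    and "\<And>A c. A \<in> U \<Longrightarrow> c > 0 \<Longrightarrow> c *\<^sub>R A \<in> U"
    and "continuous_on (frontier \<Omega>) \<phi>"
    and "continuous_on (closure \<Omega>) \<psi>1" and "viscosity_boundary (F_op \<alpha> \<beta>) U \<Omega> \<psi>1"
    and "\<And>x. x \<in> frontier \<Omega> \<Longrightarrow> \<psi>1 x = \<phi> x"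
    and "continuous_on (closure \<Omega>) \<psi>2" and "viscosity_boundary (F_op \<alpha> \<beta>) U \<Omega> \<psi>2"
    and "\<And>x. x \<in> frontier \<Omega> \<Longrightarrow> \<psi>2 x = \<phi> x"
  shows "\<forall>x\<in>closure \<Omega>. \<psi>1 x = \<psi>2 x"
proof
  fix x assume x: "x \<in> closure \<Omega>"
  have U: "U \<subseteq> sym_matrices"
    using openin_imp_subset[OF assms(6)] .
  show "\<psi>1 x = \<psi>2 x"
  proof (rule antisym)
    show "\<psi>1 x \<le> \<psi>2 x"
      using assms(12,15) by (intro comparison_principle[OF assms(3,4) U assms(7,8,10,11,13,14) _ x]) auto
    show "\<psi>2 x \<le> \<psi>1 x"
      using assms(12,15) by (intro comparison_principle[OF assms(3,4) U assms(7,8,13,14,10,11) _ x]) auto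
  qed
qed

end
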